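(* Let $n\ge1$ and $M\ge2$ be integers. For every prime power $q$, $$\frac{|\mathrm{U}(n,q)^M|}{|\mathrm{U}(n,q)|}=\sum_{\substack{\lambda\vdash n\\ \lambda=1^{m_1}2^{m_2}\cdots i^{m_i}\cdots}}\ \prod_i\frac{1}{m_i!\,i^{m_i}\,(M,q^i-(-1)^i)^{m_i}}+\mathcal O(q^{-1}),$$ where the constant implied by $\mathcal O$ does not depend on $q$.
   Context: $\mathrm{U}(n,q)\subset \mathrm{GL}(n,q^2)$ is the finite unitary group, the group of fixed points of the Frobenius map $F\colon (a_{ij})\mapsto {}^t(a_{ij}^q)^{-1}$ on $\mathrm{GL}(n,\overline{\mathbb F_q})$, and $\mathrm{U}(n,q)^M=\{x^M:x\in \mathrm{U}(n,q)\}$. The sum is over all partitions $\lambda$ of $n$, in power notation: $m_i\ge0$ is the number of parts of $\lambda$ equal to $i$. $(a,b)$ is the greatest common divisor. *)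

theory Defs
  imports
    "HOL-Algebra.Algebraic_Closure"
    "HOL-Number_Theory.Prime_Powers"
    "Jordan_Normal_Form.Matrix"
begin

text \<open>
  The operations on \<^typ>\<open>'a mat\<close> provided by the library take their arithmetic from type
  classes.  Since the theorem quantifies over fields of every characteristic, the field has to be
  a ring record here: only the container (indexing, transposition, entrywise map) is reused, and
  the matrix product is spelled out with the operations of the record.
\<close>

definition mat_monoid :: "('a, 'b) ring_scheme \<Rightarrow> nat \<Rightarrow> 'a mat monoid" where
  "mat_monoid R n =
     \<lparr>carrier = {A \<in> carrier_mat n n. elements_mat A \<subseteq> carrier R},
      monoid.mult = (\<lambda>A B. mat n n (\<lambda>(i, j). \<Oplus>\<^bsub>R\<^esub>k\<in>{..<n}. A $$ (i, k) \<otimes>\<^bsub>R\<^esub> B $$ (k, j))),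
      one = mat n n (\<lambda>(i, j). if i = j then \<one>\<^bsub>R\<^esub> else \<zero>\<^bsub>R\<^esub>)\<rparr>"

definition general_linear_group :: "('a, 'b) ring_scheme \<Rightarrow> nat \<Rightarrow> 'a mat monoid" where
  "general_linear_group R n = units_of (mat_monoid R n)"

definition unitary_frobenius :: "('a, 'b) ring_scheme \<Rightarrow> nat \<Rightarrow> nat \<Rightarrow> 'a mat \<Rightarrow> 'a mat" where
  "unitary_frobenius L n q A =
     inv\<^bsub>general_linear_group L n\<^esub> (transpose_mat (map_mat (\<lambda>a. a [^]\<^bsub>L\<^esub> q) A))"

text \<open>
  The finite unitary group \<open>U(n,q)\<close>, where \<open>L\<close> is meant to be an algebraic closure of the field
  with \<open>q\<close> elements.  A fixed matrix has entries with \<open>a\<^sup>q\<^sup>2 = a\<close>, that is, in the subfield of \<open>L\<close>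
  with \<open>q\<^sup>2\<close> elements.
\<close>

definition unitary_group :: "('a, 'b) ring_scheme \<Rightarrow> nat \<Rightarrow> nat \<Rightarrow> 'a mat monoid" where
  "unitary_group L n q = (general_linear_group L n)
     \<lparr>carrier := {A \<in> carrier (general_linear_group L n). unitary_frobenius L n q A = A}\<rparr>"

definition power_image :: "('a, 'b) monoid_scheme \<Rightarrow> nat \<Rightarrow> 'a set" where
  "power_image G M = (\<lambda>x. x [^]\<^bsub>G\<^esub> M) ` carrier G"

text \<open>
  A partition of \<open>n\<close> is the multiset of its parts; the exponent \<open>m\<^sub>i\<close> in power notation is
  \<open>count \<mu> i\<close>.
\<close>

definition partitions_of :: "nat \<Rightarrow> nat multiset set" where
  "partitions_of n = {\<mu>. 0 \<notin># \<mu> \<and> sum_mset \<mu> = n}"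

end

theory Submission
  imports Defs "HOL-Number_Theory.Cong" "HOL-Combinatorics.Cycles"
begin

text \<open>
  Almost every element \<open>x\<close> of the unitary group has \<open>n\<close> distinct eigenvalues.  If the columns of
  \<open>g\<close> are eigenvectors of such an \<open>x\<close>, the twisted Frobenius map permutes the eigenlines by some
  \<open>s\<close>, and \<open>g\<close> can be scaled so that \<open>g w g\<^sup>* = 1\<close> with \<open>w\<close> the permutation matrix of \<open>s\<close> and
  \<open>g\<^sup>*\<close> the transpose of the matrix of \<open>q\<close>-th powers.  Conversely, for each cycle type \<open>\<mu>\<close> such a
  frame \<open>g\<close> exists (a case of Lang's theorem, proved by finding an orthonormal basis), and the elements
  \<open>(h g) D (h g)\<^sup>-\<^sup>1\<close>, with \<open>h\<close> unitary and \<open>D\<close> in the torus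
  \<open>T \<cong> \<Prod> C(q\<^sup>i - (-1)\<^sup>i)\<close> of type \<open>\<mu>\<close>, are unitary.  If \<open>D\<close> is regular, at most
  \<open>z |T|\<close> pairs \<open>(h, D)\<close> give the same element, where \<open>z\<close> is the order of the centralizer of \<open>s\<close>
  in the symmetric group; different types give disjoint sets; and the element is an \<open>M\<close>-th power in
  the unitary group iff \<open>D\<close> is one in \<open>T\<close>.  All but \<open>O(|T| / q)\<close> elements of \<open>T\<close> are regular.
  This bounds from below the number of \<open>M\<close>-th powers and also the number of elements that are not
  \<open>M\<close>-th powers.  Since \<open>\<Sum> 1/z = 1\<close>, the two bounds add up to the order of the group up to a factor
  \<open>1 - O(1/q)\<close>, so both are sharp; no independent estimate for the nonregular elements is needed.
\<close>

section \<open>Roots of unity and Frobenius in an algebraically closed field\<close>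

text \<open>Read row by row, g w g^* = 1 asks for n vectors that are orthonormal for
  \<open>form\<close>. Taking adjoints in this equation and cancelling shows that
  \<open>adj (adj g)\<close> is g w w; in coordinates this is v(s(s j)) = v(j)^(q^2), the condition
  that defines \<open>vecs\<close> and makes the form Hermitian. No notion of dimension is set up
  for \<open>vecs\<close>. All its vectors have coordinates in one finite subfield E, so a
  comparison of dimensions becomes a comparison of |E|^k with |E|^n along an injection, and
  nondegeneracy becomes a comparison of the number of roots of an additive polynomial with its
  degree. This is uniform in the characteristic, with no exception for 2. The constant 4 n^2 has two
  sources: at most n^2 pairs of eigenvalues can coincide, and each coincidence holds on at most a
  proportion 4 / q of the torus. The 4 absorbs the difference between q^k and q^k - (-1)^k, so that
  no lower bound on q is required.\<close>

lemma card_eq_fibre_card_mult: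
  assumes "finite A" and "\<And>y. y \<in> f ` A \<Longrightarrow> card {x \<in> A. f x = y} = k"
  shows "card A = k * card (f ` A)"
proof -
  have "card A = (\<Sum>x\<in>A. 1)" by simp
  also have "\<dots> = (\<Sum>y\<in>f ` A. \<Sum>x\<in>{x \<in> A. f x = y}. 1)"
    using sum.image_gen[OF assms(1)] by fastforce
  also have "\<dots> = (\<Sum>y\<in>f ` A. k)"
    by (rule sum.cong) (use assms(2) in auto)
  finally show ?thesis by simp
qed

text \<open>The polynomials of \<open>poly_ring\<close> are lists with the leading coefficient
  first, hence the \<open>rev\<close>. This translation lets everything below work with sums over
  exponents.\<close>

lemma (in field) poly_of_coeffs:
  assumes "c \<in> {..d} \<rightarrow> carrier R" and "c d \<noteq> \<zero>"
  defines "P \<equiv> map c (rev [0..<Suc d])"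
  shows "P \<in> carrier (poly_ring R)" and "length P = Suc d"
    and "x \<in> carrier R \<Longrightarrow> eval P x = (\<Oplus>i\<in>{..d}. c i \<otimes> x [^] i)"
proof -
  show "P \<in> carrier (poly_ring R)"
    using assms by (auto simp: P_def univ_poly_carrier[symmetric] polynomial_def Pi_def)
  show "length P = Suc d" by (simp add: P_def)
next
  assume x: "x \<in> carrier R"
  have "k \<le> Suc d \<Longrightarrow> eval (map c (rev [0..<k])) x = (\<Oplus>i\<in>{..<k}. c i \<otimes> x [^] i)" for k
  proof (induction k)
    case (Suc k)
    have "(\<Oplus>i\<in>{..<Suc k}. c i \<otimes> x [^] i) = c k \<otimes> x [^] k \<oplus> (\<Oplus>i\<in>{..<k}. c i \<otimes> x [^] i)"
      unfolding lessThan_Suc using Suc.prems x assms(1) by (subst finsum_insert) (auto simp: Pi_def)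
    then show ?case using Suc by simp
  qed simp
  from this[of "Suc d"] show "eval P x = (\<Oplus>i\<in>{..d}. c i \<otimes> x [^] i)"
    by (simp add: P_def lessThan_Suc_atMost)
qed

lemma (in field) roots_of_coeffs:
  assumes "c \<in> {..d} \<rightarrow> carrier R" and "c d \<noteq> \<zero>"
  shows "finite {x \<in> carrier R. (\<Oplus>i\<in>{..d}. c i \<otimes> x [^] i) = \<zero>}"
    and "card {x \<in> carrier R. (\<Oplus>i\<in>{..d}. c i \<otimes> x [^] i) = \<zero>} \<le> d"
proof -
  define P where "P = map c (rev [0..<Suc d])"
  note P = poly_of_coeffs[OF assms, folded P_def]
  have "P \<noteq> []" using P(2) by auto
  then have eq: "{x \<in> carrier R. (\<Oplus>i\<in>{..d}. c i \<otimes> x [^] i) = \<zero>} = set_mset (roots P)"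
    using P by (auto simp: roots_mem_iff_is_root is_root_def)
  show "finite {x \<in> carrier R. (\<Oplus>i\<in>{..d}. c i \<otimes> x [^] i) = \<zero>}" by (simp add: eq)
  have "card (set_mset (roots P)) \<le> size (roots P)"
    using size_mset_mono[OF mset_set_set_mset_msubset[of "roots P"]] by simp
  then show "card {x \<in> carrier R. (\<Oplus>i\<in>{..d}. c i \<otimes> x [^] i) = \<zero>} \<le> d"
    using size_roots_le_degree[OF P(1)] P(2) by (simp add: eq)
qed

lemma (in algebraically_closed) ex_root_of_coeffs:
  fixes d :: nat
  assumes "c \<in> {..d} \<rightarrow> carrier L" and "c d \<noteq> \<zero>" and "d > 0"
  shows "\<exists>x\<in>carrier L. (\<Oplus>i\<in>{..d}. c i \<otimes> x [^] i) = \<zero>"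
proof -
  define P where "P = map c (rev [0..<Suc d])"
  note P = poly_of_coeffs[OF assms(1,2), folded P_def]
  have "size (roots P) = d"
    using roots_over_carrier[OF P(1)] P(2) by (simp add: splitted_def)
  then obtain x where "x \<in># roots P" using assms(3) by (metis neq0_conv size_empty multiset_nonemptyE)
  then have "is_root P x" using P(1) by (simp add: roots_mem_iff_is_root)
  then show ?thesis using P by (auto simp: is_root_def)
qed

lemma (in field) binomial_coeffs:
  fixes N :: nat
  assumes "a \<in> carrier R" "N > 0" "x \<in> carrier R"
  shows "(\<Oplus>i\<in>{..N}. (if i = N then \<one> else if i = 0 then \<ominus> a else \<zero>) \<otimes> x [^] i) = x [^] N \<ominus> a"
proof -
  have "(\<Oplus>i\<in>{..N}. (if i = N then \<one> else if i = 0 then \<ominus> a else \<zero>) \<otimes> x [^] i)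
      = (\<Oplus>i\<in>{N, 0}. (if i = N then \<one> else if i = 0 then \<ominus> a else \<zero>) \<otimes> x [^] i)"
    by (rule add.finprod_mono_neutral_cong_right) (use assms in auto)
  also have "\<dots> = x [^] N \<ominus> a"
    using assms by (subst finsum_insert) (auto simp: a_minus_def)
  finally show ?thesis .
qed

lemma (in field) nth_roots_bound:
  fixes N :: nat
  assumes "a \<in> carrier R" "N > 0"
  shows "finite {x \<in> carrier R. x [^] N = a}" "card {x \<in> carrier R. x [^] N = a} \<le> N"
proof -
  let ?c = "\<lambda>i. if i = N then \<one> else if i = 0 then \<ominus> a else \<zero>"
  have eq: "{x \<in> carrier R. x [^] N = a} = {x \<in> carrier R. (\<Oplus>i\<in>{..N}. ?c i \<otimes> x [^] i) = \<zero>}"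
    using assms by (auto simp: binomial_coeffs)
  have c: "?c \<in> {..N} \<rightarrow> carrier R" "?c N \<noteq> \<zero>" using assms by auto
  show "finite {x \<in> carrier R. x [^] N = a}" unfolding eq by (rule roots_of_coeffs(1)[OF c])
  show "card {x \<in> carrier R. x [^] N = a} \<le> N" unfolding eq by (rule roots_of_coeffs(2)[OF c])
qed

lemma (in algebraically_closed) ex_nth_root:
  fixes N :: nat
  assumes "a \<in> carrier L" "N > 0"
  shows "\<exists>x\<in>carrier L. x [^] N = a"
proof -
  let ?c = "\<lambda>i. if i = N then \<one> else if i = 0 then \<ominus> a else \<zero>"
  have c: "?c \<in> {..N} \<rightarrow> carrier L" "?c N \<noteq> \<zero>" using assms by auto
  show ?thesis using ex_root_of_coeffs[OF c assms(2)] assms by (auto simp: binomial_coeffs)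
qed

section \<open>Additivity of the Frobenius map\<close>

lemma (in cring) binomial_ring:
  assumes a: "a \<in> carrier R" and b: "b \<in> carrier R"
  shows "(a \<oplus> b) [^] (n::nat) = (\<Oplus>k\<in>{..n}. [(n choose k)] \<cdot> (a [^] k \<otimes> b [^] (n - k)))"
proof (induction n)
  case (Suc n)
  let ?t = "\<lambda>n k. [(n choose k)] \<cdot> (a [^] k \<otimes> b [^] (n - k))"
  have "(\<Oplus>k\<in>{..Suc n}. ?t (Suc n) k) = (\<Oplus>k\<in>{..n}. ?t (Suc n) (Suc k)) \<oplus> ?t (Suc n) 0"
    using a b by (subst finsum_Suc2) (auto simp: Pi_def)
  also have "(\<Oplus>k\<in>{..n}. ?t (Suc n) (Suc k))
      = (\<Oplus>k\<in>{..n}. a \<otimes> ?t n k \<oplus> (if k = n then \<zero> else b \<otimes> ?t n (Suc k)))"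
  proof (rule finsum_cong', goal_cases)
    case (3 k)
    then have k: "k \<le> n" by simp
    have 1: "[(n choose k)] \<cdot> (a [^] Suc k \<otimes> b [^] (n - k)) = a \<otimes> ?t n k"
      using a b by (simp add: add_pow_rdistr m_ac nat_pow_Suc2)
    have 2: "[(n choose Suc k)] \<cdot> (a [^] Suc k \<otimes> b [^] (n - k)) = (if k = n then \<zero> else b \<otimes> ?t n (Suc k))"
    proof (cases "k = n")
      case False
      then have "n - k = Suc (n - Suc k)" using k by simp
      then show ?thesis using a b False by (simp add: add_pow_rdistr m_ac)
    qed (simp add: binomial_eq_0)
    show ?case using a b unfolding 1[symmetric] 2[symmetric]
      by (simp add: add.nat_pow_mult add.m_comm)
  qed (use a b in auto)
  also have "\<dots> = a \<otimes> (\<Oplus>k\<in>{..n}. ?t n k) \<oplus> (\<Oplus>k\<in>{..n}. if k = n then \<zero> else b \<otimes> ?t n (Suc k))"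
    using a b by (subst finsum_addf) (auto simp: finsum_rdistr)
  also have "(\<Oplus>k\<in>{..n}. if k = n then \<zero> else b \<otimes> ?t n (Suc k)) = (\<Oplus>k\<in>{..<n}. b \<otimes> ?t n (Suc k))"
    by (rule add.finprod_mono_neutral_cong_right) (use a b in auto)
  also have "?t (Suc n) 0 = b \<otimes> ?t n 0" using a b by (simp add: m_comm)
  also have "a \<otimes> (\<Oplus>k\<in>{..n}. ?t n k) \<oplus> (\<Oplus>k\<in>{..<n}. b \<otimes> ?t n (Suc k)) \<oplus> b \<otimes> ?t n 0
     = a \<otimes> (\<Oplus>k\<in>{..n}. ?t n k) \<oplus> ((\<Oplus>k\<in>{..<n}. b \<otimes> ?t n (Suc k)) \<oplus> b \<otimes> ?t n 0)"
    using a b by (intro a_assoc) auto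
  also have "(\<Oplus>k\<in>{..<n}. b \<otimes> ?t n (Suc k)) \<oplus> b \<otimes> ?t n 0 = (\<Oplus>k\<in>{..n}. b \<otimes> ?t n k)"
  proof (cases n)
    case (Suc m)
    then show ?thesis using a b unfolding Suc lessThan_Suc_atMost by (subst finsum_Suc2[of _ m]) (auto simp: Pi_def)
  qed (use a b in simp)
  also have "\<dots> = b \<otimes> (\<Oplus>k\<in>{..n}. ?t n k)" using a b by (intro finsum_rdistr[symmetric]) auto
  also have "a \<otimes> (\<Oplus>k\<in>{..n}. ?t n k) \<oplus> b \<otimes> (\<Oplus>k\<in>{..n}. ?t n k) = (a \<oplus> b) \<otimes> (a \<oplus> b) [^] n"
    using a b Suc.IH by (simp add: l_distr)
  finally show ?case using a b by (simp add: m_comm)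
qed (use assms in simp)

lemma (in cring) frobenius_add_prime:
  assumes p: "prime p" "[p] \<cdot> \<one> = \<zero>" and a: "a \<in> carrier R" and b: "b \<in> carrier R"
  shows "(a \<oplus> b) [^] (p::nat) = a [^] p \<oplus> b [^] p"
proof -
  have p0: "p > 0" using p(1) prime_gt_0_nat by blast
  have ann: "[m] \<cdot> x = \<zero>" if "p dvd m" "x \<in> carrier R" for m x
  proof -
    from that(1) obtain k where "m = p * k" by (elim dvdE)
    then have "[m] \<cdot> x = [k] \<cdot> ([p] \<cdot> \<one> \<otimes> x)"
      using that by (simp add: add.nat_pow_pow add_pow_ldistr)
    then show ?thesis using p that by simp
  qed
  have "(a \<oplus> b) [^] p = (\<Oplus>k\<in>{0, p}. [(p choose k)] \<cdot> (a [^] k \<otimes> b [^] (p - k)))"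
    unfolding binomial_ring[OF a b]
  proof (rule add.finprod_mono_neutral_cong_right, goal_cases)
    case (3 i)
    then have "p dvd (p choose i)" by (intro dvd_choose_prime) (use p in auto)
    then show ?case using ann a b by simp
  qed (use a b in auto)
  also have "\<dots> = b [^] p \<oplus> a [^] p"
    using a b p0 by (subst finsum_insert) auto
  finally show ?thesis using a b by (simp add: a_comm)
qed

lemma (in cring) frobenius_add_prime_power:
  assumes "prime p" "[p] \<cdot> \<one> = \<zero>" "a \<in> carrier R" "b \<in> carrier R"
  shows "(a \<oplus> b) [^] (p ^ k :: nat) = a [^] (p ^ k) \<oplus> b [^] (p ^ k)"
proof (induction k)
  case (Suc k)
  have "x [^] (p ^ Suc k) = (x [^] (p ^ k)) [^] p" if "x \<in> carrier R" for x
    using that by (simp add: nat_pow_pow mult.commute)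
  then show ?case using assms Suc by (simp add: frobenius_add_prime del: power_Suc)
qed (use assms in simp)

lemma (in domain) nat_pow_nonzero: "x \<in> carrier R \<Longrightarrow> x \<noteq> \<zero> \<Longrightarrow> x [^] (k::nat) \<noteq> \<zero>"
  by (induction k) (auto simp: integral_iff)

lemma (in field) geometric_sum:
  assumes "x \<in> carrier R"
  shows "(x \<ominus> \<one>) \<otimes> (\<Oplus>i\<in>{..<n}. x [^] i) = x [^] (n::nat) \<ominus> \<one>"
proof (induction n)
  case (Suc n)
  have "(\<Oplus>i\<in>{..<Suc n}. x [^] i) = x [^] n \<oplus> (\<Oplus>i\<in>{..<n}. x [^] i)"
    unfolding lessThan_Suc using assms by (subst finsum_insert) auto
  then have "(x \<ominus> \<one>) \<otimes> (\<Oplus>i\<in>{..<Suc n}. x [^] i) = (x \<ominus> \<one>) \<otimes> x [^] n \<oplus> (x [^] n \<ominus> \<one>)"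
    using assms Suc by (simp add: r_distr)
  also have "\<dots> = x [^] n \<otimes> x \<ominus> \<one>"
  proof -
    have "x [^] n \<in> carrier R" using assms by simp
    then show ?thesis using assms by algebra
  qed
  finally show ?case by simp
qed (use assms in \<open>simp add: a_minus_def r_neg\<close>)

section \<open>Roots of unity\<close>

definition (in field) unity_roots :: "nat \<Rightarrow> 'a set" where
  "unity_roots N = {x \<in> carrier R. x [^] N = \<one>}"

lemma (in field) unity_roots_pos:
  "x \<in> unity_roots N \<Longrightarrow> x \<in> carrier R" "x \<in> unity_roots N \<Longrightarrow> N > 0 \<Longrightarrow> x \<noteq> \<zero>"
  by (auto simp: unity_roots_def nat_pow_zero)

lemma (in field) finite_unity_roots: "N > 0 \<Longrightarrow> finite (unity_roots N)"
  unfolding unity_roots_def by (rule nth_roots_bound) auto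

lemma (in field) card_unity_roots_le: "N > 0 \<Longrightarrow> card (unity_roots N) \<le> N"
  unfolding unity_roots_def by (rule nth_roots_bound) auto

lemma (in field) unity_roots_gcd:
  assumes "x \<in> unity_roots M" "x \<in> unity_roots N" "M > 0"
  shows "x \<in> unity_roots (gcd M N)"
proof -
  have x: "x \<in> carrier R" "x [^] M = \<one>" "x [^] N = \<one>" using assms by (auto simp: unity_roots_def)
  obtain u v where "M * u = N * v + gcd M N" using assms(3) bezout_nat[of M N] by auto
  then have "x [^] (M * u) = x [^] (N * v) \<otimes> x [^] gcd M N"
    using x by (simp add: nat_pow_mult)
  then show ?thesis using x by (simp add: nat_pow_pow[symmetric] unity_roots_def)
qed

lemma (in field) unity_roots_dvd:
  assumes "x \<in> unity_roots M" "M dvd N"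
  shows "x \<in> unity_roots N"
  using assms by (auto simp: unity_roots_def nat_pow_pow[symmetric])

lemma (in field) card_nth_roots:
  assumes "y \<in> carrier R" "y \<noteq> \<zero>" "z \<in> carrier R" "z [^] N = y" "N > 0"
  shows "card {x \<in> carrier R. x [^] N = y} = card (unity_roots N)"
proof (rule bij_betw_same_card[symmetric], rule bij_betwI')
  have z0: "z \<noteq> \<zero>" using assms by (auto simp: nat_pow_zero)
  show "(z \<otimes> x = z \<otimes> x') = (x = x')" if "x \<in> unity_roots N" "x' \<in> unity_roots N" for x x'
    using that assms z0 by (simp add: m_lcancel unity_roots_pos)
  show "z \<otimes> x \<in> {x \<in> carrier R. x [^] N = y}" if "x \<in> unity_roots N" for x
    using that assms by (simp add: unity_roots_def nat_pow_distrib)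
  fix x assume x: "x \<in> {x \<in> carrier R. x [^] N = y}"
  have zi: "inv z \<in> carrier R" "z \<otimes> inv z = \<one>" "inv z \<otimes> z = \<one>"
    using z0 assms(3) by (auto simp: field_Units)
  have "(inv z \<otimes> x) [^] N = inv z [^] N \<otimes> z [^] N"
    using x assms zi by (simp add: nat_pow_distrib)
  also have "\<dots> = (inv z \<otimes> z) [^] N" by (rule nat_pow_distrib[symmetric]) (use zi assms in auto)
  finally have "(inv z \<otimes> x) [^] N = \<one>" using zi by simp
  then show "\<exists>w\<in>unity_roots N. x = z \<otimes> w"
    using x zi assms by (intro bexI[of _ "inv z \<otimes> x"]) (auto simp: unity_roots_def m_assoc[symmetric])
qed

text \<open>Of the field with q elements only the characteristic is recorded, in the form
  \<open>card_times_one\<close>. Finite subfields are recovered inside L as fixed points of powers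
  of the Frobenius map.\<close>

locale closed_field_prime_power = algebraically_closed L for L (structure) +
  fixes q :: nat
  assumes primepow_q: "primepow q" and card_times_one: "[q] \<cdot> \<one> = \<zero>"
begin

lemma q_ge_2: "q \<ge> 2"
  using primepow_gt_Suc_0[OF primepow_q] by simp

text \<open>The multiple p^k of one is the k-th power of the multiple p of one, and a domain has no
  nilpotent elements.\<close>

lemma ex_prime_base:
  obtains p r where "prime p" "[p] \<cdot> \<one> = \<zero>" "q = p ^ r"
proof -
  obtain p r where p: "prime p" "q = p ^ r" using primepow_q by (auto simp: primepow_def)
  have "[(p ^ k)] \<cdot> \<one> = ([p] \<cdot> \<one>) [^] k" for k :: nat
    by (induction k)
      (auto simp: add.nat_pow_pow[symmetric] add_pow_rdistr power_Suc2 simp del: power_Suc)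
  then have "([p] \<cdot> \<one>) [^] r = \<zero>" using card_times_one p by simp
  then have "[p] \<cdot> \<one> = \<zero>" using nat_pow_nonzero[of "[p] \<cdot> \<one>" r] by auto
  with p that show ?thesis by blast
qed

lemma frobenius_add:
  assumes "a \<in> carrier L" "b \<in> carrier L"
  shows "(a \<oplus> b) [^] (q ^ k) = a [^] (q ^ k) \<oplus> b [^] (q ^ k)"
proof -
  obtain p r where "prime p" "[p] \<cdot> \<one> = \<zero>" "q = p ^ r" by (rule ex_prime_base)
  then show ?thesis
    using frobenius_add_prime_power[of p a b "r * k"] assms by (simp add: power_mult)
qed

lemma frobenius_finsum:
  assumes "f \<in> A \<rightarrow> carrier L"
  shows "(\<Oplus>i\<in>A. f i) [^] (q ^ k) = (\<Oplus>i\<in>A. f i [^] (q ^ k))"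
proof (cases "finite A")
  case True
  then show ?thesis using assms
  proof (induction A)
    case empty
    then show ?case using q_ge_2 by (simp add: nat_pow_zero)
  next
    case (insert x A)
    then show ?case by (simp add: frobenius_add Pi_def)
  qed
qed (use q_ge_2 in \<open>simp add: finsum_infinite nat_pow_zero\<close>)

lemma coprime_times_one_neq_zero:
  assumes "coprime N q"
  shows "[N] \<cdot> \<one> \<noteq> \<zero>"
proof
  assume N: "[N] \<cdot> \<one> = \<zero>"
  have "q \<noteq> 0" using q_ge_2 by simp
  then obtain u v where "q * u = N * v + 1" using assms bezout_nat[of q N] by (auto simp: coprime_commute)
  then have "[(q * u)] \<cdot> \<one> = [(N * v)] \<cdot> \<one> \<oplus> \<one>"
    using add.nat_pow_mult[of \<one> "N * v" 1] by simp
  then show False using N card_times_one by (simp add: add.nat_pow_pow[symmetric])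
qed

text \<open>A root z of 1 + X + ... + X^(l-1) is an l-th root of unity by the geometric sum, and it
  is not 1 because the value at 1 is l, which is nonzero in L. As l is prime, the powers of z are
  then distinct, which gives l roots; the degree allows no more.\<close>

lemma card_unity_roots_prime:
  assumes "prime l" "coprime l q"
  shows "card (unity_roots l) = l"
proof -
  have l: "l \<ge> 2" using assms prime_ge_2_nat by blast
  obtain z where z: "z \<in> carrier L" "(\<Oplus>i\<in>{..l - 1}. \<one> \<otimes> z [^] i) = \<zero>"
    using ex_root_of_coeffs[of "\<lambda>_. \<one>" "l - 1"] l by auto
  have "{..l - 1} = {..<l}" using l by auto
  then have z0: "(\<Oplus>i\<in>{..<l}. z [^] i) = \<zero>"
    using z by (simp cong: finsum_cong)
  then have "z [^] l \<ominus> \<one> = (z \<ominus> \<one>) \<otimes> \<zero>"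
    using geometric_sum[OF z(1), of l] by simp
  then have zl: "z [^] l = \<one>"
    using z(1) by simp
  have z1: "z \<noteq> \<one>"
  proof
    assume "z = \<one>"
    then have "[l] \<cdot> \<one> = \<zero>" using z0 add.finprod_const[of \<one> "{..<l}"] by simp
    then show False using coprime_times_one_neq_zero[OF assms(2)] by simp
  qed
  have "z \<noteq> \<zero>" using zl l by (auto simp: nat_pow_zero)
  have "inj_on (\<lambda>i. z [^] i) {..<l}"
  proof (rule linorder_inj_onI)
    fix i j assume ij: "i < j" "i \<in> {..<l}" "j \<in> {..<l}"
    show "z [^] i \<noteq> z [^] j"
    proof
      assume "z [^] i = z [^] j"
      moreover have "z [^] i \<otimes> z [^] (j - i) = z [^] j"
        using z(1) ij by (simp add: nat_pow_mult)
      ultimately have "z [^] i \<otimes> \<one> = z [^] i \<otimes> z [^] (j - i)"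
        using z(1) by simp
      then have "z [^] (j - i) = \<one>"
        using z(1) \<open>z \<noteq> \<zero>\<close> m_lcancel[of "z [^] i" \<one> "z [^] (j - i)"] nat_pow_nonzero by simp
      then have "z \<in> unity_roots (gcd (j - i) l)"
        using z(1) zl ij by (intro unity_roots_gcd) (auto simp: unity_roots_def)
      moreover have "gcd (j - i) l = 1"
      proof -
        have "\<not> l dvd (j - i)" using ij by (auto dest: dvd_imp_le)
        then show ?thesis using assms(1) by (simp add: prime_imp_coprime coprime_commute flip: coprime_iff_gcd_eq_1)
      qed
      ultimately show False using z1 z(1) by (auto simp: unity_roots_def)
    qed
  qed linarith
  moreover have "(\<lambda>i. z [^] i) ` {..<l} \<subseteq> unity_roots l"
  proof safe
    fix i :: nat
    have "(z [^] i) [^] l = (z [^] l) [^] i"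
      using z(1) by (simp only: nat_pow_pow mult.commute)
    then show "z [^] i \<in> unity_roots l"
      using z(1) zl by (simp add: unity_roots_def)
  qed
  ultimately have "l \<le> card (unity_roots l)"
    using card_inj_on_le[of _ "{..<l}" "unity_roots l"] finite_unity_roots[of l] l by auto
  then show ?thesis using card_unity_roots_le[of l] l by auto
qed

text \<open>Separability of X^N - 1 is replaced by an induction on the prime factors: raising to the
  power l maps the roots for l * N onto those for N, because L is algebraically closed, and each
  fibre is a coset of the l-th roots of unity.\<close>

lemma card_unity_roots:
  assumes "coprime N q" "N > 0"
  shows "card (unity_roots N) = N"
  using assms
proof (induction N rule: prime_divisors_induct)
  case zero
  then show ?case by simp
next
  case (unit x)
  then show ?case by (auto simp: unity_roots_def conj_commute cong: conj_cong)
next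
  case (factor l N)
  then have l: "l > 0" "N > 0" "coprime l q" "coprime N q" by (auto simp: prime_gt_0_nat)
  have img: "(\<lambda>x. x [^] l) ` unity_roots (l * N) = unity_roots N"
  proof safe
    fix x assume "x \<in> unity_roots N"
    then have x: "x \<in> carrier L" "x [^] N = \<one>" by (auto simp: unity_roots_def)
    obtain y where y: "y \<in> carrier L" "y [^] l = x" using ex_nth_root[OF x(1) l(1)] by blast
    then show "x \<in> (\<lambda>x. x [^] l) ` unity_roots (l * N)"
      using x by (intro image_eqI[of _ _ y]) (auto simp: unity_roots_def nat_pow_pow[symmetric])
  qed (auto simp: unity_roots_def nat_pow_pow)
  have "card (unity_roots (l * N)) = l * card ((\<lambda>x. x [^] l) ` unity_roots (l * N))"
  proof (rule card_eq_fibre_card_mult)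
    fix y assume "y \<in> (\<lambda>x. x [^] l) ` unity_roots (l * N)"
    then obtain z where z: "z \<in> carrier L" "z [^] l = y" "y \<in> unity_roots N"
      by (auto simp: unity_roots_def nat_pow_pow)
    have "{x \<in> unity_roots (l * N). x [^] l = y} = {x \<in> carrier L. x [^] l = y}"
      using z by (auto simp: unity_roots_def nat_pow_pow[symmetric])
    then show "card {x \<in> unity_roots (l * N). x [^] l = y} = l"
      using card_nth_roots[of y z l] z l unity_roots_pos[of y N] card_unity_roots_prime[of l] factor by auto
  qed (use l in \<open>auto intro: finite_unity_roots\<close>)
  then show ?case using img factor l by simp
qed

text \<open>The kernel of the M-th power map on the group of N-th roots of unity is the group of
  gcd(M, N)-th roots of unity. This is the source of the factors (M, q^i - (-1)^i) in the
  theorem.\<close>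

lemma card_power_unity_roots:
  assumes "coprime N q" "N > 0" "M > 0"
  shows "card ((\<lambda>x. x [^] M) ` unity_roots N) * gcd M N = N"
proof -
  have "card (unity_roots N) = gcd M N * card ((\<lambda>x. x [^] M) ` unity_roots N)"
  proof (rule card_eq_fibre_card_mult)
    fix y assume "y \<in> (\<lambda>x. x [^] M) ` unity_roots N"
    then obtain z where z: "z \<in> unity_roots N" "z [^] M = y" by auto
    have z': "z \<in> carrier L" "z \<noteq> \<zero>" "z [^] N = \<one>"
      using z unity_roots_pos[of z N] assms(2) by (auto simp: unity_roots_def)
    have zi: "inv z \<in> carrier L" "z \<otimes> inv z = \<one>" "inv z \<otimes> z = \<one>" using z' by (auto simp: field_Units)
    have iz: "inv z [^] k \<otimes> z [^] k = \<one>" for k :: nat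
      using nat_pow_distrib[of "inv z" z k] zi z'(1) by simp
    have "card (unity_roots (gcd M N)) = card {x \<in> unity_roots N. x [^] M = y}"
    proof (rule bij_betw_same_card, rule bij_betwI')
      show "(z \<otimes> x = z \<otimes> x') = (x = x')" if "x \<in> unity_roots (gcd M N)" "x' \<in> unity_roots (gcd M N)" for x x'
        using that z' by (simp add: m_lcancel unity_roots_pos)
      show "z \<otimes> x \<in> {x \<in> unity_roots N. x [^] M = y}" if "x \<in> unity_roots (gcd M N)" for x
        using unity_roots_dvd[OF that, of M] unity_roots_dvd[OF that, of N] z z'
        by (auto simp: unity_roots_def nat_pow_distrib)
      fix x assume x: "x \<in> {x \<in> unity_roots N. x [^] M = y}"
      then have x': "x \<in> carrier L" "x [^] N = z [^] N" "x [^] M = z [^] M" using z z' by (auto simp: unity_roots_def)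
      then have "inv z \<otimes> x \<in> unity_roots (gcd M N)"
        using zi iz assms by (intro unity_roots_gcd) (auto simp: unity_roots_def nat_pow_distrib)
      then show "\<exists>w\<in>unity_roots (gcd M N). x = z \<otimes> w"
        using x' zi z' by (intro bexI[of _ "inv z \<otimes> x"]) (auto simp: m_assoc[symmetric])
    qed
    moreover have "coprime (gcd M N) q" using assms(1) by (rule coprime_imp_coprime) auto
    ultimately show "card {x \<in> unity_roots N. x [^] M = y} = gcd M N"
      using card_unity_roots[of "gcd M N"] assms by simp
  qed (use assms in \<open>auto intro: finite_unity_roots\<close>)
  then show ?thesis using card_unity_roots[OF assms(1,2)] by (simp add: mult.commute)
qed

text \<open>For k > 0 this is the subfield with q^k elements.\<close>

definition fixed_field :: "nat \<Rightarrow> 'a set" where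
  "fixed_field k = {x \<in> carrier L. x [^] (q ^ k) = x}"

lemma frobenius_minus:
  assumes "a \<in> carrier L"
  shows "(\<ominus> a) [^] (q ^ k) = \<ominus> (a [^] (q ^ k))"
proof -
  have "a [^] (q ^ k) \<oplus> (\<ominus> a) [^] (q ^ k) = \<zero>"
    using frobenius_add[of a "\<ominus> a" k] assms q_ge_2 by (simp add: r_neg nat_pow_zero)
  then show ?thesis using assms by (metis a_inv_closed add.inv_equality a_comm nat_pow_closed)
qed

lemma fixed_field_closed:
  shows "x \<in> fixed_field k \<Longrightarrow> x \<in> carrier L"
    and "x \<in> fixed_field k \<Longrightarrow> y \<in> fixed_field k \<Longrightarrow> x \<oplus> y \<in> fixed_field k"
    and "x \<in> fixed_field k \<Longrightarrow> y \<in> fixed_field k \<Longrightarrow> x \<otimes> y \<in> fixed_field k"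
    and "x \<in> fixed_field k \<Longrightarrow> \<ominus> x \<in> fixed_field k"
    and "x \<in> fixed_field k \<Longrightarrow> x [^] (m::nat) \<in> fixed_field k"
    and "\<zero> \<in> fixed_field k" and "\<one> \<in> fixed_field k"
    and "f \<in> A \<rightarrow> fixed_field k \<Longrightarrow> (\<Oplus>i\<in>A. f i) \<in> fixed_field k"
proof -
  show "(\<Oplus>i\<in>A. f i) \<in> fixed_field k" if f: "f \<in> A \<rightarrow> fixed_field k"
  proof -
    have "f \<in> A \<rightarrow> carrier L" using f by (auto simp: fixed_field_def)
    moreover have "(\<Oplus>i\<in>A. f i [^] (q ^ k)) = (\<Oplus>i\<in>A. f i)"
      by (rule finsum_cong') (use f in \<open>auto simp: fixed_field_def\<close>)
    ultimately show ?thesis by (simp add: fixed_field_def frobenius_finsum)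
  qed
  show "x [^] (m::nat) \<in> fixed_field k" if x: "x \<in> fixed_field k"
  proof -
    have x': "x \<in> carrier L" "x [^] (q ^ k) = x" using x by (auto simp: fixed_field_def)
    have "(x [^] m) [^] (q ^ k) = (x [^] (q ^ k)) [^] m"
      using x'(1) by (simp add: nat_pow_pow mult.commute)
    then have "(x [^] m) [^] (q ^ k) = x [^] m" by (simp add: x'(2))
    then show ?thesis using x by (simp add: fixed_field_def)
  qed
  show "\<zero> \<in> fixed_field k" using q_ge_2 by (simp add: fixed_field_def nat_pow_zero)
  show "\<one> \<in> fixed_field k" by (simp add: fixed_field_def)
qed (simp_all add: fixed_field_def frobenius_add frobenius_minus nat_pow_distrib)

lemma fixed_field_eq:
  assumes "k > 0"
  shows "fixed_field k = insert \<zero> (unity_roots (q ^ k - 1))"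
proof -
  have Q: "q ^ k = Suc (q ^ k - 1)" "q ^ k - 1 > 0"
    using q_ge_2 one_less_power[of q k] assms by auto
  have iff: "x [^] (q ^ k) = x \<longleftrightarrow> x = \<zero> \<or> x [^] (q ^ k - 1) = \<one>" if "x \<in> carrier L" for x
  proof -
    have "x [^] (q ^ k) = x \<longleftrightarrow> x [^] (q ^ k - 1) \<otimes> x = \<one> \<otimes> x"
      using that by (subst Q(1)) simp
    also have "\<dots> \<longleftrightarrow> x = \<zero> \<or> x [^] (q ^ k - 1) = \<one>"
      using that m_rcancel[of x "x [^] (q ^ k - 1)" \<one>] by (cases "x = \<zero>") auto
    finally show ?thesis .
  qed
  show ?thesis using iff by (auto simp: fixed_field_def unity_roots_def)
qed

lemma
  assumes "k > 0"
  shows finite_fixed_field: "finite (fixed_field k)"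
    and card_fixed_field: "card (fixed_field k) = q ^ k"
proof -
  have Q: "q ^ k = Suc (q ^ k - 1)" "q ^ k - 1 > 0"
    using q_ge_2 one_less_power[of q k] assms by auto
  have "coprime (q ^ k - 1) (q ^ k)" using q_ge_2 by (intro coprime_diff_one_left_nat) simp
  then have "coprime (q ^ k - 1) q" using assms by (auto simp only: coprime_power_right_iff)
  note U = finite_unity_roots[OF Q(2)] card_unity_roots[OF this Q(2)]
  show "finite (fixed_field k)" using U by (simp add: fixed_field_eq[OF assms])
  have "\<zero> \<notin> unity_roots (q ^ k - 1)" using unity_roots_pos(2) Q(2) by blast
  from card_insert_disjoint[OF U(1) this] U(2) Q(2) show "card (fixed_field k) = q ^ k"
    unfolding fixed_field_eq[OF assms] by linarith
qed

text \<open>The degree is at most Q^(l-1), so the strict bound is the point: a field with Q^l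
  elements cannot consist of roots. This takes the place of the linear independence of the powers of
  the Frobenius map.\<close>

lemma card_additive_poly_roots:
  assumes y: "y \<in> {..<l} \<rightarrow> carrier L" and nz: "\<exists>c<l. y c \<noteq> \<zero>" and Q: "Q \<ge> (2::nat)"
  shows "finite {a \<in> carrier L. (\<Oplus>c\<in>{..<l}. y c \<otimes> a [^] (Q ^ c)) = \<zero>}"
    and "card {a \<in> carrier L. (\<Oplus>c\<in>{..<l}. y c \<otimes> a [^] (Q ^ c)) = \<zero>} < Q ^ l"
proof -
  \<comment> \<open>The highest index with a nonzero coefficient, since
    \<open>roots_of_coeffs\<close> asks for a nonzero leading coefficient.\<close>
  define m where "m = Max {c. c < l \<and> y c \<noteq> \<zero>}"
  have m: "m < l" "y m \<noteq> \<zero>" using Max_in[of "{c. c < l \<and> y c \<noteq> \<zero>}"] nz by (auto simp: m_def)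
  have m_max: "y c = \<zero>" if "c < l" "m < c" for c
  proof (rule ccontr)
    assume "y c \<noteq> \<zero>"
    then have "c \<le> m" using that unfolding m_def by (intro Max_ge) auto
    then show False using that by simp
  qed
  have inj: "inj_on (\<lambda>c. Q ^ c) A" for A using Q by (auto intro!: inj_onI)
  \<comment> \<open>The same polynomial with coefficients indexed by exponents: \<open>y c\<close>
    sits at the exponent Q^c.\<close>
  define f where "f = (\<lambda>i. if i \<in> (\<lambda>c. Q ^ c) ` {..m} then y (the_inv_into {..m} (\<lambda>c. Q ^ c) i) else \<zero>)"
  have fQ: "f (Q ^ c) = y c" if "c \<le> m" for c
    using that the_inv_into_f_f[OF inj[of "{..m}"], of c] by (auto simp: f_def)
  have f0: "f i = \<zero>" if "i \<notin> (\<lambda>c. Q ^ c) ` {..m}" for i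
    using that by (simp only: f_def if_False)
  have ycar: "y c \<in> carrier L" if "c < l" for c using y that by auto
  have fcar: "f i \<in> carrier L" for i
    using fQ f0 ycar m by (cases "i \<in> (\<lambda>c. Q ^ c) ` {..m}") auto
  have f: "f \<in> {..Q ^ m} \<rightarrow> carrier L" "f (Q ^ m) \<noteq> \<zero>"
    using fcar fQ[of m] m by auto
  have eq: "(\<Oplus>c\<in>{..<l}. y c \<otimes> a [^] (Q ^ c)) = (\<Oplus>i\<in>{..Q ^ m}. f i \<otimes> a [^] i)" if a: "a \<in> carrier L" for a
  proof -
    have "(\<Oplus>i\<in>{..Q ^ m}. f i \<otimes> a [^] i) = (\<Oplus>i\<in>(\<lambda>c. Q ^ c) ` {..m}. f i \<otimes> a [^] i)"
      by (rule add.finprod_mono_neutral_cong_right)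
        (use a fcar f0 Q in \<open>auto intro!: power_increasing\<close>)
    also have "\<dots> = (\<Oplus>c\<in>{..m}. f (Q ^ c) \<otimes> a [^] (Q ^ c))"
      by (rule finsum_reindex) (use a fcar inj in auto)
    also have "\<dots> = (\<Oplus>c\<in>{..m}. y c \<otimes> a [^] (Q ^ c))"
      by (rule finsum_cong') (use a fQ ycar m in auto)
    also have "\<dots> = (\<Oplus>c\<in>{..<l}. y c \<otimes> a [^] (Q ^ c))"
      by (rule add.finprod_mono_neutral_cong_left) (use a ycar m m_max in auto)
    finally show ?thesis by simp
  qed
  have set_eq: "{a \<in> carrier L. (\<Oplus>c\<in>{..<l}. y c \<otimes> a [^] (Q ^ c)) = \<zero>}
      = {a \<in> carrier L. (\<Oplus>i\<in>{..Q ^ m}. f i \<otimes> a [^] i) = \<zero>}"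
    by (rule Collect_cong) (metis eq)
  have "Q ^ m < Q ^ l" using m Q by simp
  show "finite {a \<in> carrier L. (\<Oplus>c\<in>{..<l}. y c \<otimes> a [^] (Q ^ c)) = \<zero>}"
    unfolding set_eq by (rule roots_of_coeffs(1)[OF f])
  show "card {a \<in> carrier L. (\<Oplus>c\<in>{..<l}. y c \<otimes> a [^] (Q ^ c)) = \<zero>} < Q ^ l"
    unfolding set_eq using roots_of_coeffs(2)[OF f] \<open>Q ^ m < Q ^ l\<close> by (rule le_less_trans)
qed

end

section \<open>Matrices over a ring record\<close>

lemma card_le_fibre_card_mult:
  assumes "finite A" and "\<And>y. y \<in> f ` A \<Longrightarrow> card {x \<in> A. f x = y} \<le> k"
  shows "card A \<le> k * card (f ` A)"
proof -
  have "card A = (\<Sum>x\<in>A. 1)" by simp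
  also have "\<dots> = (\<Sum>y\<in>f ` A. \<Sum>x\<in>{x \<in> A. f x = y}. 1)"
    using sum.image_gen[OF assms(1)] by fastforce
  also have "\<dots> \<le> (\<Sum>y\<in>f ` A. k)"
    by (rule sum_mono) (use assms(2) in auto)
  finally show ?thesis by (simp add: mult.commute)
qed

lemma (in monoid) Units_r_cancel:
  assumes "u \<in> Units G" "x \<in> carrier G" "y \<in> carrier G" "x \<otimes> u = y \<otimes> u"
  shows "x = y"
proof -
  have "x = x \<otimes> u \<otimes> inv u" using assms(1,2) by (simp add: m_assoc Units_closed)
  also have "\<dots> = y" unfolding assms(4) using assms(1,3) by (simp add: m_assoc Units_closed)
  finally show ?thesis .
qed

locale matrix_space = closed_field_prime_power L q for L (structure) and q +
  fixes n :: nat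
begin

abbreviation Mat :: "'a mat monoid" where "Mat \<equiv> mat_monoid L n"

abbreviation mat_mult :: "'a mat \<Rightarrow> 'a mat \<Rightarrow> 'a mat" (infixl "\<star>" 70) where
  "A \<star> B \<equiv> A \<otimes>\<^bsub>Mat\<^esub> B"

lemma Mat_carrier:
  "A \<in> carrier Mat \<longleftrightarrow> A \<in> carrier_mat n n \<and> (\<forall>i<n. \<forall>j<n. A $$ (i, j) \<in> carrier L)"
  by (fastforce simp: mat_monoid_def elements_mat_def)

lemma Mat_entry: "A \<in> carrier Mat \<Longrightarrow> i < n \<Longrightarrow> j < n \<Longrightarrow> A $$ (i, j) \<in> carrier L"
  by (simp add: Mat_carrier)

lemma Mat_eqI:
  assumes "A \<in> carrier Mat" "B \<in> carrier Mat" "\<And>i j. i < n \<Longrightarrow> j < n \<Longrightarrow> A $$ (i, j) = B $$ (i, j)"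
  shows "A = B"
  by (rule eq_matI) (use assms in \<open>auto simp: Mat_carrier\<close>)

lemma mat_in_Mat: "(\<And>i j. i < n \<Longrightarrow> j < n \<Longrightarrow> f (i, j) \<in> carrier L) \<Longrightarrow> mat n n f \<in> carrier Mat"
  by (simp add: Mat_carrier)

lemma Mat_mult: "A \<star> B = mat n n (\<lambda>(i, j). \<Oplus>k\<in>{..<n}. A $$ (i, k) \<otimes> B $$ (k, j))"
  by (simp add: mat_monoid_def)

lemma Mat_mult_entry:
  "i < n \<Longrightarrow> j < n \<Longrightarrow> (A \<star> B) $$ (i, j) = (\<Oplus>k\<in>{..<n}. A $$ (i, k) \<otimes> B $$ (k, j))"
  by (simp add: Mat_mult)

lemma Mat_one: "\<one>\<^bsub>Mat\<^esub> = mat n n (\<lambda>(i, j). if i = j then \<one> else \<zero>)"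
  by (simp add: mat_monoid_def)

lemma finsum_single:
  assumes "m < n" "\<And>k. k < n \<Longrightarrow> k \<noteq> m \<Longrightarrow> f k = \<zero>" "f m \<in> carrier L"
  shows "(\<Oplus>k\<in>{..<n}. f k) = f m"
proof -
  have "f k \<in> carrier L" if "k < n" for k using assms that by (cases "k = m") auto
  then have "(\<Oplus>k\<in>{..<n}. f k) = (\<Oplus>k\<in>{m}. f k)"
    by (intro add.finprod_mono_neutral_cong_right) (use assms in auto)
  then show ?thesis using assms by simp
qed

lemma Mat_mult_closed:
  assumes "A \<in> carrier Mat" "B \<in> carrier Mat"
  shows "A \<star> B \<in> carrier Mat"
  unfolding Mat_mult by (rule mat_in_Mat) (use assms Mat_entry in \<open>auto intro!: finsum_closed\<close>)

lemma Mat_one_closed: "\<one>\<^bsub>Mat\<^esub> \<in> carrier Mat"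
  unfolding Mat_one by (rule mat_in_Mat) auto

lemma Mat_monoid: "monoid Mat"
proof
  fix A assume A: "A \<in> carrier Mat"
  note Ac = Mat_entry[OF A]
  show "\<one>\<^bsub>Mat\<^esub> \<star> A = A"
  proof (rule Mat_eqI)
    fix i j assume ij: "i < n" "j < n"
    have "(\<Oplus>k\<in>{..<n}. \<one>\<^bsub>Mat\<^esub> $$ (i, k) \<otimes> A $$ (k, j)) = \<one>\<^bsub>Mat\<^esub> $$ (i, i) \<otimes> A $$ (i, j)"
      by (rule finsum_single) (use ij Ac in \<open>auto simp: Mat_one\<close>)
    then show "(\<one>\<^bsub>Mat\<^esub> \<star> A) $$ (i, j) = A $$ (i, j)"
      using ij Ac by (simp add: Mat_mult_entry Mat_one)
  qed (use A Mat_mult_closed Mat_one_closed in auto)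
  show "A \<star> \<one>\<^bsub>Mat\<^esub> = A"
  proof (rule Mat_eqI)
    fix i j assume ij: "i < n" "j < n"
    have "(\<Oplus>k\<in>{..<n}. A $$ (i, k) \<otimes> \<one>\<^bsub>Mat\<^esub> $$ (k, j)) = A $$ (i, j) \<otimes> \<one>\<^bsub>Mat\<^esub> $$ (j, j)"
      by (rule finsum_single) (use ij Ac in \<open>auto simp: Mat_one\<close>)
    then show "(A \<star> \<one>\<^bsub>Mat\<^esub>) $$ (i, j) = A $$ (i, j)"
      using ij Ac by (simp add: Mat_mult_entry Mat_one)
  qed (use A Mat_mult_closed Mat_one_closed in auto)
next
  fix A B C assume ABC: "A \<in> carrier Mat" "B \<in> carrier Mat" "C \<in> carrier Mat"
  note c = ABC[THEN Mat_entry]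
  show "A \<star> B \<star> C = A \<star> (B \<star> C)"
  proof (rule Mat_eqI)
    fix i j assume ij: "i < n" "j < n"
    have "(A \<star> B \<star> C) $$ (i, j)
        = (\<Oplus>k\<in>{..<n}. (\<Oplus>l\<in>{..<n}. A $$ (i, l) \<otimes> B $$ (l, k)) \<otimes> C $$ (k, j))"
      using ij ABC c by (auto simp: Mat_mult_entry intro!: finsum_cong' finsum_closed)
    also have "\<dots> = (\<Oplus>k\<in>{..<n}. \<Oplus>l\<in>{..<n}. A $$ (i, l) \<otimes> (B $$ (l, k) \<otimes> C $$ (k, j)))"
    proof (rule finsum_cong', goal_cases)
      case (3 k)
      have "(\<Oplus>l\<in>{..<n}. A $$ (i, l) \<otimes> B $$ (l, k)) \<otimes> C $$ (k, j)
          = (\<Oplus>l\<in>{..<n}. A $$ (i, l) \<otimes> B $$ (l, k) \<otimes> C $$ (k, j))"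
        by (rule finsum_ldistr) (use 3 ij c in auto)
      also have "\<dots> = (\<Oplus>l\<in>{..<n}. A $$ (i, l) \<otimes> (B $$ (l, k) \<otimes> C $$ (k, j)))"
        by (rule finsum_cong') (use 3 ij c in \<open>auto simp: m_assoc\<close>)
      finally show ?case .
    qed (use ij c in \<open>auto intro!: finsum_closed\<close>)
    also have "\<dots> = (\<Oplus>l\<in>{..<n}. \<Oplus>k\<in>{..<n}. A $$ (i, l) \<otimes> (B $$ (l, k) \<otimes> C $$ (k, j)))"
      by (rule finsum_finsum_swap) (use ij c in auto)
    also have "\<dots> = (\<Oplus>l\<in>{..<n}. A $$ (i, l) \<otimes> (\<Oplus>k\<in>{..<n}. B $$ (l, k) \<otimes> C $$ (k, j)))"
      by (rule finsum_cong') (use ij c in \<open>auto intro!: finsum_closed finsum_rdistr[symmetric]\<close>)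
    also have "\<dots> = (A \<star> (B \<star> C)) $$ (i, j)"
      using ij ABC c by (auto simp: Mat_mult_entry intro!: finsum_cong' finsum_closed)
    finally show "(A \<star> B \<star> C) $$ (i, j) = (A \<star> (B \<star> C)) $$ (i, j)" .
  qed (use ABC Mat_mult_closed in auto)
qed (use Mat_mult_closed Mat_one_closed in auto)

sublocale Mat: monoid Mat by (rule Mat_monoid)

section \<open>Permutation, diagonal and adjoint matrices\<close>

definition perm_mat :: "(nat \<Rightarrow> nat) \<Rightarrow> 'a mat" where
  "perm_mat s = mat n n (\<lambda>(i, j). if i = s j then \<one> else \<zero>)"

definition diag :: "(nat \<Rightarrow> 'a) \<Rightarrow> 'a mat" where
  "diag d = mat n n (\<lambda>(i, j). if i = j then d i else \<zero>)"

text \<open>Conjugate transpose with x -> x^q as conjugation. Over L it is not an involution: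
  applied twice, it raises every entry to the power q^2.\<close>

definition adj :: "'a mat \<Rightarrow> 'a mat" where
  "adj A = transpose_mat (map_mat (\<lambda>a. a [^] q) A)"

lemma perm_mat_closed: "perm_mat s \<in> carrier Mat"
  unfolding perm_mat_def by (rule mat_in_Mat) auto

lemma perm_mat_entry: "i < n \<Longrightarrow> j < n \<Longrightarrow> perm_mat s $$ (i, j) = (if i = s j then \<one> else \<zero>)"
  by (simp add: perm_mat_def)

lemma diag_closed: "(\<And>i. i < n \<Longrightarrow> d i \<in> carrier L) \<Longrightarrow> diag d \<in> carrier Mat"
  unfolding diag_def by (rule mat_in_Mat) auto

lemma diag_entry: "i < n \<Longrightarrow> j < n \<Longrightarrow> diag d $$ (i, j) = (if i = j then d i else \<zero>)"
  by (simp add: diag_def)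

lemma adj_closed: "A \<in> carrier Mat \<Longrightarrow> adj A \<in> carrier Mat"
  by (auto simp: adj_def Mat_carrier)

lemma adj_entry: "A \<in> carrier Mat \<Longrightarrow> i < n \<Longrightarrow> j < n \<Longrightarrow> adj A $$ (i, j) = A $$ (j, i) [^] q"
  by (auto simp: adj_def Mat_carrier)

lemma mult_perm_mat_entry:
  assumes "A \<in> carrier Mat" "s permutes {..<n}" "i < n" "j < n"
  shows "(A \<star> perm_mat s) $$ (i, j) = A $$ (i, s j)"
proof -
  have s: "s j < n" using permutes_in_image[OF assms(2), of j] assms(4) by simp
  have "(\<Oplus>k\<in>{..<n}. A $$ (i, k) \<otimes> perm_mat s $$ (k, j)) = A $$ (i, s j) \<otimes> perm_mat s $$ (s j, j)"
    by (rule finsum_single) (use s assms Mat_entry[OF assms(1)] in \<open>auto simp: perm_mat_entry\<close>)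
  then show ?thesis using assms s Mat_entry[OF assms(1)] by (simp add: Mat_mult_entry perm_mat_entry)
qed

lemma diag_mult_entry:
  assumes "A \<in> carrier Mat" "\<And>i. i < n \<Longrightarrow> d i \<in> carrier L" "i < n" "j < n"
  shows "(diag d \<star> A) $$ (i, j) = d i \<otimes> A $$ (i, j)"
proof -
  have "(\<Oplus>k\<in>{..<n}. diag d $$ (i, k) \<otimes> A $$ (k, j)) = diag d $$ (i, i) \<otimes> A $$ (i, j)"
    by (rule finsum_single) (use assms Mat_entry[OF assms(1)] in \<open>auto simp: diag_entry\<close>)
  then show ?thesis using assms by (simp add: Mat_mult_entry diag_entry)
qed

lemma mult_diag_entry:
  assumes "A \<in> carrier Mat" "\<And>i. i < n \<Longrightarrow> d i \<in> carrier L" "i < n" "j < n"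
  shows "(A \<star> diag d) $$ (i, j) = A $$ (i, j) \<otimes> d j"
proof -
  have "(\<Oplus>k\<in>{..<n}. A $$ (i, k) \<otimes> diag d $$ (k, j)) = A $$ (i, j) \<otimes> diag d $$ (j, j)"
    by (rule finsum_single) (use assms Mat_entry[OF assms(1)] in \<open>auto simp: diag_entry\<close>)
  then show ?thesis using assms by (simp add: Mat_mult_entry diag_entry)
qed

lemma diag_pow:
  assumes "\<And>i. i < n \<Longrightarrow> d i \<in> carrier L"
  shows "diag d [^]\<^bsub>Mat\<^esub> (k::nat) = diag (\<lambda>i. d i [^] k)"
proof (induction k)
  case 0
  show ?case by (rule eq_matI) (auto simp: Mat_one diag_def)
next
  case (Suc k)
  show ?case
    using assms by (intro Mat_eqI)
      (auto simp: Suc mult_diag_entry diag_closed diag_entry intro!: Mat.m_closed diag_closed)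
qed

lemma adj_mult:
  assumes "A \<in> carrier Mat" "B \<in> carrier Mat"
  shows "adj (A \<star> B) = adj B \<star> adj A"
proof (rule Mat_eqI)
  fix i j assume ij: "i < n" "j < n"
  note c = assms[THEN Mat_entry]
  have "adj (A \<star> B) $$ (i, j) = (\<Oplus>k\<in>{..<n}. A $$ (j, k) \<otimes> B $$ (k, i)) [^] q"
    using ij assms by (simp add: adj_entry Mat_mult_entry)
  also have "\<dots> = (\<Oplus>k\<in>{..<n}. (A $$ (j, k) \<otimes> B $$ (k, i)) [^] q)"
    using frobenius_finsum[of "\<lambda>k. A $$ (j, k) \<otimes> B $$ (k, i)" "{..<n}" 1] ij c by simp
  also have "\<dots> = (\<Oplus>k\<in>{..<n}. adj B $$ (i, k) \<otimes> adj A $$ (k, j))"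
    by (rule finsum_cong') (use ij c assms in \<open>auto simp: adj_entry nat_pow_distrib m_comm\<close>)
  finally show "adj (A \<star> B) $$ (i, j) = (adj B \<star> adj A) $$ (i, j)"
    using ij by (simp add: Mat_mult_entry)
qed (use assms adj_closed in auto)

lemma adj_one: "adj \<one>\<^bsub>Mat\<^esub> = \<one>\<^bsub>Mat\<^esub>"
  using q_ge_2 by (intro Mat_eqI) (auto simp: adj_entry Mat_one_closed adj_closed, auto simp: Mat_one nat_pow_zero)

lemma adj_diag:
  assumes "\<And>i. i < n \<Longrightarrow> d i \<in> carrier L"
  shows "adj (diag d) = diag (\<lambda>i. d i [^] q)"
  using q_ge_2 assms
  by (intro Mat_eqI) (auto simp: adj_entry diag_closed adj_closed diag_entry nat_pow_zero)

lemma Units_Mat_closed: "A \<in> Units Mat \<Longrightarrow> A \<in> carrier Mat"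
  by (rule Mat.Units_closed)

lemma adj_Units:
  assumes "A \<in> Units Mat"
  shows "adj A \<in> Units Mat"
proof -
  have A: "A \<in> carrier Mat" "inv\<^bsub>Mat\<^esub> A \<in> carrier Mat" using assms by auto
  have "adj A \<star> adj (inv\<^bsub>Mat\<^esub> A) = \<one>\<^bsub>Mat\<^esub>" "adj (inv\<^bsub>Mat\<^esub> A) \<star> adj A = \<one>\<^bsub>Mat\<^esub>"
    using A assms by (simp_all flip: adj_mult add: adj_one)
  then show ?thesis using A adj_closed unfolding Units_def by blast
qed

section \<open>The unitary group as a set of matrices\<close>

definition unitaries :: "'a mat set" where
  "unitaries = {A \<in> Units Mat. A \<star> adj A = \<one>\<^bsub>Mat\<^esub>}"

text \<open>The Frobenius map sends A to the inverse of \<open>adj A\<close>, so a fixed matrix is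
  one that is inverse to its adjoint.\<close>

lemma carrier_unitary_group: "carrier (unitary_group L n q) = unitaries"
proof -
  have "inv\<^bsub>units_of Mat\<^esub> (adj A) = A \<longleftrightarrow> A \<star> adj A = \<one>\<^bsub>Mat\<^esub>" if A: "A \<in> Units Mat" for A
  proof -
    have B: "adj A \<in> Units Mat" using A by (rule adj_Units)
    have "inv\<^bsub>Mat\<^esub> (adj A) = A \<longleftrightarrow> A \<star> adj A = \<one>\<^bsub>Mat\<^esub>"
    proof
      assume "A \<star> adj A = \<one>\<^bsub>Mat\<^esub>"
      then have "inv\<^bsub>Mat\<^esub> (adj A) = A \<star> adj A \<star> inv\<^bsub>Mat\<^esub> (adj A)" using B by simp
      also have "\<dots> = A" using A B Units_Mat_closed[OF A] Units_Mat_closed[OF B] by (simp add: Mat.m_assoc)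
      finally show "inv\<^bsub>Mat\<^esub> (adj A) = A" .
    next
      assume "inv\<^bsub>Mat\<^esub> (adj A) = A"
      then show "A \<star> adj A = \<one>\<^bsub>Mat\<^esub>" using Mat.Units_l_inv[OF B] by simp
    qed
    then show ?thesis using B by (simp add: Mat.units_of_inv)
  qed
  then show ?thesis
    by (auto simp: unitary_group_def unitary_frobenius_def general_linear_group_def units_of_carrier
        unitaries_def adj_def[symmetric])
qed

lemma pow_unitary_group: "x [^]\<^bsub>unitary_group L n q\<^esub> (k::nat) = x [^]\<^bsub>Mat\<^esub> k"
  by (simp add: nat_pow_def unitary_group_def general_linear_group_def units_of_def)

lemma one_unitary: "\<one>\<^bsub>Mat\<^esub> \<in> unitaries"
  by (simp add: unitaries_def adj_one)

lemma finite_Mat_fixed_field: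
  assumes "N > 0"
  shows "finite {A \<in> carrier Mat. \<forall>i<n. \<forall>j<n. A $$ (i, j) \<in> fixed_field N}" (is "finite ?X")
proof -
  define F where "F A = (\<lambda>p\<in>{..<n} \<times> {..<n}. A $$ p)" for A :: "'a mat"
  have "inj_on F ?X"
  proof (rule inj_onI)
    fix A B assume AB: "A \<in> ?X" "B \<in> ?X" "F A = F B"
    show "A = B"
    proof (rule Mat_eqI)
      fix i j assume "i < n" "j < n"
      then show "A $$ (i, j) = B $$ (i, j)" using fun_cong[OF AB(3), of "(i, j)"] by (simp add: F_def)
    qed (use AB in auto)
  qed
  moreover have "F ` ?X \<subseteq> {..<n} \<times> {..<n} \<rightarrow>\<^sub>E fixed_field N"
    unfolding F_def by (intro image_subsetI) (simp only: restrict_PiE_iff, auto)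
  moreover have "finite ({..<n} \<times> {..<n} \<rightarrow>\<^sub>E fixed_field N)"
    using finite_fixed_field[OF assms] by (intro finite_PiE) auto
  ultimately show ?thesis by (meson finite_subset inj_on_finite)
qed

text \<open>Taking adjoints in the unitary equation and cancelling \<open>adj A\<close> gives
  \<open>adj (adj A) = A\<close>, so all entries lie in the field with q^2 elements.\<close>

lemma finite_unitaries: "finite unitaries"
proof (rule finite_subset[OF _ finite_Mat_fixed_field[of 2]])
  show "unitaries \<subseteq> {A \<in> carrier Mat. \<forall>i<n. \<forall>j<n. A $$ (i, j) \<in> fixed_field 2}"
  proof safe
    fix A assume A: "A \<in> unitaries"
    then have u: "A \<in> Units Mat" "A \<star> adj A = \<one>\<^bsub>Mat\<^esub>" by (auto simp: unitaries_def)
    then show c: "A \<in> carrier Mat" by auto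
    have "adj (adj A) \<star> adj A = \<one>\<^bsub>Mat\<^esub>"
      using arg_cong[OF u(2), of adj] c adj_closed by (simp add: adj_mult adj_one)
    then have "adj (adj A) \<star> adj A = A \<star> adj A" using u by simp
    then have eq: "adj (adj A) = A"
      using Mat.Units_r_cancel[OF adj_Units[OF u(1)]] c adj_closed by simp
    fix i j assume "i < n" "j < n"
    then have "A $$ (i, j) = (A $$ (i, j) [^] q) [^] q"
      using arg_cong[OF eq, of "\<lambda>B. B $$ (i, j)"] c adj_closed by (simp add: adj_entry)
    then show "A $$ (i, j) \<in> fixed_field 2"
      using Mat_entry[OF c \<open>i < n\<close> \<open>j < n\<close>] by (simp add: fixed_field_def nat_pow_pow power2_eq_square)
  qed
qed simp

text \<open>Over a finite subfield the monoid of matrices is finite, so one-sided inverses are two-sided.\<close>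

lemma right_inverse_imp_Unit:
  assumes A: "A \<in> carrier Mat" "\<And>i j. i < n \<Longrightarrow> j < n \<Longrightarrow> A $$ (i, j) \<in> fixed_field N"
    and B: "B \<in> carrier Mat"
    and AB: "A \<star> B = \<one>\<^bsub>Mat\<^esub>" and N: "N > 0"
  shows "A \<in> Units Mat"
proof -
  let ?X = "{A \<in> carrier Mat. \<forall>i<n. \<forall>j<n. A $$ (i, j) \<in> fixed_field N}"
  \<comment> \<open>B may have entries outside the finite field, so it only serves to show that
    right multiplication by A is injective; the left inverse comes from surjectivity on the finite
    set.\<close>
  have "inj_on (\<lambda>Y. Y \<star> A) ?X"
  proof (rule inj_onI)
    fix Y Z assume YZ: "Y \<in> ?X" "Z \<in> ?X" "Y \<star> A = Z \<star> A"
    have "Y = Y \<star> A \<star> B" using YZ(1) A(1) B AB by (simp add: Mat.m_assoc)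
    also have "\<dots> = Z" unfolding YZ(3) using YZ(2) A(1) B AB by (simp add: Mat.m_assoc)
    finally show "Y = Z" .
  qed
  moreover have "(\<lambda>Y. Y \<star> A) ` ?X \<subseteq> ?X"
    using A Mat_mult_closed by (auto simp: Mat_mult_entry intro!: fixed_field_closed(8,3))
  ultimately have "(\<lambda>Y. Y \<star> A) ` ?X = ?X"
    using endo_inj_surj[OF finite_Mat_fixed_field[OF N]] by blast
  moreover have "\<one>\<^bsub>Mat\<^esub> \<in> ?X"
    using fixed_field_closed(6,7) by (simp add: Mat_one_closed) (simp add: Mat_one)
  ultimately obtain C where C: "C \<in> carrier Mat" "C \<star> A = \<one>\<^bsub>Mat\<^esub>" by (smt (verit) imageE mem_Collect_eq)
  have "C = C \<star> (A \<star> B)" using AB C by simp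
  also have "\<dots> = B" using C A B by (simp flip: Mat.m_assoc)
  finally show ?thesis using A B C AB unfolding Units_def by blast
qed

end

section \<open>An orthonormal basis for a twisted Hermitian form\<close>

locale twisted_space = matrix_space L q n for L (structure) and q n +
  fixes s :: "nat \<Rightarrow> nat"
  assumes s_permutes: "s permutes {..<n}"
begin

lemma s_less [simp]: "s j < n \<longleftrightarrow> j < n"
  using permutes_in_image[OF s_permutes, of j] by simp

lemma s_inj [simp]: "s i = s j \<longleftrightarrow> i = j"
  using permutes_inj[OF s_permutes] by (auto dest: injD)

lemma s_pow_less [simp]: "(s ^^ k) j < n \<longleftrightarrow> j < n"
  by (induction k) auto

lemma s_pow_inj [simp]: "(s ^^ k) i = (s ^^ k) j \<longleftrightarrow> i = j"
  by (induction k) auto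

text \<open>With rows i and j of g as arguments this is the entry (i, j) of the product of g,
  \<open>perm_mat s\<close> and \<open>adj g\<close>.\<close>

definition form :: "(nat \<Rightarrow> 'a) \<Rightarrow> (nat \<Rightarrow> 'a) \<Rightarrow> 'a" where
  "form u v = (\<Oplus>j\<in>{..<n}. u (s j) \<otimes> v j [^] q)"

text \<open>On these vectors the form is Hermitian over the field with \<open>q\<^sup>2\<close> elements.\<close>

definition vecs :: "(nat \<Rightarrow> 'a) set" where
  "vecs = {v. (\<forall>j<n. v j \<in> carrier L) \<and> (\<forall>j<n. v (s (s j)) = v j [^] (q ^ 2))}"

lemma vecs_carrier: "v \<in> vecs \<Longrightarrow> j < n \<Longrightarrow> v j \<in> carrier L"
  by (simp add: vecs_def)

text \<open>If s^N is the identity, then 2 N steps along s return to j, and the relation in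
  \<open>vecs\<close> turns them into N applications of x -> x^(q^2). A single finite field for all
  coordinates makes the counting arguments possible.\<close>

lemma vecs_fixed_field: "\<exists>N>0. \<forall>v\<in>vecs. \<forall>j<n. v j \<in> fixed_field N"
proof -
  have "permutation s" using s_permutes by (auto simp: permutation_permutes)
  then obtain N where N: "s ^^ N = id" "N > 0" using permutation_is_nilpotent by blast
  have "v j \<in> fixed_field (2 * N)" if v: "v \<in> vecs" "j < n" for v j
  proof -
    have "v ((s ^^ (2 * k)) j) = v j [^] (q ^ (2 * k))" for k
    proof (induction k)
      case (Suc k)
      have exp: "q ^ (2 * Suc k) = q ^ (2 * k) * q ^ 2" by (simp add: power2_eq_square)
      have "v ((s ^^ (2 * Suc k)) j) = v (s (s ((s ^^ (2 * k)) j)))" by simp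
      also have "\<dots> = v ((s ^^ (2 * k)) j) [^] (q ^ 2)"
        using v unfolding vecs_def by (simp del: funpow.simps)
      also have "\<dots> = v j [^] (q ^ (2 * Suc k))"
        using vecs_carrier[OF v] by (simp only: Suc nat_pow_pow exp)
      finally show ?case .
    qed (use vecs_carrier[OF v] in simp)
    from this[of N] have "v j [^] (q ^ (2 * N)) = v j"
      using N by (simp add: mult_2 funpow_add)
    then show ?thesis using vecs_carrier[OF v] by (simp add: fixed_field_def)
  qed
  then show ?thesis using N(2) by (intro exI[of _ "2 * N"]) auto
qed

text \<open>
  Vectors supported on the orbit of \<open>k0\<close> are parametrized by a finite field; orthogonality to all
  of them gives an additive polynomial with more roots than its degree.
\<close>

lemma sum_vecs_nondegenerate:
  assumes y: "\<And>j. j < n \<Longrightarrow> y j \<in> carrier L"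
    and orth: "\<And>v. v \<in> vecs \<Longrightarrow> (\<Oplus>j\<in>{..<n}. v j \<otimes> y j) = \<zero>" and k0: "k0 < n"
  shows "y k0 = \<zero>"
proof (rule ccontr)
  assume nz: "y k0 \<noteq> \<zero>"
  \<comment> \<open>The relation in \<open>vecs\<close> moves two steps along s, so the relevant
    orbits are those of s composed with s; \<open>l\<close> below is the length of the one through
    \<open>k0\<close>.\<close>
  define t where "t c = (s ^^ (2 * c)) k0" for c
  have t_Suc: "t (Suc c) = s (s (t c))" for c by (simp add: t_def)
  have t_less: "t c < n" for c using k0 by (simp add: t_def)
  have t0: "t 0 = k0" by (simp add: t_def)
  have shift: "t a = t b \<Longrightarrow> a \<le> b \<Longrightarrow> t (b - a) = k0" for a b
  proof -
    assume ab: "t a = t b" "a \<le> b"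
    then have "2 * b = 2 * a + 2 * (b - a)" by simp
    then have "(s ^^ (2 * a)) k0 = (s ^^ (2 * a)) ((s ^^ (2 * (b - a))) k0)"
      using ab(1) unfolding t_def by (metis funpow_add o_apply)
    then show "t (b - a) = k0" by (simp add: t_def)
  qed
  have "\<exists>l>0. t l = k0"
  proof -
    have "permutation s" using s_permutes by (auto simp: permutation_permutes)
    then obtain N where N: "s ^^ N = id" "N > 0" using permutation_is_nilpotent by blast
    then show ?thesis by (intro exI[of _ N]) (auto simp: t_def mult_2 funpow_add)
  qed
  define l where "l = (LEAST l. l > 0 \<and> t l = k0)"
  have l: "l > 0" "t l = k0" using LeastI_ex[OF \<open>\<exists>l>0. t l = k0\<close>] by (auto simp: l_def)
  have l_min: "t c \<noteq> k0" if "0 < c" "c < l" for c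
    using that not_less_Least[of c "\<lambda>l. l > 0 \<and> t l = k0"] by (auto simp: l_def)
  have t_inj: "inj_on t {..<l}"
  proof (rule linorder_inj_onI)
    fix a b assume "a < b" "a \<in> {..<l}" "b \<in> {..<l}"
    then show "t a \<noteq> t b" using shift[of a b] l_min[of "b - a"] by auto
  qed linarith
  define co where "co = the_inv_into {..<l} t"
  have co: "co (t c) = c" if "c < l" for c using the_inv_into_f_f[OF t_inj] that by (simp add: co_def)
  have orbit_s: "s (s j) \<in> t ` {..<l} \<longleftrightarrow> j \<in> t ` {..<l}" for j
  proof
    assume "j \<in> t ` {..<l}"
    then obtain c where c: "c < l" "s (s j) = t (Suc c)" by (auto simp: t_Suc)
    show "s (s j) \<in> t ` {..<l}"
    proof (cases "Suc c < l")
      case False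
      then have "t (Suc c) = t 0" using c l t0 by (metis Suc_lessI)
      then show ?thesis using c l by auto
    qed (use c in auto)
  next
    assume "s (s j) \<in> t ` {..<l}"
    then obtain c where c: "c < l" "s (s j) = t c" by auto
    show "j \<in> t ` {..<l}"
    proof (cases c)
      case 0
      then have "s (s j) = t (Suc (l - 1))" using c l t0 by simp
      then show ?thesis using l unfolding t_Suc by auto
    next
      case (Suc d)
      then have "s (s j) = s (s (t d))" using c t_Suc by simp
      then show ?thesis using c Suc by auto
    qed
  qed
  have key: "(\<Oplus>c\<in>{..<l}. y (t c) \<otimes> a [^] ((q ^ 2) ^ c)) = \<zero>" if a: "a \<in> fixed_field (2 * l)" for a
  proof -
    have ac: "a \<in> carrier L" "a [^] ((q ^ 2) ^ l) = a"
      using a by (auto simp: fixed_field_def power_mult)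
    \<comment> \<open>The value at \<open>k0\<close> can be any such a. The values along the orbit
      are its successive q^2-th powers, and they close up after l steps because a lies in the field
      with q^(2 l) elements.\<close>
    define v where "v j = (if j \<in> t ` {..<l} then a [^] ((q ^ 2) ^ co j) else \<zero>)" for j
    have vt: "v (t c) = a [^] ((q ^ 2) ^ c)" if "c < l" for c
      using that co by (auto simp: v_def)
    have v0: "v j = \<zero>" if "j \<notin> t ` {..<l}" for j using that unfolding v_def by (rule if_not_P)
    have "v \<in> vecs" unfolding vecs_def
    proof safe
      fix j assume "j < n"
      show "v j \<in> carrier L" using ac by (simp add: v_def)
      show "v (s (s j)) = v j [^] (q ^ 2)"
      proof (cases "j \<in> t ` {..<l}")
        case True
        then obtain c where c: "c < l" "j = t c" by auto
        have "v (t (Suc c)) = a [^] ((q ^ 2) ^ Suc c)"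
        proof (cases "Suc c < l")
          case True then show ?thesis by (rule vt)
        next
          case False
          then have "Suc c = l" using c by simp
          then show ?thesis using vt[of 0] l t0 ac by (simp del: power_Suc)
        qed
        then show ?thesis using c vt[of c] ac by (simp add: t_Suc nat_pow_pow mult.commute)
      next
        case False
        then show ?thesis using v0 orbit_s q_ge_2 by (simp add: nat_pow_zero)
      qed
    qed
    from orth[OF this] have "\<zero> = (\<Oplus>j\<in>{..<n}. v j \<otimes> y j)" by simp
    also have "\<dots> = (\<Oplus>j\<in>t ` {..<l}. v j \<otimes> y j)"
      by (rule add.finprod_mono_neutral_cong_right) (use v0 t_less vecs_carrier[OF \<open>v \<in> vecs\<close>] y in auto)
    also have "\<dots> = (\<Oplus>c\<in>{..<l}. v (t c) \<otimes> y (t c))"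
      by (rule finsum_reindex) (use t_less vecs_carrier[OF \<open>v \<in> vecs\<close>] y t_inj in auto)
    also have "\<dots> = (\<Oplus>c\<in>{..<l}. y (t c) \<otimes> a [^] ((q ^ 2) ^ c))"
      by (rule finsum_cong') (use vt t_less y ac in \<open>auto simp: m_comm\<close>)
    finally show ?thesis by simp
  qed
  let ?R = "{a \<in> carrier L. (\<Oplus>c\<in>{..<l}. y (t c) \<otimes> a [^] ((q ^ 2) ^ c)) = \<zero>}"
  have Q: "q ^ 2 \<ge> 2" using q_ge_2 self_le_power[of q 2] by linarith
  have "(\<lambda>c. y (t c)) \<in> {..<l} \<rightarrow> carrier L" "\<exists>c<l. y (t c) \<noteq> \<zero>"
    using y t_less nz l t0 by (auto intro!: exI[of _ 0])
  note R = card_additive_poly_roots[OF this Q]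
  have "fixed_field (2 * l) \<subseteq> ?R" using key fixed_field_closed(1) by auto
  then have "card (fixed_field (2 * l)) \<le> card ?R" by (rule card_mono[OF R(1)])
  then show False using R(2) card_fixed_field[of "2 * l"] l by (simp add: power_mult)
qed

section \<open>Sesquilinearity and Hermitian symmetry\<close>

lemma form_carrier:
  "\<lbrakk>\<And>j. j < n \<Longrightarrow> u j \<in> carrier L; \<And>j. j < n \<Longrightarrow> v j \<in> carrier L\<rbrakk> \<Longrightarrow> form u v \<in> carrier L"
  unfolding form_def by (intro finsum_closed) auto

lemma form_cong:
  assumes "\<And>j. j < n \<Longrightarrow> u j = u' j" "\<And>j. j < n \<Longrightarrow> v j = v' j"
    "\<And>j. j < n \<Longrightarrow> u' j \<in> carrier L" "\<And>j. j < n \<Longrightarrow> v' j \<in> carrier L"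
  shows "form u v = form u' v'"
  unfolding form_def by (rule finsum_cong') (use assms in auto)

lemma form_add_left:
  assumes "\<And>j. j < n \<Longrightarrow> u j \<in> carrier L" "\<And>j. j < n \<Longrightarrow> u' j \<in> carrier L"
    "\<And>j. j < n \<Longrightarrow> v j \<in> carrier L"
  shows "form (\<lambda>j. u j \<oplus> u' j) v = form u v \<oplus> form u' v"
proof -
  have "form (\<lambda>j. u j \<oplus> u' j) v = (\<Oplus>j\<in>{..<n}. u (s j) \<otimes> v j [^] q \<oplus> u' (s j) \<otimes> v j [^] q)"
    unfolding form_def by (rule finsum_cong') (use assms in \<open>auto simp: l_distr\<close>)
  also have "\<dots> = form u v \<oplus> form u' v"
    unfolding form_def by (rule finsum_addf) (use assms in auto)
  finally show ?thesis .
qed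

lemma form_add_right:
  assumes "\<And>j. j < n \<Longrightarrow> u j \<in> carrier L" "\<And>j. j < n \<Longrightarrow> v j \<in> carrier L"
    "\<And>j. j < n \<Longrightarrow> v' j \<in> carrier L"
  shows "form u (\<lambda>j. v j \<oplus> v' j) = form u v \<oplus> form u v'"
proof -
  have "form u (\<lambda>j. v j \<oplus> v' j) = (\<Oplus>j\<in>{..<n}. u (s j) \<otimes> v j [^] q \<oplus> u (s j) \<otimes> v' j [^] q)"
    unfolding form_def
    by (rule finsum_cong') (use assms frobenius_add[of _ _ 1] in \<open>auto simp: r_distr\<close>)
  also have "\<dots> = form u v \<oplus> form u v'"
    unfolding form_def by (rule finsum_addf) (use assms in auto)
  finally show ?thesis .
qed

lemma form_smult_left:
  assumes "\<And>j. j < n \<Longrightarrow> u j \<in> carrier L" "\<And>j. j < n \<Longrightarrow> v j \<in> carrier L" "c \<in> carrier L"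
  shows "form (\<lambda>j. c \<otimes> u j) v = c \<otimes> form u v"
proof -
  have "form (\<lambda>j. c \<otimes> u j) v = (\<Oplus>j\<in>{..<n}. c \<otimes> (u (s j) \<otimes> v j [^] q))"
    unfolding form_def by (rule finsum_cong') (use assms in \<open>auto simp: m_assoc\<close>)
  also have "\<dots> = c \<otimes> form u v"
    unfolding form_def by (rule finsum_rdistr[symmetric]) (use assms in auto)
  finally show ?thesis .
qed

lemma form_smult_right:
  assumes "\<And>j. j < n \<Longrightarrow> u j \<in> carrier L" "\<And>j. j < n \<Longrightarrow> v j \<in> carrier L" "c \<in> carrier L"
  shows "form u (\<lambda>j. c \<otimes> v j) = c [^] q \<otimes> form u v"
proof -
  have "form u (\<lambda>j. c \<otimes> v j) = (\<Oplus>j\<in>{..<n}. c [^] q \<otimes> (u (s j) \<otimes> v j [^] q))"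
    unfolding form_def by (rule finsum_cong') (use assms in \<open>auto simp: nat_pow_distrib m_lcomm\<close>)
  also have "\<dots> = c [^] q \<otimes> form u v"
    unfolding form_def by (rule finsum_rdistr[symmetric]) (use assms in auto)
  finally show ?thesis .
qed

lemma form_sum_left:
  assumes "finite A" "\<And>i j. i \<in> A \<Longrightarrow> j < n \<Longrightarrow> u i j \<in> carrier L" "\<And>i. i \<in> A \<Longrightarrow> c i \<in> carrier L"
    "\<And>j. j < n \<Longrightarrow> v j \<in> carrier L"
  shows "form (\<lambda>j. \<Oplus>i\<in>A. c i \<otimes> u i j) v = (\<Oplus>i\<in>A. c i \<otimes> form (u i) v)"
  using assms(1-3)
proof (induction A)
  case empty
  then show ?case
    using assms(4) unfolding form_def by (auto intro!: add.finprod_one_eqI)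
next
  case (insert x A)
  have "form (\<lambda>j. \<Oplus>i\<in>insert x A. c i \<otimes> u i j) v = form (\<lambda>j. c x \<otimes> u x j \<oplus> (\<Oplus>i\<in>A. c i \<otimes> u i j)) v"
    by (rule form_cong) (use insert.prems insert.hyps assms(4) in \<open>auto simp: Pi_def intro!: finsum_closed\<close>)
  also have "\<dots> = c x \<otimes> form (u x) v \<oplus> (\<Oplus>i\<in>A. c i \<otimes> form (u i) v)"
    using insert assms(4)
    by (subst form_add_left) (auto simp: form_smult_left intro!: finsum_closed)
  also have "\<dots> = (\<Oplus>i\<in>insert x A. c i \<otimes> form (u i) v)"
    using insert assms(4) by (auto simp: Pi_def form_carrier)
  finally show ?case .
qed

text \<open>The q-th power turns the second factor into v(j)^(q^2), which is v(s(s j)) on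
  \<open>vecs\<close>; substituting j for s j gives the form with its arguments exchanged.\<close>

lemma form_hermitian:
  assumes u: "u \<in> vecs" and v: "v \<in> vecs"
  shows "form u v [^] q = form v u"
proof -
  note uc = vecs_carrier[OF u] and vc = vecs_carrier[OF v]
  have vs: "v (s (s j)) = v j [^] (q ^ 2)" if "j < n" for j using v that by (simp add: vecs_def)
  have "form u v [^] q = (\<Oplus>j\<in>{..<n}. (u (s j) \<otimes> v j [^] q) [^] q)"
    unfolding form_def using frobenius_finsum[of "\<lambda>j. u (s j) \<otimes> v j [^] q" _ 1] uc vc by simp
  also have "\<dots> = (\<Oplus>j\<in>{..<n}. v (s (s j)) \<otimes> u (s j) [^] q)"
    by (rule finsum_cong')
      (use uc vc vs in \<open>auto simp: nat_pow_distrib nat_pow_pow power2_eq_square m_comm\<close>)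
  also have "\<dots> = (\<Oplus>j\<in>s ` {..<n}. v (s j) \<otimes> u j [^] q)"
    by (rule finsum_reindex[symmetric]) (use uc vc in \<open>auto intro: inj_onI\<close>)
  also have "s ` {..<n} = {..<n}" using permutes_image[OF s_permutes] .
  finally show ?thesis by (simp add: form_def)
qed

lemma form_fixed_field: "u \<in> vecs \<Longrightarrow> v \<in> vecs \<Longrightarrow> form u v \<in> fixed_field 2"
  using form_hermitian[of u v] form_hermitian[of v u] vecs_carrier
  by (simp add: fixed_field_def power2_eq_square form_carrier flip: nat_pow_pow)

lemma vecs_add: "u \<in> vecs \<Longrightarrow> v \<in> vecs \<Longrightarrow> (\<lambda>j. u j \<oplus> v j) \<in> vecs"
  by (simp add: vecs_def frobenius_add)

lemma vecs_smult: "c \<in> fixed_field 2 \<Longrightarrow> v \<in> vecs \<Longrightarrow> (\<lambda>j. c \<otimes> v j) \<in> vecs"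
  by (simp add: vecs_def nat_pow_distrib fixed_field_def)

lemma vecs_sum:
  assumes "\<And>i. i \<in> A \<Longrightarrow> u i \<in> vecs" "\<And>i. i \<in> A \<Longrightarrow> c i \<in> fixed_field 2"
  shows "(\<lambda>j. \<Oplus>i\<in>A. c i \<otimes> u i j) \<in> vecs"
proof -
  have cl: "c i \<otimes> u i j \<in> carrier L" if "i \<in> A" "j < n" for i j
    using assms that vecs_carrier[of "u i" j] fixed_field_closed(1)[of "c i" 2] by simp
  show ?thesis unfolding vecs_def
  proof safe
    fix j assume j: "j < n"
    show "(\<Oplus>i\<in>A. c i \<otimes> u i j) \<in> carrier L" using cl j by (intro finsum_closed) auto
    show "(\<Oplus>i\<in>A. c i \<otimes> u i (s (s j))) = (\<Oplus>i\<in>A. c i \<otimes> u i j) [^] (q ^ 2)"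
      using cl j assms vecs_smult[of "c _" "u _"]
      by (subst frobenius_finsum) (auto intro!: finsum_cong' simp: vecs_def)
  qed
qed

section \<open>Orthonormal families\<close>

definition orthonormal :: "nat \<Rightarrow> (nat \<Rightarrow> nat \<Rightarrow> 'a) \<Rightarrow> bool" where
  "orthonormal k u \<longleftrightarrow> (\<forall>i<k. u i \<in> vecs) \<and>
     (\<forall>i<k. \<forall>m<k. form (u i) (u m) = (if i = m then \<one> else \<zero>))"

lemma finsum_delta:
  assumes "m < k" "\<And>i. i < k \<Longrightarrow> c i \<in> carrier L"
  shows "(\<Oplus>i\<in>{..<k::nat}. c i \<otimes> (if i = m then \<one> else \<zero>)) = c m"
proof -
  have "(\<Oplus>i\<in>{..<k}. c i \<otimes> (if i = m then \<one> else \<zero>)) = (\<Oplus>i\<in>{m}. c i \<otimes> (if i = m then \<one> else \<zero>))"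
    by (rule add.finprod_mono_neutral_cong_right) (use assms in auto)
  then show ?thesis using assms by simp
qed

lemma form_sum_orthonormal:
  assumes "orthonormal k u" "m < k" "\<And>i. i < k \<Longrightarrow> c i \<in> carrier L"
  shows "form (\<lambda>j. \<Oplus>i\<in>{..<k}. c i \<otimes> u i j) (u m) = c m"
proof -
  have uc: "u i j \<in> carrier L" if "i < k" "j < n" for i j
    using assms(1) that vecs_carrier by (auto simp: orthonormal_def)
  have "form (\<lambda>j. \<Oplus>i\<in>{..<k}. c i \<otimes> u i j) (u m) = (\<Oplus>i\<in>{..<k}. c i \<otimes> form (u i) (u m))"
    by (rule form_sum_left) (use uc assms in auto)
  also have "\<dots> = (\<Oplus>i\<in>{..<k}. c i \<otimes> (if i = m then \<one> else \<zero>))"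
    by (rule finsum_cong') (use assms in \<open>auto simp: orthonormal_def\<close>)
  also have "\<dots> = c m" by (rule finsum_delta) (use assms in auto)
  finally show ?thesis .
qed

text \<open>Pairing a linear combination with the members of the family recovers its coefficients.
  So E^k embeds into E^n for a finite field E that contains all coordinates, and cardinalities
  decide.\<close>

lemma orthonormal_le:
  assumes u: "orthonormal k u"
  shows "k \<le> n"
proof -
  obtain N where N: "N > 0" "\<And>v j. v \<in> vecs \<Longrightarrow> j < n \<Longrightarrow> v j \<in> fixed_field N"
    using vecs_fixed_field by blast
  let ?E = "fixed_field N"
  have uE: "u i j \<in> ?E" if "i < k" "j < n" for i j
    using u that N(2) by (auto simp: orthonormal_def)
  have uc: "u i j \<in> carrier L" if "i < k" "j < n" for i j
    using uE[OF that] fixed_field_closed(1) by blast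
  define F where "F = (\<lambda>c. \<lambda>j\<in>{..<n}. \<Oplus>i\<in>{..<k}. c i \<otimes> u i j)"
  have "inj_on F ({..<k} \<rightarrow>\<^sub>E ?E)"
  proof (rule inj_onI)
    fix c c' assume c: "c \<in> {..<k} \<rightarrow>\<^sub>E ?E" "c' \<in> {..<k} \<rightarrow>\<^sub>E ?E" and eq: "F c = F c'"
    have cc: "c i \<in> carrier L" "c' i \<in> carrier L" if "i < k" for i
      using c that fixed_field_closed(1) by (auto simp: PiE_iff)
    have "(\<Oplus>i\<in>{..<k}. c i \<otimes> u i j) = (\<Oplus>i\<in>{..<k}. c' i \<otimes> u i j)" if "j < n" for j
      using fun_cong[OF eq, of j] that by (simp add: F_def)
    then have "form (\<lambda>j. \<Oplus>i\<in>{..<k}. c i \<otimes> u i j) (u m) = form (\<lambda>j. \<Oplus>i\<in>{..<k}. c' i \<otimes> u i j) (u m)" if "m < k" for m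
      using that uc cc by (intro form_cong) (auto intro!: finsum_closed)
    then have "c m = c' m" if "m < k" for m
      using that cc form_sum_orthonormal[OF u] by simp
    then show "c = c'" using c by (intro PiE_ext) auto
  qed
  moreover have "F ` ({..<k} \<rightarrow>\<^sub>E ?E) \<subseteq> {..<n} \<rightarrow>\<^sub>E ?E"
    using uE by (auto simp: F_def PiE_iff intro!: fixed_field_closed(8,3))
  moreover have "finite ({..<n} \<rightarrow>\<^sub>E ?E)"
    using finite_fixed_field[OF N(1)] by (intro finite_PiE) auto
  ultimately have "card ({..<k} \<rightarrow>\<^sub>E ?E) \<le> card ({..<n} \<rightarrow>\<^sub>E ?E)"
    by (rule card_inj_on_le)
  then have "(q ^ N) ^ k \<le> (q ^ N) ^ n"
    by (simp add: card_PiE card_fixed_field[OF N(1)])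
  moreover have "q ^ N > 1" using q_ge_2 N by (intro one_less_power) auto
  ultimately show ?thesis using power_le_imp_le_exp by blast
qed

text \<open>Shifting the sum by s turns the form into the pairing of
  \<open>sum_vecs_nondegenerate\<close>, with the q-th powers of v transported along s as the fixed
  vector.\<close>

lemma form_nondegenerate:
  assumes v: "\<And>j. j < n \<Longrightarrow> v j \<in> carrier L" and orth: "\<And>u. u \<in> vecs \<Longrightarrow> form u v = \<zero>" and "j < n"
  shows "v j = \<zero>"
proof -
  define y where "y j = v (inv_into UNIV s j) [^] q" for j
  have s_inv: "inv_into UNIV s (s i) = i" for i
    using permutes_inverses(2)[OF s_permutes] .
  have ys: "y (s i) = v i [^] q" for i by (simp add: y_def s_inv)
  have sy: "\<exists>i<n. j = s i" if "j < n" for j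
    using permutes_image[OF s_permutes] that by (metis imageE lessThan_iff)
  have yc: "y j \<in> carrier L" if "j < n" for j using sy[OF that] v ys by auto
  have "y (s j) = \<zero>"
  proof (rule sum_vecs_nondegenerate)
    fix u assume u: "u \<in> vecs"
    have "(\<Oplus>j\<in>s ` {..<n}. u j \<otimes> y j) = (\<Oplus>j\<in>{..<n}. u (s j) \<otimes> y (s j))"
      by (rule finsum_reindex) (use yc vecs_carrier[OF u] in \<open>auto intro: inj_onI\<close>)
    also have "\<dots> = form u v"
      unfolding form_def ys ..
    finally show "(\<Oplus>j\<in>{..<n}. u j \<otimes> y j) = \<zero>"
      using orth[OF u] by (simp add: permutes_image[OF s_permutes])
  qed (use yc assms in auto)
  then show ?thesis using v[OF assms(3)] nat_pow_nonzero unfolding ys by blast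
qed

text \<open>Scaling v by c multiplies its value b by c^(q+1), so c is taken with c^(q+1) = 1/b.
  Since b is fixed by x -> x^q, this c lies in the field with q^2 elements and the scaled vector
  stays in \<open>vecs\<close>: the norm from that field onto the field with q elements is
  surjective.\<close>

lemma orthonormal_extend:
  assumes u: "orthonormal k u" and v: "v \<in> vecs" and orth: "\<And>m. m < k \<Longrightarrow> form v (u m) = \<zero>"
    and nz: "form v v \<noteq> \<zero>"
  shows "\<exists>u'. orthonormal (Suc k) u'"
proof -
  define b where "b = form v v"
  have b: "b \<in> carrier L" "b \<noteq> \<zero>" "b [^] q = b"
    using nz form_hermitian[OF v v] form_carrier vecs_carrier[OF v] by (auto simp: b_def)
  have ib: "inv b \<in> carrier L" "inv b \<otimes> b = \<one>" using b by (auto simp: field_Units)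
  obtain c where c: "c \<in> carrier L" "c [^] Suc q = inv b" using ex_nth_root[OF ib(1), of "Suc q"] by auto
  have "inv b [^] q \<otimes> b = inv b \<otimes> b"
    using nat_pow_distrib[OF ib(1) b(1), of q] b ib by simp
  then have ibq: "inv b [^] q = inv b" using b ib m_rcancel[of b "inv b [^] q" "inv b"] by simp
  have c0: "c \<noteq> \<zero>"
  proof
    assume "c = \<zero>"
    then have "inv b = \<zero>" using c by simp
    then show False using ib b by simp
  qed
  \<comment> \<open>Raising c^(q+1) = 1/b to the power q changes nothing, as 1/b is fixed;
    cancelling c^q leaves c^(q^2) = c.\<close>
  have "c [^] (q ^ 2) \<otimes> c [^] q = (c [^] Suc q) [^] q"
    using c(1) by (simp add: nat_pow_distrib nat_pow_pow power2_eq_square nat_pow_mult)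
  also have "\<dots> = c \<otimes> c [^] q" using c ibq by (simp add: m_comm)
  finally have "c [^] (q ^ 2) = c" using m_rcancel[of "c [^] q"] c c0 nat_pow_nonzero by simp
  then have cE: "c \<in> fixed_field 2" using c by (simp add: fixed_field_def)
  define u' where "u' i = (if i = k then (\<lambda>j. c \<otimes> v j) else u i)" for i
  note vc = vecs_carrier[OF v]
  have uv: "u m \<in> vecs" "\<And>j. j < n \<Longrightarrow> u m j \<in> carrier L" if "m < k" for m
    using u that vecs_carrier by (auto simp: orthonormal_def)
  have "form (\<lambda>j. c \<otimes> v j) (\<lambda>j. c \<otimes> v j) = c \<otimes> (c [^] q \<otimes> b)"
    using c vc by (subst form_smult_left, auto)+ (simp add: form_smult_right b_def)
  also have "\<dots> = (c [^] Suc q) \<otimes> b" using c(1) b by (simp add: m_ac)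
  also have "\<dots> = \<one>" unfolding c(2) by (rule ib(2))
  finally have 1: "form (\<lambda>j. c \<otimes> v j) (\<lambda>j. c \<otimes> v j) = \<one>" .
  have 2: "form (\<lambda>j. c \<otimes> v j) (u m) = \<zero>" if "m < k" for m
    using c vc uv that orth by (simp add: form_smult_left)
  have 3: "form (u m) (\<lambda>j. c \<otimes> v j) = \<zero>" if "m < k" for m
  proof -
    have "form (u m) v = \<zero>"
      using form_hermitian[OF v uv(1)[OF that]] orth[OF that] q_ge_2 by (simp add: nat_pow_zero)
    then show ?thesis using c vc uv that by (simp add: form_smult_right)
  qed
  have "orthonormal (Suc k) u'"
    using u vecs_smult[OF cE v] 1 2 3 by (auto simp: orthonormal_def u'_def less_Suc_eq)
  then show ?thesis by blast
qed

text \<open>Polarization in every characteristic: with b = \<open>form v w\<close>, the value at v +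
  a w is b^q a + b a^q for each a in the field with q^2 elements, and a nonzero polynomial of degree
  q cannot vanish at q^2 points.\<close>

lemma isotropic_imp_zero:
  assumes v: "v \<in> vecs" and w: "w \<in> vecs"
    and iso: "\<And>a. a \<in> fixed_field 2 \<Longrightarrow> form (\<lambda>j. v j \<oplus> a \<otimes> w j) (\<lambda>j. v j \<oplus> a \<otimes> w j) = \<zero>"
      "form v v = \<zero>" "form w w = \<zero>"
  shows "form v w = \<zero>"
proof (rule ccontr)
  define b where "b = form v w"
  assume "form v w \<noteq> \<zero>"
  then have b: "b \<in> carrier L" "b \<noteq> \<zero>" using v w vecs_carrier by (auto simp: b_def form_carrier)
  have bq: "form w v = b [^] q" using form_hermitian[OF v w] by (simp add: b_def)
  define y where "y c = (if c = 0 then b [^] q else b)" for c :: nat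
  let ?R = "{a \<in> carrier L. (\<Oplus>c\<in>{..<2}. y c \<otimes> a [^] (q ^ c)) = \<zero>}"
  have "fixed_field 2 \<subseteq> ?R"
  proof
    fix a assume aE: "a \<in> fixed_field 2"
    then have a: "a \<in> carrier L" by (rule fixed_field_closed)
    note vc = vecs_carrier[OF v] and wc = vecs_carrier[OF w]
    have "\<zero> = form (\<lambda>j. v j \<oplus> a \<otimes> w j) (\<lambda>j. v j \<oplus> a \<otimes> w j)" using iso(1)[OF aE] by simp
    also have "\<dots> = (form v v \<oplus> a [^] q \<otimes> form v w) \<oplus> a \<otimes> (form w v \<oplus> a [^] q \<otimes> form w w)"
      using a vc wc by (simp add: form_add_left form_add_right form_smult_left form_smult_right form_carrier r_distr)
    also have "\<dots> = b [^] q \<otimes> a \<oplus> b \<otimes> a [^] q"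
      using a b iso bq by (simp add: b_def[symmetric] m_comm a_comm)
    also have "\<dots> = (\<Oplus>c\<in>{..<2}. y c \<otimes> a [^] (q ^ c))"
      using a b by (simp add: numeral_2_eq_2 lessThan_Suc y_def a_comm)
    finally show "a \<in> ?R" using a by simp
  qed
  moreover have "y \<in> {..<2} \<rightarrow> carrier L" "\<exists>c<2. y c \<noteq> \<zero>"
    using b by (auto simp: y_def intro!: exI[of _ 1])
  note R = card_additive_poly_roots[OF this q_ge_2]
  ultimately have "card (fixed_field 2) \<le> card ?R" using R(1) by (intro card_mono)
  then show False using R(2) card_fixed_field[of 2] by simp
qed

text \<open>By maximality every vector orthogonal to the family has value zero, so by polarization
  the form vanishes on the space S of all of them. The remainder \<open>r w\<close> is orthogonal
  both to S and to the family, hence to all of \<open>vecs\<close>, and nondegeneracy makes it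
  zero.\<close>

lemma orthonormal_maximal_expansion:
  assumes u: "orthonormal k u" and max: "\<nexists>u'. orthonormal (Suc k) u'" and w: "w \<in> vecs" and "j < n"
  shows "w j = (\<Oplus>i\<in>{..<k}. form w (u i) \<otimes> u i j)"
proof -
  have uv: "u m \<in> vecs" "\<And>j. j < n \<Longrightarrow> u m j \<in> carrier L" if "m < k" for m
    using u that vecs_carrier by (auto simp: orthonormal_def)
  \<comment> \<open>The projection onto the span of the family with the opposite sign, so that the
    remainder \<open>r\<close> is a sum.\<close>
  define P where "P w j = (\<Oplus>i\<in>{..<k}. \<ominus> form w (u i) \<otimes> u i j)" for w j
  define r where "r w j = w j \<oplus> P w j" for w j
  have Pv: "P v \<in> vecs" if "v \<in> vecs" for v
    unfolding P_def using uv form_fixed_field[OF that] fixed_field_closed(4)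
    by (intro vecs_sum) auto
  have rv: "r v \<in> vecs" if "v \<in> vecs" for v
    unfolding r_def using Pv that by (intro vecs_add) auto
  have form_uv: "form v (u m) \<in> carrier L" if "v \<in> vecs" "m < k" for v m
    using that uv vecs_carrier by (intro form_carrier) auto
  have r_orth: "form (r v) (u m) = \<zero>" if v: "v \<in> vecs" and m: "m < k" for v m
  proof -
    have "form (r v) (u m) = form v (u m) \<oplus> form (P v) (u m)"
      unfolding r_def using uv[OF m] vecs_carrier v Pv[OF v] by (intro form_add_left) auto
    also have "form (P v) (u m) = \<ominus> form v (u m)"
      unfolding P_def by (rule form_sum_orthonormal[OF u m]) (use form_uv[OF v] in auto)
    finally show ?thesis using form_uv[OF v m] by (simp add: r_neg)
  qed
  define S where "S = {v \<in> vecs. \<forall>m<k. form v (u m) = \<zero>}"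
  have S_iso: "form v v = \<zero>" if "v \<in> S" for v
    using orthonormal_extend[OF u, of v] that max by (auto simp: S_def)
  have S_orth: "form v v' = \<zero>" if "v \<in> S" "v' \<in> S" for v v'
  proof (rule isotropic_imp_zero)
    fix a assume a: "a \<in> fixed_field 2"
    have "(\<lambda>j. v j \<oplus> a \<otimes> v' j) \<in> S"
      using that vecs_add[OF _ vecs_smult[OF a]] uv vecs_carrier fixed_field_closed(1)[OF a]
      by (auto simp: S_def form_add_left form_smult_left)
    then show "form (\<lambda>j. v j \<oplus> a \<otimes> v' j) (\<lambda>j. v j \<oplus> a \<otimes> v' j) = \<zero>" by (rule S_iso)
  qed (use that S_iso in \<open>auto simp: S_def\<close>)
  have rw: "r w \<in> S" using rv[OF w] r_orth[OF w] by (simp add: S_def)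
  have "r w j = \<zero>"
  proof (rule form_nondegenerate)
    fix v assume v: "v \<in> vecs"
    have Pz: "form (P v) (r w) = \<zero>"
    proof -
      have "form (u i) (r w) = \<zero>" if "i < k" for i
        using form_hermitian[OF rv[OF w] uv(1)[OF that]] r_orth[OF w that] q_ge_2
        by (simp add: nat_pow_zero)
      moreover have "form (P v) (r w) = (\<Oplus>i\<in>{..<k}. \<ominus> form v (u i) \<otimes> form (u i) (r w))"
        unfolding P_def
        by (rule form_sum_left) (use uv form_uv[OF v] vecs_carrier[OF rv[OF w]] in auto)
      moreover have "(\<Oplus>i\<in>{..<k}. \<ominus> form v (u i) \<otimes> form (u i) (r w)) = \<zero>"
        by (rule add.finprod_one_eqI) (use calculation(1) form_uv[OF v] in auto)
      ultimately show ?thesis by simp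
    qed
    have "\<zero> = form (r v) (r w)"
      using S_orth[of "r v" "r w"] rw rv[OF v] r_orth[OF v] by (simp add: S_def)
    also have "\<dots> = form v (r w) \<oplus> form (P v) (r w)"
      unfolding r_def[of v] using vecs_carrier v Pv[OF v] rv[OF w] by (intro form_add_left) auto
    finally show "form v (r w) = \<zero>"
      using Pz v rv[OF w] vecs_carrier form_carrier[of v "r w"] by simp
  qed (use vecs_carrier rv w assms in auto)
  moreover have "P w j = \<ominus> (\<Oplus>i\<in>{..<k}. form w (u i) \<otimes> u i j)"
  proof -
    have "P w j \<oplus> (\<Oplus>i\<in>{..<k}. form w (u i) \<otimes> u i j)
        = (\<Oplus>i\<in>{..<k}. \<ominus> form w (u i) \<otimes> u i j \<oplus> form w (u i) \<otimes> u i j)"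
      unfolding P_def by (rule finsum_addf[symmetric]) (use uv form_uv[OF w] assms in auto)
    also have "\<dots> = \<zero>"
      by (rule add.finprod_one_eqI) (use uv form_uv[OF w] assms in \<open>auto simp: l_minus l_neg\<close>)
    finally show ?thesis
      using uv form_uv[OF w] assms vecs_carrier[OF Pv[OF w]]
      by (intro minus_equality[symmetric]) (auto intro!: finsum_closed)
  qed
  moreover have "(\<Oplus>i\<in>{..<k}. form w (u i) \<otimes> u i j) \<in> carrier L"
    using uv form_uv[OF w] assms by (auto intro!: finsum_closed)
  ultimately show ?thesis using vecs_carrier[OF w assms(4)] by (simp add: r_def flip: a_minus_def)
qed

text \<open>A family of maximal length k spans \<open>vecs\<close> by the expansion, so a vector
  over E that is annihilated by its k members under the plain dot product is annihilated by all of
  \<open>vecs\<close> and is zero. The members therefore embed E^n into E^k, which gives n <=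
  k.\<close>

lemma ex_orthonormal: "\<exists>u. orthonormal n u"
proof -
  have "orthonormal 0 undefined" by (simp add: orthonormal_def)
  then have ex: "\<exists>u. orthonormal 0 u" by blast
  define k where "k = (GREATEST k. \<exists>u. orthonormal k u)"
  have bound: "\<forall>k. (\<exists>u. orthonormal k u) \<longrightarrow> k \<le> n" using orthonormal_le by blast
  have k_le: "k' \<le> k" if "\<exists>u. orthonormal k' u" for k'
    unfolding k_def using that bound by (intro Greatest_le_nat[of "\<lambda>k. \<exists>u. orthonormal k u" _ n]) auto
  have "\<exists>u. orthonormal k u"
    unfolding k_def using ex bound by (intro GreatestI_nat[of "\<lambda>k. \<exists>u. orthonormal k u" 0 n]) auto
  then obtain u where u: "orthonormal k u" by blast
  have max: "\<nexists>u'. orthonormal (Suc k) u'" using k_le[of "Suc k"] by auto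
  obtain N where N: "N > 0" "\<And>v j. v \<in> vecs \<Longrightarrow> j < n \<Longrightarrow> v j \<in> fixed_field N"
    using vecs_fixed_field by blast
  let ?E = "fixed_field N"
  have uE: "u i j \<in> ?E" if "i < k" "j < n" for i j
    using u that N(2) by (auto simp: orthonormal_def)
  have uc: "u i j \<in> carrier L" if "i < k" "j < n" for i j
    using uE[OF that] fixed_field_closed(1) by blast
  define F where "F = (\<lambda>y. \<lambda>i\<in>{..<k}. \<Oplus>j\<in>{..<n}. u i j \<otimes> y j)"
  have "inj_on F ({..<n} \<rightarrow>\<^sub>E ?E)"
  proof (rule inj_onI)
    fix y y' assume y: "y \<in> {..<n} \<rightarrow>\<^sub>E ?E" "y' \<in> {..<n} \<rightarrow>\<^sub>E ?E" and eq: "F y = F y'"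
    have yc: "y i \<in> carrier L" "y' i \<in> carrier L" if "i < n" for i
      using y that fixed_field_closed(1) by (auto simp: PiE_iff)
    have u0: "(\<Oplus>j\<in>{..<n}. u i j \<otimes> (y j \<ominus> y' j)) = \<zero>" if "i < k" for i
    proof -
      have "(\<Oplus>j\<in>{..<n}. u i j \<otimes> (y j \<ominus> y' j)) \<oplus> (\<Oplus>j\<in>{..<n}. u i j \<otimes> y' j)
          = (\<Oplus>j\<in>{..<n}. u i j \<otimes> (y j \<ominus> y' j) \<oplus> u i j \<otimes> y' j)"
        by (rule finsum_addf[symmetric]) (use uc yc that in auto)
      also have "\<dots> = (\<Oplus>j\<in>{..<n}. u i j \<otimes> y j)"
      proof (rule finsum_cong', goal_cases)
        case (3 j)
        then have "u i j \<in> carrier L" "y j \<in> carrier L" "y' j \<in> carrier L" using uc yc that by auto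
        then show ?case by algebra
      qed (use uc yc that in auto)
      also have "\<dots> = (\<Oplus>j\<in>{..<n}. u i j \<otimes> y' j)"
        using fun_cong[OF eq, of i] that by (simp add: F_def)
      finally have "(\<Oplus>j\<in>{..<n}. u i j \<otimes> (y j \<ominus> y' j)) \<oplus> (\<Oplus>j\<in>{..<n}. u i j \<otimes> y' j)
          = (\<Oplus>j\<in>{..<n}. u i j \<otimes> y' j)" .
      moreover have "(\<Oplus>j\<in>{..<n}. u i j \<otimes> (y j \<ominus> y' j)) \<in> carrier L"
        "(\<Oplus>j\<in>{..<n}. u i j \<otimes> y' j) \<in> carrier L"
        using uc yc that by (auto intro!: finsum_closed)
      ultimately show ?thesis by (metis add.r_cancel_one)
    qed
    have "y j \<ominus> y' j = \<zero>" if "j < n" for j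
    proof (rule sum_vecs_nondegenerate[OF _ _ that])
      fix w assume w: "w \<in> vecs"
      have fc: "form w (u i) \<in> carrier L" if "i < k" for i
        using that uc w vecs_carrier by (intro form_carrier) auto
      have "(\<Oplus>j\<in>{..<n}. w j \<otimes> (y j \<ominus> y' j))
          = (\<Oplus>j\<in>{..<n}. \<Oplus>i\<in>{..<k}. form w (u i) \<otimes> (u i j \<otimes> (y j \<ominus> y' j)))"
      proof (rule finsum_cong', goal_cases)
        case (3 j)
        have "w j \<otimes> (y j \<ominus> y' j) = (\<Oplus>i\<in>{..<k}. form w (u i) \<otimes> u i j) \<otimes> (y j \<ominus> y' j)"
          using orthonormal_maximal_expansion[OF u max w, of j] 3 by simp
        also have "\<dots> = (\<Oplus>i\<in>{..<k}. form w (u i) \<otimes> u i j \<otimes> (y j \<ominus> y' j))"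
          by (rule finsum_ldistr) (use 3 uc yc fc in auto)
        also have "\<dots> = (\<Oplus>i\<in>{..<k}. form w (u i) \<otimes> (u i j \<otimes> (y j \<ominus> y' j)))"
          by (rule finsum_cong') (use 3 uc yc fc in \<open>auto simp: m_assoc\<close>)
        finally show ?case .
      qed (use uc yc fc in \<open>auto intro!: finsum_closed\<close>)
      also have "\<dots> = (\<Oplus>i\<in>{..<k}. \<Oplus>j\<in>{..<n}. form w (u i) \<otimes> (u i j \<otimes> (y j \<ominus> y' j)))"
        by (rule finsum_finsum_swap) (use uc yc fc in auto)
      also have "\<dots> = \<zero>"
      proof (rule add.finprod_one_eqI)
        fix i assume i: "i \<in> {..<k}"
        have "(\<Oplus>j\<in>{..<n}. form w (u i) \<otimes> (u i j \<otimes> (y j \<ominus> y' j)))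
            = form w (u i) \<otimes> (\<Oplus>j\<in>{..<n}. u i j \<otimes> (y j \<ominus> y' j))"
          by (rule finsum_rdistr[symmetric]) (use i uc yc fc in auto)
        then show "(\<Oplus>j\<in>{..<n}. form w (u i) \<otimes> (u i j \<otimes> (y j \<ominus> y' j))) = \<zero>"
          using i u0 fc by simp
      qed
      finally show "(\<Oplus>j\<in>{..<n}. w j \<otimes> (y j \<ominus> y' j)) = \<zero>" .
    qed (use yc in auto)
    then have "y j = y' j" if "j < n" for j using that yc by simp
    then show "y = y'" using y by (intro PiE_ext) auto
  qed
  moreover have "F ` ({..<n} \<rightarrow>\<^sub>E ?E) \<subseteq> {..<k} \<rightarrow>\<^sub>E ?E"
    using uE by (auto simp: F_def PiE_iff intro!: fixed_field_closed(8,3))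
  moreover have "finite ({..<k} \<rightarrow>\<^sub>E ?E)"
    using finite_fixed_field[OF N(1)] by (intro finite_PiE) auto
  ultimately have "card ({..<n} \<rightarrow>\<^sub>E ?E) \<le> card ({..<k} \<rightarrow>\<^sub>E ?E)"
    by (rule card_inj_on_le)
  then have "(q ^ N) ^ n \<le> (q ^ N) ^ k"
    by (simp add: card_PiE card_fixed_field[OF N(1)])
  moreover have "q ^ N > 1" using q_ge_2 N by (intro one_less_power) auto
  ultimately have "n \<le> k" using power_le_imp_le_exp by blast
  then show ?thesis using u orthonormal_le[OF u] by auto
qed

end

section \<open>Frames and conjugates of torus elements\<close>

lemma (in monoid) Units_cancel:
  assumes "u \<in> Units G" "x \<in> carrier G"
  shows "u \<otimes> (inv u \<otimes> x) = x" "inv u \<otimes> (u \<otimes> x) = x"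
  using assms by (simp_all add: Units_closed flip: m_assoc)

lemma (in monoid) conj_nat_pow:
  assumes "u \<in> Units G" "x \<in> carrier G"
  shows "(u \<otimes> x \<otimes> inv u) [^] (k::nat) = u \<otimes> x [^] k \<otimes> inv u"
  using assms by (induction k) (simp_all add: m_assoc Units_closed Units_cancel)

context matrix_space
begin

text \<open>Lang's equation: with F(g) the inverse of \<open>adj g\<close>, it says that the inverse
  of g times F(g) is \<open>perm_mat s\<close>.\<close>

definition frame :: "(nat \<Rightarrow> nat) \<Rightarrow> 'a mat \<Rightarrow> bool" where
  "frame s g \<longleftrightarrow> g \<in> Units Mat \<and> g \<star> perm_mat s \<star> adj g = \<one>\<^bsub>Mat\<^esub>"

text \<open>
  The condition says that \<open>diag d\<close> is fixed by the Frobenius map of the unitary group twisted by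
  \<open>s\<close>.
\<close>

definition torus :: "(nat \<Rightarrow> nat) \<Rightarrow> (nat \<Rightarrow> 'a) set" where
  "torus s = {d \<in> {..<n} \<rightarrow>\<^sub>E carrier L. \<forall>j<n. d (s j) \<otimes> d j [^] q = \<one>}"

definition monomial_mat :: "(nat \<Rightarrow> nat) \<Rightarrow> (nat \<Rightarrow> 'a) \<Rightarrow> 'a mat" where
  "monomial_mat p t = mat n n (\<lambda>(i, j). if j = p i then t i else \<zero>)"

lemma torus_carrier: "d \<in> torus s \<Longrightarrow> i < n \<Longrightarrow> d i \<in> carrier L"
  by (auto simp: torus_def)

lemma torus_nonzero:
  assumes "s permutes {..<n}" "d \<in> torus s" "i < n"
  shows "d i \<noteq> \<zero>"
proof
  assume "d i = \<zero>"
  then have "d (s i) \<otimes> \<zero> [^] q = \<one>" using assms by (auto simp: torus_def)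
  moreover have "\<zero> [^] q = \<zero>" using q_ge_2 by (simp add: nat_pow_zero)
  moreover have "d (s i) \<in> carrier L"
    using permutes_in_image[OF assms(1), of i] assms torus_carrier by auto
  ultimately show False by simp
qed

lemma frame_closed: "frame s g \<Longrightarrow> g \<in> Units Mat" "frame s g \<Longrightarrow> g \<in> carrier Mat"
  by (auto simp: frame_def)

lemma adj_inv:
  assumes "g \<in> Units Mat"
  shows "adj g \<star> adj (inv\<^bsub>Mat\<^esub> g) = \<one>\<^bsub>Mat\<^esub>" "adj (inv\<^bsub>Mat\<^esub> g) \<star> adj g = \<one>\<^bsub>Mat\<^esub>"
  using assms by (simp_all flip: adj_mult add: adj_one Units_Mat_closed)

lemma frame_inv:
  assumes "frame s g"
  shows "inv\<^bsub>Mat\<^esub> g \<star> adj (inv\<^bsub>Mat\<^esub> g) = perm_mat s"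
proof -
  note g = frame_closed[OF assms]
  have c: "inv\<^bsub>Mat\<^esub> g \<in> carrier Mat" "adj g \<in> carrier Mat" "adj (inv\<^bsub>Mat\<^esub> g) \<in> carrier Mat"
    using g adj_closed by auto
  have "inv\<^bsub>Mat\<^esub> g \<star> adj (inv\<^bsub>Mat\<^esub> g)
      = inv\<^bsub>Mat\<^esub> g \<star> (g \<star> perm_mat s \<star> adj g) \<star> adj (inv\<^bsub>Mat\<^esub> g)"
    using assms c by (simp add: frame_def)
  also have "\<dots> = perm_mat s"
    using c g perm_mat_closed adj_inv(1)[OF g(1)] by (simp add: Mat.m_assoc Mat.Units_cancel)
  finally show ?thesis .
qed

text \<open>In the product of y and \<open>adj y\<close> the factors between B and
  \<open>adj B\<close> collapse to \<open>perm_mat s\<close> by \<open>frame_inv\<close>, and the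
  outer factors g and \<open>adj g\<close> are units that can be cancelled. In the frame, the
  standard form becomes the one with matrix \<open>perm_mat s\<close>.\<close>

lemma conj_unitary_iff:
  assumes f: "frame s g" and B: "B \<in> carrier Mat"
  defines "y \<equiv> g \<star> B \<star> inv\<^bsub>Mat\<^esub> g"
  shows "y \<star> adj y = \<one>\<^bsub>Mat\<^esub> \<longleftrightarrow> B \<star> perm_mat s \<star> adj B = perm_mat s"
proof -
  note g = frame_closed[OF f]
  have c: "inv\<^bsub>Mat\<^esub> g \<in> carrier Mat" "adj g \<in> carrier Mat" "adj (inv\<^bsub>Mat\<^esub> g) \<in> carrier Mat"
    "adj B \<in> carrier Mat" "perm_mat s \<in> carrier Mat"
    using g B adj_closed perm_mat_closed by auto
  define Z where "Z = B \<star> perm_mat s \<star> adj B"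
  have Z: "Z \<in> carrier Mat" using B c by (simp add: Z_def)
  have "y \<star> adj y = g \<star> B \<star> (inv\<^bsub>Mat\<^esub> g \<star> adj (inv\<^bsub>Mat\<^esub> g)) \<star> adj B \<star> adj g"
    using g B c by (simp add: y_def adj_mult Mat.m_assoc)
  then have yZ: "y \<star> adj y = g \<star> Z \<star> adj g"
    unfolding frame_inv[OF f] using g B c by (simp add: Z_def Mat.m_assoc)
  have "g \<star> Z \<star> adj g = \<one>\<^bsub>Mat\<^esub> \<longleftrightarrow> Z = perm_mat s"
  proof
    assume "g \<star> Z \<star> adj g = \<one>\<^bsub>Mat\<^esub>"
    then have "g \<star> Z \<star> adj g = g \<star> perm_mat s \<star> adj g"
      using f by (simp add: frame_def)
    from Mat.Units_r_cancel[OF adj_Units[OF g(1)] _ _ this]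
    have "g \<star> Z = g \<star> perm_mat s"
      using g c Z by simp
    then show "Z = perm_mat s" using Mat.Units_l_cancel[OF g(1)] c Z by simp
  qed (use f in \<open>simp add: frame_def\<close>)
  then show ?thesis unfolding yZ Z_def .
qed

lemma diag_perm_adj_iff:
  assumes s: "s permutes {..<n}" and d: "\<And>i. i < n \<Longrightarrow> d i \<in> carrier L"
  shows "diag d \<star> perm_mat s \<star> adj (diag d) = perm_mat s
    \<longleftrightarrow> (\<forall>j<n. d (s j) \<otimes> d j [^] q = \<one>)" (is "?A = _ \<longleftrightarrow> _")
proof -
  have sn: "s j < n" if "j < n" for j using permutes_in_image[OF s, of j] that by simp
  have A: "?A \<in> carrier Mat" using d by (intro Mat.m_closed diag_closed adj_closed perm_mat_closed) auto
  have entry: "?A $$ (i, j) = (if i = s j then d (s j) \<otimes> d j [^] q else \<zero>)" if "i < n" "j < n" for i j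
    using that d sn
    by (auto simp: adj_diag mult_diag_entry diag_mult_entry perm_mat_closed diag_closed perm_mat_entry)
  show ?thesis
  proof
    assume eq: "?A = perm_mat s"
    have "d (s j) \<otimes> d j [^] q = \<one>" if "j < n" for j
      using entry[of "s j" j] sn[OF that] that unfolding eq by (simp add: perm_mat_entry)
    then show "\<forall>j<n. d (s j) \<otimes> d j [^] q = \<one>" by blast
  next
    assume "\<forall>j<n. d (s j) \<otimes> d j [^] q = \<one>"
    then show "?A = perm_mat s"
      by (intro Mat_eqI[OF A perm_mat_closed]) (simp add: entry perm_mat_entry)
  qed
qed

lemma diag_mult_diag:
  assumes "\<And>i. i < n \<Longrightarrow> d i \<in> carrier L" "\<And>i. i < n \<Longrightarrow> e i \<in> carrier L"
  shows "diag d \<star> diag e = diag (\<lambda>i. d i \<otimes> e i)"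
  using assms
  by (intro Mat_eqI Mat.m_closed diag_closed) (auto simp: mult_diag_entry diag_closed diag_entry)

lemma diag_eq_one: "(\<And>i. i < n \<Longrightarrow> d i = \<one>) \<Longrightarrow> diag d = \<one>\<^bsub>Mat\<^esub>"
  unfolding diag_def Mat_one by (rule eq_matI) auto

lemma torus_conj_unitary:
  assumes "s permutes {..<n}" "frame s g" "d \<in> torus s"
  shows "g \<star> diag d \<star> inv\<^bsub>Mat\<^esub> g \<in> unitaries"
proof -
  note g = frame_closed[OF assms(2)]
  have dc: "d i \<in> carrier L" "d i \<noteq> \<zero>" if "i < n" for i
    using torus_carrier[OF assms(3) that] torus_nonzero[OF assms(1,3) that] by auto
  have inv: "inv (d i) \<in> carrier L" "d i \<otimes> inv (d i) = \<one>" "inv (d i) \<otimes> d i = \<one>" if "i < n" for i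
    using dc[OF that] by (auto simp: field_Units)
  have DI: "diag d \<in> carrier Mat" "diag (\<lambda>i. inv (d i)) \<in> carrier Mat"
    using dc(1) inv(1) by (auto intro: diag_closed)
  have "diag d \<star> diag (\<lambda>i. inv (d i)) = diag (\<lambda>i. d i \<otimes> inv (d i))"
    by (rule diag_mult_diag) (use dc(1) inv(1) in auto)
  also have "\<dots> = \<one>\<^bsub>Mat\<^esub>" by (rule diag_eq_one) (rule inv(2))
  finally have 1: "diag d \<star> diag (\<lambda>i. inv (d i)) = \<one>\<^bsub>Mat\<^esub>" .
  have "diag (\<lambda>i. inv (d i)) \<star> diag d = diag (\<lambda>i. inv (d i) \<otimes> d i)"
    by (rule diag_mult_diag) (use dc(1) inv(1) in auto)
  also have "\<dots> = \<one>\<^bsub>Mat\<^esub>" by (rule diag_eq_one) (rule inv(3))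
  finally have 2: "diag (\<lambda>i. inv (d i)) \<star> diag d = \<one>\<^bsub>Mat\<^esub>" .
  from 1 2 DI have "diag d \<in> Units Mat" unfolding Units_def by blast
  then have "g \<star> diag d \<star> inv\<^bsub>Mat\<^esub> g \<in> Units Mat" using g by auto
  moreover have "diag d \<star> perm_mat s \<star> adj (diag d) = perm_mat s"
    using diag_perm_adj_iff[OF assms(1) dc(1)] assms(3) by (simp add: torus_def)
  ultimately show ?thesis
    using conj_unitary_iff[OF assms(2) diag_closed, of d] dc by (simp add: unitaries_def)
qed

lemma unitary_mult_frame:
  assumes "h \<in> unitaries" "frame s g"
  shows "frame s (h \<star> g)"
proof -
  note g = frame_closed[OF assms(2)]
  have h: "h \<in> Units Mat" "h \<in> carrier Mat" "h \<star> adj h = \<one>\<^bsub>Mat\<^esub>"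
    using assms by (auto simp: unitaries_def)
  note c = g h perm_mat_closed adj_closed[OF g(2)] adj_closed[OF h(2)]
  have "h \<star> g \<star> perm_mat s \<star> adj (h \<star> g)
      = h \<star> (g \<star> perm_mat s \<star> adj g) \<star> adj h"
    using c by (simp add: adj_mult Mat.m_assoc)
  also have "\<dots> = \<one>\<^bsub>Mat\<^esub>" using assms(2) h adj_closed by (simp add: frame_def)
  finally show ?thesis using g h by (simp add: frame_def)
qed

text \<open>For h = g^-1 g' the two diagonalizations give D h = h D'. A nonzero entry of h forces
  equal eigenvalues, and these are distinct within D and within D', so h is monomial. As h carries
  the form of s' to that of s, its permutation intertwines s and s' and its entries satisfy the
  torus equation. With s' = s this bounds fibres; with different cycle types it proves
  disjointness.\<close>

lemma frames_same_conj_imp_monomial: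
  assumes s: "s permutes {..<n}" and s': "s' permutes {..<n}"
    and f: "frame s g" and f': "frame s' g'"
    and d: "d \<in> torus s" "inj_on d {..<n}" and d': "d' \<in> torus s'" "inj_on d' {..<n}"
    and eq: "g \<star> diag d \<star> inv\<^bsub>Mat\<^esub> g = g' \<star> diag d' \<star> inv\<^bsub>Mat\<^esub> g'"
  shows "\<exists>p t. p permutes {..<n} \<and> (\<forall>j<n. s' (p j) = p (s j)) \<and> t \<in> torus s \<and>
    inv\<^bsub>Mat\<^esub> g \<star> g' = monomial_mat p t"
proof -
  note g = frame_closed[OF f] and g' = frame_closed[OF f']
  have sn: "s j < n" if "j < n" for j using permutes_in_image[OF s, of j] that by simp
  have dc: "d i \<in> carrier L" "d' i \<in> carrier L" if "i < n" for i
    using torus_carrier d d' that by auto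
  have D: "diag d \<in> carrier Mat" "diag d' \<in> carrier Mat" using dc diag_closed by auto
  have c: "inv\<^bsub>Mat\<^esub> g \<in> carrier Mat" "adj g \<in> carrier Mat" "adj (inv\<^bsub>Mat\<^esub> g) \<in> carrier Mat"
     "inv\<^bsub>Mat\<^esub> g' \<in> carrier Mat" "adj g' \<in> carrier Mat" "perm_mat s' \<in> carrier Mat"
    using g g' adj_closed perm_mat_closed by auto
  define h where "h = inv\<^bsub>Mat\<^esub> g \<star> g'"
  have hU: "h \<in> Units Mat" and h: "h \<in> carrier Mat" using g g' by (auto simp: h_def)
  have "diag d \<star> h = inv\<^bsub>Mat\<^esub> g \<star> (g \<star> diag d \<star> inv\<^bsub>Mat\<^esub> g) \<star> g'"
    using g g' c D by (simp add: h_def Mat.m_assoc Mat.Units_cancel)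
  also have "\<dots> = h \<star> diag d'"
    unfolding eq using g g' c D by (simp add: h_def Mat.m_assoc)
  finally have comm: "diag d \<star> h = h \<star> diag d'" .
  have "h \<star> perm_mat s' \<star> adj h
      = inv\<^bsub>Mat\<^esub> g \<star> (g' \<star> perm_mat s' \<star> adj g') \<star> adj (inv\<^bsub>Mat\<^esub> g)"
    using g g' c by (simp add: h_def adj_mult Mat.m_assoc)
  also have "\<dots> = perm_mat s" using f' frame_inv[OF f] c by (simp add: frame_def)
  finally have hs: "h \<star> perm_mat s' \<star> adj h = perm_mat s" .
  have hc: "h $$ (i, k) \<in> carrier L" if "i < n" "k < n" for i k using Mat_entry[OF h] that by simp
  have eig: "d i = d' k" if "i < n" "k < n" "h $$ (i, k) \<noteq> \<zero>" for i k
  proof -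
    have "d i \<otimes> h $$ (i, k) = h $$ (i, k) \<otimes> d' k"
      using arg_cong[OF comm, of "\<lambda>A. A $$ (i, k)"] that h dc
      by (simp add: diag_mult_entry mult_diag_entry)
    then have "d i \<otimes> h $$ (i, k) = d' k \<otimes> h $$ (i, k)"
      using hc dc that by (simp add: m_comm)
    then show ?thesis using m_rcancel[of "h $$ (i, k)" "d i" "d' k"] hc dc that by simp
  qed
  have ex: "\<exists>k<n. h $$ (i, k) \<noteq> \<zero>" if i: "i < n" for i
  proof (rule ccontr)
    assume "\<not> (\<exists>k<n. h $$ (i, k) \<noteq> \<zero>)"
    then have "(\<Oplus>k\<in>{..<n}. h $$ (i, k) \<otimes> (inv\<^bsub>Mat\<^esub> h) $$ (k, i)) = \<zero>"
      using Mat_entry[OF Mat.Units_inv_closed[OF hU]] i by (intro add.finprod_one_eqI) auto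
    moreover have "(h \<star> inv\<^bsub>Mat\<^esub> h) $$ (i, i) = \<one>" using hU i by (simp add: Mat_one)
    ultimately show False using i by (simp add: Mat_mult_entry)
  qed
  define p where "p i = (if i < n then SOME k. k < n \<and> h $$ (i, k) \<noteq> \<zero> else i)" for i
  have p: "p i < n" "h $$ (i, p i) \<noteq> \<zero>" if "i < n" for i
    using someI_ex[OF ex[OF that]] that by (auto simp: p_def)
  have pu: "k = p i" if "i < n" "k < n" "h $$ (i, k) \<noteq> \<zero>" for i k
    using eig[OF that] eig[OF that(1) p[OF that(1)]] p[OF that(1)] that(2) inj_onD[OF d'(2), of k "p i"] by simp
  have "inj_on p {..<n}"
  proof (rule inj_onI)
    fix i j assume ij: "i \<in> {..<n}" "j \<in> {..<n}" "p i = p j"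
    then have "d i = d j" using eig[of i "p i"] eig[of j "p j"] p[of i] p[of j] by simp
    then show "i = j" using inj_onD[OF d(2)] ij by auto
  qed
  moreover have "p ` {..<n} \<subseteq> {..<n}" using p by auto
  ultimately have "bij_betw p {..<n} {..<n}"
    using endo_inj_surj[of "{..<n}" p] by (simp add: bij_betw_def)
  then have p_perm: "p permutes {..<n}" by (rule bij_imp_permutes) (simp add: p_def)
  define t where "t = (\<lambda>i\<in>{..<n}. h $$ (i, p i))"
  \<comment> \<open>The entry (s j, j) of the equation \<open>hs\<close>. Only the term k = p j
    survives, since row j of h vanishes elsewhere.\<close>
  have key: "h $$ (s j, s' (p j)) \<otimes> h $$ (j, p j) [^] q = \<one>" if j: "j < n" for j
  proof -
    have s'n: "s' k < n" if "k < n" for k using permutes_in_image[OF s', of k] that by simp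
    have "(\<Oplus>k\<in>{..<n}. h $$ (s j, s' k) \<otimes> h $$ (j, k) [^] q) = h $$ (s j, s' (p j)) \<otimes> h $$ (j, p j) [^] q"
    proof (rule finsum_single)
      fix k assume "k < n" "k \<noteq> p j"
      then have "h $$ (j, k) = \<zero>" using pu j by blast
      then show "h $$ (s j, s' k) \<otimes> h $$ (j, k) [^] q = \<zero>"
        using hc[OF sn[OF j] s'n[OF \<open>k < n\<close>]] q_ge_2 by (simp add: nat_pow_zero)
    qed (use j p sn s'n hc in auto)
    moreover have "(\<Oplus>k\<in>{..<n}. (h \<star> perm_mat s') $$ (s j, k) \<otimes> adj h $$ (k, j)) = \<one>"
      using arg_cong[OF hs, of "\<lambda>A. A $$ (s j, j)"] j sn
      by (simp add: Mat_mult_entry[of _ _ _ "adj h"] perm_mat_entry)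
    moreover have "(\<Oplus>k\<in>{..<n}. (h \<star> perm_mat s') $$ (s j, k) \<otimes> adj h $$ (k, j))
        = (\<Oplus>k\<in>{..<n}. h $$ (s j, s' k) \<otimes> h $$ (j, k) [^] q)"
      by (rule finsum_cong') (use j h s' sn s'n hc in \<open>auto simp: mult_perm_mat_entry adj_entry\<close>)
    ultimately show ?thesis by simp
  qed
  have inter: "s' (p j) = p (s j)" if j: "j < n" for j
  proof (rule pu)
    show "s' (p j) < n" using permutes_in_image[OF s', of "p j"] p[OF j] by simp
    show "h $$ (s j, s' (p j)) \<noteq> \<zero>" using key[OF j] hc p[OF j] j by auto
  qed (use sn j in auto)
  have "t \<in> torus s"
    using key inter sn hc p by (auto simp: torus_def t_def)
  moreover have "h = monomial_mat p t"
  proof (rule Mat_eqI[OF h])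
    show "monomial_mat p t \<in> carrier Mat"
      unfolding monomial_mat_def by (rule mat_in_Mat) (use hc p in \<open>auto simp: t_def\<close>)
    show "h $$ (i, j) = monomial_mat p t $$ (i, j)" if "i < n" "j < n" for i j
      using that pu by (auto simp: monomial_mat_def t_def)
  qed
  ultimately show ?thesis using p_perm inter unfolding h_def by blast
qed

text \<open>A root y commutes with its power, so in the frame it commutes with a diagonal matrix
  with distinct entries and is diagonal itself. Unitarity of y then becomes the torus equation for
  its diagonal.\<close>

lemma root_of_regular_conj:
  assumes s: "s permutes {..<n}" and f: "frame s g" and d: "d \<in> torus s" "inj_on d {..<n}"
    and y: "y \<in> unitaries"
    and eq: "y [^]\<^bsub>Mat\<^esub> (k::nat) = g \<star> diag d \<star> inv\<^bsub>Mat\<^esub> g"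
  shows "\<exists>e\<in>torus s. \<forall>i<n. d i = e i [^] k"
proof -
  note g = frame_closed[OF f]
  have yc: "y \<in> carrier Mat" "y \<star> adj y = \<one>\<^bsub>Mat\<^esub>" using y by (auto simp: unitaries_def)
  have dc: "d i \<in> carrier L" if "i < n" for i using torus_carrier d that by auto
  have D: "diag d \<in> carrier Mat" using dc diag_closed by auto
  have gi: "inv\<^bsub>Mat\<^esub> g \<in> Units Mat" "inv\<^bsub>Mat\<^esub> g \<in> carrier Mat" "inv\<^bsub>Mat\<^esub> (inv\<^bsub>Mat\<^esub> g) = g" using g by auto
  define E where "E = inv\<^bsub>Mat\<^esub> g \<star> y \<star> g"
  have E: "E \<in> carrier Mat" using g yc by (simp add: E_def)
  have yE: "y = g \<star> E \<star> inv\<^bsub>Mat\<^esub> g"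
    using g gi yc by (simp add: E_def Mat.m_assoc Mat.Units_cancel)
  have Ek: "E [^]\<^bsub>Mat\<^esub> k = diag d"
    using Mat.conj_nat_pow[OF gi(1) yc(1), of k] g gi D eq
    by (simp add: E_def Mat.m_assoc Mat.Units_cancel)
  have comm: "E \<star> diag d = diag d \<star> E"
    unfolding Ek[symmetric] using E by (simp flip: Mat.nat_pow_Suc2)
  have Ec: "E $$ (i, j) \<in> carrier L" if "i < n" "j < n" for i j using Mat_entry[OF E] that by simp
  have E0: "E $$ (i, j) = \<zero>" if ij: "i < n" "j < n" "i \<noteq> j" for i j
  proof (rule ccontr)
    assume nz: "E $$ (i, j) \<noteq> \<zero>"
    have "d j \<otimes> E $$ (i, j) = d i \<otimes> E $$ (i, j)"
      using arg_cong[OF comm, of "\<lambda>A. A $$ (i, j)"] ij E dc Ec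
      by (simp add: diag_mult_entry mult_diag_entry m_comm)
    then have "d j = d i" using m_rcancel[of "E $$ (i, j)" "d j" "d i"] nz dc Ec ij by simp
    then show False using inj_onD[OF d(2)] ij by auto
  qed
  define e where "e = (\<lambda>i\<in>{..<n}. E $$ (i, i))"
  have ec: "e i \<in> carrier L" if "i < n" for i using Ec that by (simp add: e_def)
  have Ee: "E = diag e"
    by (rule Mat_eqI[OF E diag_closed]) (use ec E0 in \<open>auto simp: diag_entry e_def\<close>)
  have DE: "diag d = diag (\<lambda>i. e i [^] k)" using Ek diag_pow[of e k] ec unfolding Ee by simp
  have de: "d i = e i [^] k" if "i < n" for i
    using arg_cong[OF DE, of "\<lambda>A. A $$ (i, i)"] that by (simp add: diag_entry)
  have "E \<star> perm_mat s \<star> adj E = perm_mat s"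
    using conj_unitary_iff[OF f E] yc(2) unfolding yE[symmetric] by simp
  then have "\<forall>j<n. e (s j) \<otimes> e j [^] q = \<one>"
    using diag_perm_adj_iff[OF s, of e] ec unfolding Ee by simp
  then have "e \<in> torus s" using ec by (auto simp: torus_def e_def)
  then show ?thesis using de by blast
qed

definition conj_set :: "'a mat \<Rightarrow> (nat \<Rightarrow> 'a) set \<Rightarrow> 'a mat set" where
  "conj_set g S = (\<lambda>(h, d). (h \<star> g) \<star> diag d \<star> inv\<^bsub>Mat\<^esub> (h \<star> g)) ` (unitaries \<times> S)"

definition centralizer :: "(nat \<Rightarrow> nat) \<Rightarrow> (nat \<Rightarrow> nat) set" where
  "centralizer s = {p. p permutes {..<n} \<and> (\<forall>j<n. s (p j) = p (s j))}"

lemma finite_centralizer: "finite (centralizer s)"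
  by (rule finite_subset[of _ "{p. p permutes {..<n}}"]) (auto simp: centralizer_def finite_permutations)

text \<open>Fix one pair (h0, d0) over x and put a = h0 g. Any pair (h, d) over x yields a monomial
  matrix a^-1 h g with data in the centralizer and the torus. This matrix determines h, and h
  together with x determines d, which bounds the fibre.\<close>

lemma card_conj_set:
  assumes s: "s permutes {..<n}" and f: "frame s g" and fin: "finite (torus s)"
    and S: "S \<subseteq> torus s" "\<And>d. d \<in> S \<Longrightarrow> inj_on d {..<n}"
  shows "card unitaries * card S \<le> card (centralizer s) * card (torus s) * card (conj_set g S)"
proof -
  define F where "F = (\<lambda>(h, d). (h \<star> g) \<star> diag d \<star> inv\<^bsub>Mat\<^esub> (h \<star> g))"
  have "card (unitaries \<times> S) \<le> (card (centralizer s) * card (torus s)) * card (F ` (unitaries \<times> S))"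
  proof (rule card_le_fibre_card_mult)
    show "finite (unitaries \<times> S)" using finite_unitaries finite_subset[OF S(1) fin] by simp
    fix x assume "x \<in> F ` (unitaries \<times> S)"
    then obtain h0 d0 where h0: "h0 \<in> unitaries" "d0 \<in> S" and x0: "F (h0, d0) = x" by auto
    define a where "a = h0 \<star> g"
    have fa: "frame s a" using unitary_mult_frame[OF h0(1) f] by (simp add: a_def)
    note a = frame_closed[OF fa]
    note g = frame_closed[OF f]
    define P where "P = (\<lambda>(h, d :: nat \<Rightarrow> 'a). SOME pt. pt \<in> centralizer s \<times> torus s \<and>
      inv\<^bsub>Mat\<^esub> a \<star> (h \<star> g) = monomial_mat (fst pt) (snd pt))"
    have P: "P (h, d) \<in> centralizer s \<times> torus s"
      "inv\<^bsub>Mat\<^esub> a \<star> (h \<star> g) = monomial_mat (fst (P (h, d))) (snd (P (h, d)))"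
      if "h \<in> unitaries" "d \<in> S" "F (h, d) = x" for h d
    proof -
      have "\<exists>p t. p permutes {..<n} \<and> (\<forall>j<n. s (p j) = p (s j)) \<and> t \<in> torus s \<and>
         inv\<^bsub>Mat\<^esub> a \<star> (h \<star> g) = monomial_mat p t"
        by (rule frames_same_conj_imp_monomial[OF s s fa unitary_mult_frame[OF that(1) f], of d0 d])
          (use that x0 h0 S in \<open>auto simp: F_def a_def\<close>)
      then have "\<exists>pt. pt \<in> centralizer s \<times> torus s \<and>
         inv\<^bsub>Mat\<^esub> a \<star> (h \<star> g) = monomial_mat (fst pt) (snd pt)"
        by (auto simp: centralizer_def)
      from someI_ex[OF this] show "P (h, d) \<in> centralizer s \<times> torus s"
        "inv\<^bsub>Mat\<^esub> a \<star> (h \<star> g) = monomial_mat (fst (P (h, d))) (snd (P (h, d)))"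
        by (simp_all add: P_def)
    qed
    have "card {hd \<in> unitaries \<times> S. F hd = x} \<le> card (centralizer s \<times> torus s)"
    proof (rule card_inj_on_le)
      show "inj_on P {hd \<in> unitaries \<times> S. F hd = x}"
      proof (rule inj_onI)
        fix z z' assume z: "z \<in> {hd \<in> unitaries \<times> S. F hd = x}" "z' \<in> {hd \<in> unitaries \<times> S. F hd = x}"
          "P z = P z'"
        obtain h d h' d' where zz: "z = (h, d)" "z' = (h', d')" by (metis surj_pair)
        have hd: "h \<in> unitaries" "d \<in> S" "F (h, d) = x" and hd': "h' \<in> unitaries" "d' \<in> S" "F (h', d') = x"
          and PP: "P (h, d) = P (h', d')"
          using z unfolding zz by auto
        have hc: "h \<in> carrier Mat" "h' \<in> carrier Mat" "h \<in> Units Mat" using hd hd' by (auto simp: unitaries_def)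
        have "inv\<^bsub>Mat\<^esub> a \<star> (h \<star> g) = inv\<^bsub>Mat\<^esub> a \<star> (h' \<star> g)"
          using P(2)[OF hd] P(2)[OF hd'] PP by simp
        then have "h \<star> g = h' \<star> g"
          using Mat.Units_l_cancel[of "inv\<^bsub>Mat\<^esub> a"] a hc g by simp
        from Mat.Units_r_cancel[OF g(1) _ _ this] have hh: "h = h'" using hc by simp
        have dc: "d i \<in> carrier L" "d' i \<in> carrier L" if "i < n" for i
          using S hd hd' torus_carrier that by auto
        have D: "diag d \<in> carrier Mat" "diag d' \<in> carrier Mat" using dc diag_closed by auto
        define b where "b = h \<star> g"
        have b: "b \<in> Units Mat" "b \<in> carrier Mat" using hc g by (auto simp: b_def)
        have "b \<star> diag d \<star> inv\<^bsub>Mat\<^esub> b = b \<star> diag d' \<star> inv\<^bsub>Mat\<^esub> b"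
          using hd hd' by (simp add: F_def b_def hh)
        from Mat.Units_r_cancel[OF _ _ _ this]
        have "b \<star> diag d = b \<star> diag d'"
          using b D by simp
        then have DD: "diag d = diag d'" using Mat.Units_l_cancel[OF b(1)] D by simp
        have "d i = d' i" if "i < n" for i
          using arg_cong[OF DD, of "\<lambda>A. A $$ (i, i)"] that by (simp add: diag_entry)
        moreover have "d \<in> extensional {..<n}" "d' \<in> extensional {..<n}"
          using S hd hd' by (auto simp: torus_def PiE_def)
        ultimately have "d = d'" by (intro extensionalityI) auto
        then show "z = z'" using hh zz by simp
      qed
      show "P ` {hd \<in> unitaries \<times> S. F hd = x} \<subseteq> centralizer s \<times> torus s"
      proof (rule image_subsetI)
        fix z assume "z \<in> {hd \<in> unitaries \<times> S. F hd = x}"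
        then obtain h d where "z = (h, d)" "h \<in> unitaries" "d \<in> S" "F (h, d) = x" by (cases z) auto
        then show "P z \<in> centralizer s \<times> torus s" using P(1)[of h d] by (simp only:)
      qed
    qed (use fin finite_centralizer in auto)
    then show "card {hd \<in> unitaries \<times> S. F hd = x} \<le> card (centralizer s) * card (torus s)" by (simp only: card_cartesian_product)
  qed
  then show ?thesis by (simp add: conj_set_def F_def card_cartesian_product)
qed

end

context twisted_space
begin

text \<open>The rows of g are n orthonormal vectors. This yields only a right inverse, which is
  two-sided because the entries of g lie in a finite field.\<close>

lemma ex_frame: "\<exists>g. frame s g"
proof -
  obtain u where u: "orthonormal n u" using ex_orthonormal by blast
  obtain N where N: "N > 0" "\<And>v j. v \<in> vecs \<Longrightarrow> j < n \<Longrightarrow> v j \<in> fixed_field N"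
    using vecs_fixed_field by blast
  have uE: "u i j \<in> fixed_field N" if "i < n" "j < n" for i j
    using u that N(2) by (auto simp: orthonormal_def)
  have uc: "u i j \<in> carrier L" if "i < n" "j < n" for i j
    using uE[OF that] fixed_field_closed(1) by blast
  define g where "g = mat n n (\<lambda>(i, j). u i j)"
  have g: "g \<in> carrier Mat" unfolding g_def by (rule mat_in_Mat) (use uc in auto)
  have ge: "g $$ (i, j) = u i j" if "i < n" "j < n" for i j using that by (simp add: g_def)
  have eq: "g \<star> perm_mat s \<star> adj g = \<one>\<^bsub>Mat\<^esub>"
  proof (rule Mat_eqI)
    fix i j assume ij: "i < n" "j < n"
    have "(g \<star> perm_mat s \<star> adj g) $$ (i, j) = form (u i) (u j)"
      unfolding form_def Mat_mult_entry[OF ij]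
      by (rule finsum_cong') (use ij g ge uc s_permutes in \<open>auto simp: mult_perm_mat_entry adj_entry\<close>)
    then show "(g \<star> perm_mat s \<star> adj g) $$ (i, j) = \<one>\<^bsub>Mat\<^esub> $$ (i, j)"
      using u ij by (simp add: orthonormal_def Mat_one)
  qed (use g perm_mat_closed adj_closed in auto)
  moreover have "g \<in> Units Mat"
    by (rule right_inverse_imp_Unit[of g N "perm_mat s \<star> adj g"])
      (use g ge uE N eq perm_mat_closed adj_closed in \<open>auto simp: Mat.m_assoc\<close>)
  ultimately show ?thesis by (auto simp: frame_def)
qed

end

section \<open>Permutations with prescribed cycle lengths\<close>

lemma count_mset_eq_card_nth: "count (mset l) i = card {b \<in> {..<length l}. l ! b = i}"
proof -
  have "count (mset l) i = length (filter ((=) i) l)"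
    by (simp add: count_mset count_list_eq_length_filter)
  also have "\<dots> = card {b \<in> {..<length l}. l ! b = i}"
    unfolding length_filter_conv_card by (rule arg_cong[of _ _ card]) auto
  finally show ?thesis .
qed

lemma prod_nth_eq_prod_count:
  fixes f :: "nat \<Rightarrow> 'b::comm_monoid_mult"
  shows "(\<Prod>b<length l. f (l ! b)) = (\<Prod>i\<in>set_mset (mset l). f i ^ count (mset l) i)"
proof -
  have "(\<Prod>b<length l. f (l ! b))
      = (\<Prod>i\<in>(!) l ` {..<length l}. \<Prod>b\<in>{b \<in> {..<length l}. l ! b = i}. f (l ! b))"
    by (rule prod.image_gen) simp
  also have "(!) l ` {..<length l} = set_mset (mset l)"
    by (auto simp: in_set_conv_nth)
  also have "(\<Prod>i\<in>set_mset (mset l). \<Prod>b\<in>{b \<in> {..<length l}. l ! b = i}. f (l ! b))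
      = (\<Prod>i\<in>set_mset (mset l). f i ^ count (mset l) i)"
  proof (rule prod.cong)
    fix i
    show "(\<Prod>b\<in>{b \<in> {..<length l}. l ! b = i}. f (l ! b)) = f i ^ count (mset l) i"
      by (simp add: count_mset_eq_card_nth)
  qed simp
  finally show ?thesis .
qed

text \<open>Restriction to the classes of positions with equal entries loses nothing, and a class of
  size m has m! permutations.\<close>

lemma card_colour_preserving_permutations_le:
  fixes l :: "nat list"
  shows "card {p. p permutes {..<length l} \<and> (\<forall>b<length l. l ! p b = l ! b)}
    \<le> (\<Prod>i\<in>set_mset (mset l). fact (count (mset l) i))" (is "card ?P \<le> _")
proof -
  let ?C = "\<lambda>i. {b \<in> {..<length l}. l ! b = i}"
  define F where "F p = (\<lambda>i\<in>set_mset (mset l). \<lambda>b. if b \<in> ?C i then p b else b)" for p :: "nat \<Rightarrow> nat"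
  have "card ?P \<le> card (\<Pi>\<^sub>E i\<in>set_mset (mset l). {p. p permutes ?C i})"
  proof (rule card_inj_on_le)
    show "inj_on F ?P"
    proof (rule inj_onI)
      fix p p' assume p: "p \<in> ?P" "p' \<in> ?P" "F p = F p'"
      show "p = p'"
      proof
        fix b show "p b = p' b"
        proof (cases "b < length l")
          case True
          then have "F p (l ! b) b = p b" "F p' (l ! b) b = p' b" by (auto simp: F_def)
          then show ?thesis using p by simp
        next
          case False
          then show ?thesis using p permutes_not_in[of p "{..<length l}" b] permutes_not_in[of p' "{..<length l}" b] by auto
        qed
      qed
    qed
    have "(\<lambda>b. if b \<in> ?C i then p b else b) permutes ?C i" if p: "p \<in> ?P" for p i
    proof (rule bij_imp_permutes)
      have "inj_on p (?C i)" using p permutes_inj[of p] by (auto intro: inj_on_subset)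
      moreover have "p ` ?C i \<subseteq> ?C i" using p permutes_in_image[of p "{..<length l}"] by auto
      ultimately have "bij_betw p (?C i) (?C i)" using endo_inj_surj[of "?C i" p] by (simp add: bij_betw_def)
      then show "bij_betw (\<lambda>b. if b \<in> ?C i then p b else b) (?C i) (?C i)"
        by (subst bij_betw_cong[of _ _ p]) auto
    qed auto
    then show "F ` ?P \<subseteq> (\<Pi>\<^sub>E i\<in>set_mset (mset l). {p. p permutes ?C i})"
      by (intro image_subsetI) (simp add: F_def)
    show "finite (\<Pi>\<^sub>E i\<in>set_mset (mset l). {p. p permutes ?C i})"
      by (intro finite_PiE finite_permutations) auto
  qed
  also have "\<dots> = (\<Prod>i\<in>set_mset (mset l). card {p. p permutes ?C i})"
    by (rule card_PiE) simp
  also have "\<dots> = (\<Prod>i\<in>set_mset (mset l). fact (count (mset l) i))"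
  proof (rule prod.cong)
    fix i
    show "card {p. p permutes ?C i} = fact (count (mset l) i)"
      by (intro card_permutations) (auto simp: count_mset_eq_card_nth)
  qed simp
  finally show ?thesis .
qed

text \<open>
  The points of the \<open>b\<close>-th cycle are \<open>e b 0, \<dots>, e b (l ! b - 1)\<close>, and \<open>e b\<close> is continued
  periodically.
\<close>

locale cycle_system =
  fixes n :: nat and l :: "nat list" and s :: "nat \<Rightarrow> nat" and e :: "nat \<Rightarrow> nat \<Rightarrow> nat"
  assumes length_pos: "b < length l \<Longrightarrow> l ! b > 0"
    and s_perm: "s permutes {..<n}"
    and e_less: "b < length l \<Longrightarrow> e b c < n"
    and e_surj: "j < n \<Longrightarrow> \<exists>b<length l. \<exists>c<l ! b. j = e b c"
    and e_eq_iff: "b < length l \<Longrightarrow> b' < length l \<Longrightarrow> e b c = e b' c' \<longleftrightarrow> b = b' \<and> c mod (l ! b) = c' mod (l ! b)"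
    and s_e: "b < length l \<Longrightarrow> s (e b c) = e b (Suc c)"

text \<open>Points are numbered by pairs (cycle, position), and s advances the position modulo the
  length of the cycle.\<close>

lemma ex_cycle_system:
  assumes pos: "0 \<notin> set l" and sum: "sum_list l = n"
  shows "\<exists>s e. cycle_system n l s e"
proof -
  let ?S = "SIGMA b:{..<length l}. {..<l ! b}"
  have "card ?S = n" using sum by (simp add: sum_list_sum_nth atLeast0LessThan)
  then obtain f where f: "bij_betw f ?S {..<n}"
    using finite_same_card_bij[of ?S "{..<n}"] by auto
  have lpos: "l ! b > 0" if "b < length l" for b using pos that by (metis gr0I nth_mem)
  define e where "e b c = f (b, c mod (l ! b))" for b c
  define g where "g = the_inv_into ?S f"
  have gf: "g (f x) = x" if "x \<in> ?S" for x
    using the_inv_into_f_f[of f ?S x] f that by (simp add: g_def bij_betw_def)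
  have in_S: "(b, c mod (l ! b)) \<in> ?S" if "b < length l" for b c using lpos[OF that] that by auto
  define s where "s j = (if j < n then e (fst (g j)) (Suc (snd (g j))) else j)" for j
  have e_less: "e b c < n" if "b < length l" for b c
    using bij_betwE[OF f] in_S[OF that, of c] by (auto simp: e_def)
  have e_iff: "e b c = e b' c' \<longleftrightarrow> b = b' \<and> c mod (l ! b) = c' mod (l ! b)"
    if "b < length l" "b' < length l" for b b' c c'
    unfolding e_def using gf[OF in_S[OF that(1), of c]] gf[OF in_S[OF that(2), of c']]
    by (metis prod.inject)
  have e_surj: "\<exists>b<length l. \<exists>c<l ! b. j = e b c" if "j < n" for j
  proof -
    have "j \<in> f ` ?S" using f that by (simp add: bij_betw_def)
    then obtain b c where "b < length l" "c < l ! b" "j = f (b, c)" by auto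
    moreover from this have "j = e b c" by (simp add: e_def)
    ultimately show ?thesis by blast
  qed
  have s_e: "s (e b c) = e b (Suc c)" if "b < length l" for b c
  proof -
    have "g (e b c) = (b, c mod (l ! b))" unfolding e_def by (rule gf[OF in_S[OF that]])
    then have "s (e b c) = e b (Suc (c mod (l ! b)))" using e_less[OF that] by (simp add: s_def)
    then show ?thesis by (simp add: e_def mod_Suc_eq)
  qed
  have "inj_on s {..<n}"
  proof (rule inj_onI)
    fix i j assume ij: "i \<in> {..<n}" "j \<in> {..<n}" "s i = s j"
    obtain b c where i: "b < length l" "c < l ! b" "i = e b c" using e_surj[of i] ij(1) by blast
    obtain b' c' where j: "b' < length l" "c' < l ! b'" "j = e b' c'" using e_surj[of j] ij(2) by blast
    have *: "b = b'" "Suc c mod (l ! b) = Suc c' mod (l ! b)"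
      using ij(3) i j s_e e_iff by auto
    then have "c mod (l ! b) = c' mod (l ! b)"
      using cong_add_lcancel_nat[of 1 c c' "l ! b"] by (simp add: cong_def)
    then show "i = j" using i j * by simp
  qed
  moreover have "s ` {..<n} \<subseteq> {..<n}"
  proof safe
    fix j assume "j < n"
    then obtain b c where "b < length l" "c < l ! b" "j = e b c" using e_surj by blast
    then show "s j < n" using s_e e_less by simp
  qed
  ultimately have "bij_betw s {..<n} {..<n}" using endo_inj_surj[of "{..<n}" s] by (simp add: bij_betw_def)
  then have "s permutes {..<n}" by (rule bij_imp_permutes) (simp add: s_def)
  then have "cycle_system n l s e"
    using lpos e_less e_surj e_iff s_e by unfold_locales auto
  then show ?thesis by blast
qed

text \<open>On the b-th cycle p is determined by the image of \<open>e b 0\<close>: it goes to the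
  cycle \<open>f b\<close> and rotates by \<open>g b\<close>. The lengths agree because l ! b
  divides c exactly if e b c = e b 0, a condition that p transports.\<close>

lemma intertwiner_cycles:
  assumes S: "cycle_system n l s e" and S': "cycle_system n l' s' e'"
    and p: "p permutes {..<n}" and inter: "\<And>j. j < n \<Longrightarrow> s' (p j) = p (s j)"
  obtains f g where "bij_betw f {..<length l} {..<length l'}"
    and "\<And>b. b < length l \<Longrightarrow> l' ! f b = l ! b"
    and "\<And>b. b < length l \<Longrightarrow> g b < l ! b"
    and "\<And>b c. b < length l \<Longrightarrow> p (e b c) = e' (f b) (g b + c)"
proof -
  interpret A: cycle_system n l s e by (rule S)
  interpret B: cycle_system n l' s' e' by (rule S')
  have pn: "p j < n \<longleftrightarrow> j < n" for j using permutes_in_image[OF p, of j] by simp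
  have "\<exists>b' c'. b' < length l' \<and> c' < l' ! b' \<and> p (e b 0) = e' b' c'" if "b < length l" for b
    using B.e_surj[of "p (e b 0)"] pn A.e_less[OF that] by blast
  then obtain f g where fg: "\<And>b. b < length l \<Longrightarrow> f b < length l' \<and> g b < l' ! f b \<and> p (e b 0) = e' (f b) (g b)"
    by metis
  have pe: "p (e b c) = e' (f b) (g b + c)" if b: "b < length l" for b c
  proof (induction c)
    case (Suc c)
    have "p (e b (Suc c)) = s' (p (e b c))" using inter A.s_e A.e_less b by simp
    then show ?case using Suc B.s_e fg[OF b] by simp
  qed (use fg[OF b] in simp)
  have pinj: "p i = p j \<longleftrightarrow> i = j" for i j using permutes_inj[OF p] by (auto dest: injD)
  have len: "l' ! f b = l ! b" if b: "b < length l" for b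
  proof -
    have "l ! b dvd c \<longleftrightarrow> l' ! f b dvd c" for c
    proof -
      have "l ! b dvd c \<longleftrightarrow> e b c = e b 0" using A.e_eq_iff[OF b b, of c 0] by (simp add: dvd_eq_mod_eq_0)
      also have "\<dots> \<longleftrightarrow> e' (f b) (g b + c) = e' (f b) (g b)"
        using pe[OF b, of c] pe[OF b, of 0] pinj[of "e b c" "e b 0"] by simp
      also have "\<dots> \<longleftrightarrow> [g b + c = g b + 0] (mod (l' ! f b))"
        using B.e_eq_iff[of "f b" "f b"] fg[OF b] by (simp add: cong_def)
      also have "\<dots> \<longleftrightarrow> l' ! f b dvd c"
        unfolding cong_add_lcancel_nat by (simp add: cong_0_iff)
      finally show ?thesis .
    qed
    then show ?thesis by (meson dvd_antisym dvd_refl)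
  qed
  have "bij_betw f {..<length l} {..<length l'}"
  proof (rule bij_betw_imageI)
    show "inj_on f {..<length l}"
    proof (rule inj_onI)
      fix b b' assume b: "b \<in> {..<length l}" "b' \<in> {..<length l}" "f b = f b'"
      let ?m = "l' ! f b"
      have "g b < ?m" "g b' < ?m" using fg[of b] fg[of b'] b by auto
      \<comment> \<open>A shift from position \<open>g b\<close> to position \<open>g b'\<close>
        modulo the length, written without a negative difference.\<close>
      then have "(g b + (?m - g b + g b')) mod ?m = g b' mod ?m" by simp
      then have "e' (f b) (g b + (?m - g b + g b')) = e' (f b') (g b')"
        using B.e_eq_iff[of "f b" "f b'"] fg b by auto
      then have "p (e b (?m - g b + g b')) = p (e b' 0)" using pe b by simp
      then have "e b (?m - g b + g b') = e b' 0" using pinj by blast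
      then show "b = b'" using A.e_eq_iff b by auto
    qed
    show "f ` {..<length l} = {..<length l'}"
    proof safe
      fix b' assume b': "b' < length l'"
      then have "e' b' 0 \<in> p ` {..<n}" using B.e_less permutes_image[OF p] by simp
      then obtain j where "j < n" "e' b' 0 = p j" by auto
      moreover from this obtain b c where "b < length l" "j = e b c" using A.e_surj by blast
      ultimately have "b < length l" "e' b' 0 = e' (f b) (g b + c)" using pe by auto
      then show "b' \<in> f ` {..<length l}" using B.e_eq_iff[OF b', of "f b"] fg by auto
    qed (use fg in auto)
  qed
  with len fg pe show ?thesis using that by (metis (no_types, lifting))
qed

lemma intertwiner_imp_mset_eq:
  assumes "cycle_system n l s e" "cycle_system n l' s' e'"
    and "p permutes {..<n}" "\<And>j. j < n \<Longrightarrow> s' (p j) = p (s j)"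
  shows "mset l = mset l'"
proof -
  have nth: "mset xs = image_mset ((!) xs) (mset_set {..<length xs})" for xs :: "nat list"
    by (metis lessThan_atLeast0 map_nth mset_map mset_upt)
  obtain f where f: "bij_betw f {..<length l} {..<length l'}"
    "\<And>b. b < length l \<Longrightarrow> l' ! f b = l ! b"
    by (rule intertwiner_cycles[OF assms]) auto
  have "mset l' = image_mset ((!) l') (image_mset f (mset_set {..<length l}))"
    using f(1) by (simp add: nth bij_betw_def image_mset_mset_set)
  also have "\<dots> = mset l"
    unfolding nth[of l] multiset.map_comp using f(2) by (intro image_mset_cong) auto
  finally show ?thesis by simp
qed

text \<open>A permutation commuting with s permutes the cycles of equal length and rotates each of
  them, and these data determine it: m cycles of length i admit m! permutations and i^m
  rotations.\<close>

lemma card_centralizer_le: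
  assumes S: "cycle_system n l s e"
  shows "card {p. p permutes {..<n} \<and> (\<forall>j<n. s (p j) = p (s j))}
    \<le> (\<Prod>i\<in>set_mset (mset l). fact (count (mset l) i) * i ^ count (mset l) i)" (is "card ?Z \<le> _")
proof -
  interpret cycle_system n l s e by (rule S)
  let ?P = "{p. p permutes {..<length l} \<and> (\<forall>b<length l. l ! p b = l ! b)}"
  let ?G = "\<Pi>\<^sub>E b\<in>{..<length l}. {..<l ! b}"
  have "\<exists>fg. fg \<in> ?P \<times> ?G \<and> (\<forall>b<length l. \<forall>c. p (e b c) = e (fst fg b) (snd fg b + c))" if p: "p \<in> ?Z" for p
  proof -
    obtain f g where f: "bij_betw f {..<length l} {..<length l}"
      "\<And>b. b < length l \<Longrightarrow> l ! f b = l ! b" "\<And>b. b < length l \<Longrightarrow> g b < l ! b"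
      "\<And>b c. b < length l \<Longrightarrow> p (e b c) = e (f b) (g b + c)"
      by (rule intertwiner_cycles[OF S S, of p]) (use p in auto)
    define f' where "f' b = (if b < length l then f b else b)" for b
    have "bij_betw f' {..<length l} {..<length l}"
      using f(1) by (subst bij_betw_cong[of _ _ f]) (auto simp: f'_def)
    then have "f' permutes {..<length l}" by (rule bij_imp_permutes) (simp add: f'_def)
    then show ?thesis
      using f by (intro exI[of _ "(f', restrict g {..<length l})"]) (auto simp: f'_def)
  qed
  then have "\<forall>p\<in>?Z. \<exists>fg. fg \<in> ?P \<times> ?G \<and> (\<forall>b<length l. \<forall>c. p (e b c) = e (fst fg b) (snd fg b + c))"
    by blast
  from bchoice[OF this] obtain F where "\<forall>p\<in>?Z. F p \<in> ?P \<times> ?G \<and>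
      (\<forall>b<length l. \<forall>c. p (e b c) = e (fst (F p) b) (snd (F p) b + c))"
    by (elim exE)
  then have F: "\<And>p. p \<in> ?Z \<Longrightarrow> F p \<in> ?P \<times> ?G"
    "\<And>p b c. p \<in> ?Z \<Longrightarrow> b < length l \<Longrightarrow> p (e b c) = e (fst (F p) b) (snd (F p) b + c)"
    by blast+
  have fin: "finite ?P" by (rule finite_subset[of _ "{p. p permutes {..<length l}}"]) (auto simp: finite_permutations)
  have "card ?Z \<le> card (?P \<times> ?G)"
  proof (rule card_inj_on_le)
    show "inj_on F ?Z"
    proof (rule inj_onI)
      fix p p' assume p: "p \<in> ?Z" "p' \<in> ?Z" "F p = F p'"
      show "p = p'"
      proof
        fix j show "p j = p' j"
        proof (cases "j < n")
          case True
          then obtain b c where "b < length l" "j = e b c" using e_surj by blast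
          then show ?thesis using F(2)[OF p(1)] F(2)[OF p(2)] p(3) by simp
        next
          case False
          then show ?thesis using p permutes_not_in[of p "{..<n}" j] permutes_not_in[of p' "{..<n}" j] by auto
        qed
      qed
    qed
    show "F ` ?Z \<subseteq> ?P \<times> ?G" by (rule image_subsetI) (rule F(1))
    show "finite (?P \<times> ?G)" using fin by (intro finite_cartesian_product finite_PiE) auto
  qed
  also have "\<dots> = card ?P * (\<Prod>b<length l. l ! b)" by (simp add: card_cartesian_product card_PiE)
  also have "\<dots> \<le> (\<Prod>i\<in>set_mset (mset l). fact (count (mset l) i)) * (\<Prod>b<length l. l ! b)"
    by (intro mult_right_mono card_colour_preserving_permutations_le) simp
  finally show ?thesis
    using prod_nth_eq_prod_count[of "\<lambda>i. i" l] by (simp add: prod.distrib)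
qed

text \<open>The proportion of permutations of cycle type \<mu> in the symmetric group, that is, the
  reciprocal of the order of the centralizer of such a permutation.\<close>

definition partition_weight :: "nat multiset \<Rightarrow> real" where
  "partition_weight \<mu> = (\<Prod>i\<in>set_mset \<mu>. 1 / (fact (count \<mu> i) * real i ^ count \<mu> i))"

lemma finite_partitions_of: "finite (partitions_of n)"
proof (rule finite_subset)
  show "partitions_of n \<subseteq> mset ` {xs. set xs \<subseteq> {..n} \<and> length xs \<le> n}"
  proof
    fix \<mu> assume mu: "\<mu> \<in> partitions_of n"
    obtain xs where xs: "mset xs = \<mu>" using ex_mset by blast
    have 0: "0 \<notin> set xs" "sum_list xs = n"
      using mu by (auto simp: partitions_of_def simp flip: xs sum_mset_sum_list)
    have "x \<le> n" if "x \<in> set xs" for x using member_le_sum_list[OF that] 0 by simp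
    moreover have "length xs \<le> sum_list xs" using 0(1)
      by (induction xs) (auto simp: Suc_le_eq intro: add_pos_nonneg)
    ultimately show "\<mu> \<in> mset ` {xs. set xs \<subseteq> {..n} \<and> length xs \<le> n}" using xs 0 by auto
  qed
qed (intro finite_imageI finite_lists_length_le finite_atMost)

lemma partition_weight_superset:
  assumes "finite S" "set_mset \<mu> \<subseteq> S"
  shows "partition_weight \<mu> = (\<Prod>i\<in>S. 1 / (fact (count \<mu> i) * real i ^ count \<mu> i))"
  unfolding partition_weight_def
  by (rule prod.mono_neutral_left) (use assms in \<open>auto simp: not_in_iff\<close>)

lemma partition_weight_add_mset:
  assumes "i > 0"
  shows "real (i * count (add_mset i \<mu>) i) * partition_weight (add_mset i \<mu>) = partition_weight \<mu>"
proof -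
  let ?S = "insert i (set_mset \<mu>)"
  let ?w = "\<lambda>\<mu> j. 1 / (fact (count \<mu> j) * real j ^ count \<mu> j) :: real"
  have 1: "partition_weight \<nu> = ?w \<nu> i * (\<Prod>j\<in>?S - {i}. ?w \<nu> j)" if "set_mset \<nu> \<subseteq> ?S" for \<nu>
    using partition_weight_superset[of ?S \<nu>] that by (subst (asm) prod.remove[of _ i]) auto
  have 2: "(\<Prod>j\<in>?S - {i}. ?w (add_mset i \<mu>) j) = (\<Prod>j\<in>?S - {i}. ?w \<mu> j)"
    by (rule prod.cong) auto
  have 3: "real (i * Suc k) * (1 / (fact (Suc k) * real i ^ Suc k)) = 1 / (fact k * real i ^ k)" for k
  proof -
    have "fact (Suc k) * real i ^ Suc k = real (i * Suc k) * (fact k * real i ^ k)" by (simp add: algebra_simps)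
    moreover have "a * (1 / (a * b)) = 1 / b" if "a \<noteq> 0" for a b :: real using that by simp
    moreover have "real (i * Suc k) \<noteq> 0" using assms by (simp only: of_nat_eq_0_iff) simp
    ultimately show ?thesis by metis
  qed
  have 4: "real (i * count (add_mset i \<mu>) i) * ?w (add_mset i \<mu>) i = ?w \<mu> i"
    using 3[of "count \<mu> i"] by (simp only: count_add_mset simp_thms if_True)
  have A: "partition_weight (add_mset i \<mu>) = ?w (add_mset i \<mu>) i * (\<Prod>j\<in>?S - {i}. ?w \<mu> j)"
    using 1[of "add_mset i \<mu>"] unfolding 2 by simp
  have B: "partition_weight \<mu> = ?w \<mu> i * (\<Prod>j\<in>?S - {i}. ?w \<mu> j)"
    by (rule 1) auto
  show ?thesis unfolding A B mult.assoc[symmetric] 4 ..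
qed

lemma sum_mset_eq_sum_count: "sum_mset \<mu> = (\<Sum>i\<in>set_mset \<mu>. i * count \<mu> i)" for \<mu> :: "nat multiset"
proof (induction \<mu>)
  case (add x \<mu>)
  let ?S = "insert x (set_mset \<mu>)"
  have "(\<Sum>i\<in>?S. i * count (add_mset x \<mu>) i) = (\<Sum>i\<in>?S. i * count \<mu> i) + (\<Sum>i\<in>?S. if i = x then x else 0)"
    unfolding sum.distrib[symmetric] by (rule sum.cong) auto
  also have "(\<Sum>i\<in>?S. if i = x then x else 0) = x" by simp
  also have "(\<Sum>i\<in>?S. i * count \<mu> i) = (\<Sum>i\<in>set_mset \<mu>. i * count \<mu> i)"
    by (rule sum.mono_neutral_right) (auto simp: not_in_iff)
  finally show ?case using add by simp
qed simp

text \<open>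
  Removing one part gives \<open>n h\<^sub>n = h\<^sub>0 + \<dots> + h\<^sub>n\<^sub>-\<^sub>1\<close> for the sum \<open>h\<^sub>n\<close> of the weights.
\<close>

lemma sum_partition_weight: "(\<Sum>\<mu>\<in>partitions_of n. partition_weight \<mu>) = 1"
proof (induction n rule: less_induct)
  case (less n)
  show ?case
  proof (cases "n = 0")
    case True
    have "partitions_of 0 = {{#}}"
    proof safe
      fix \<mu> assume "\<mu> \<in> partitions_of 0"
      then show "\<mu> = {#}" by (cases \<mu>) (auto simp: partitions_of_def)
    qed (auto simp: partitions_of_def)
    then show ?thesis using True by (simp add: partition_weight_def)
  next
    case False
    let ?A = "SIGMA \<mu>:partitions_of n. set_mset \<mu>" and ?B = "SIGMA i:{1..n}. partitions_of (n - i)"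
    have "real n * (\<Sum>\<mu>\<in>partitions_of n. partition_weight \<mu>)
        = (\<Sum>\<mu>\<in>partitions_of n. \<Sum>i\<in>set_mset \<mu>. real (i * count \<mu> i) * partition_weight \<mu>)"
      unfolding sum_distrib_left
    proof (rule sum.cong)
      fix \<mu> assume "\<mu> \<in> partitions_of n"
      then have "n = (\<Sum>i\<in>set_mset \<mu>. i * count \<mu> i)"
        by (simp add: partitions_of_def sum_mset_eq_sum_count)
      then show "real n * partition_weight \<mu> = (\<Sum>i\<in>set_mset \<mu>. real (i * count \<mu> i) * partition_weight \<mu>)"
        by (metis of_nat_sum sum_distrib_right)
    qed simp
    also have "\<dots> = (\<Sum>(\<mu>, i)\<in>?A. real (i * count \<mu> i) * partition_weight \<mu>)"
      by (rule sum.Sigma) (auto simp: finite_partitions_of)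
    \<comment> \<open>One part i is removed from \<mu>; by \<open>partition_weight_add_mset\<close>
      the factor i * m_i is exactly the ratio of the two weights.\<close>
    also have "\<dots> = (\<Sum>(i, \<nu>)\<in>?B. partition_weight \<nu>)"
    proof (rule sum.reindex_bij_witness[of _ "\<lambda>(i, \<nu>). (add_mset i \<nu>, i)" "\<lambda>(\<mu>, i). (i, \<mu> - {#i#})"], goal_cases)
      case (1 a)
      then show ?case by auto
    next
      case (2 a)
      then obtain \<mu> i where a: "a = (\<mu>, i)" "\<mu> \<in> partitions_of n" "i \<in># \<mu>" by auto
      then obtain \<nu> where nu: "\<mu> = add_mset i \<nu>" by (meson mset_add)
      then have "i > 0" "0 \<notin># \<nu>" "i + sum_mset \<nu> = n" using a by (auto simp: partitions_of_def)
      then show ?case using a nu by (auto simp: partitions_of_def)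
    next
      case (3 b)
      then show ?case by auto
    next
      case (4 b)
      then show ?case by (auto simp: partitions_of_def)
    next
      case (5 a)
      then obtain \<mu> i where a: "a = (\<mu>, i)" "\<mu> \<in> partitions_of n" "i \<in># \<mu>" by auto
      then have "i > 0" by (auto simp: partitions_of_def intro!: Nat.gr0I)
      then show ?case using a partition_weight_add_mset[of i "\<mu> - {#i#}"] by simp
    qed
    also have "\<dots> = (\<Sum>i=1..n. \<Sum>\<nu>\<in>partitions_of (n - i). partition_weight \<nu>)"
      by (rule sum.Sigma[symmetric]) (auto simp: finite_partitions_of)
    also have "\<dots> = (\<Sum>i=1..n. 1)"
      by (rule sum.cong) (auto intro!: less.IH)
    finally show ?thesis using False by simp
  qed
qed

section \<open>Counting in a maximal torus\<close>

context closed_field_prime_power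
begin

text \<open>The order of the cyclic factor of the torus that belongs to a cycle of length k. The
  sign calls for integers; for k > 0 the value is positive, so \<open>nat\<close> loses
  nothing.\<close>

definition torus_order :: "nat \<Rightarrow> nat" where
  "torus_order k = nat (int q ^ k - (- 1) ^ k)"

lemma torus_order_even: "even k \<Longrightarrow> torus_order k = q ^ k - 1"
  using q_ge_2 by (simp add: torus_order_def nat_diff_distrib nat_power_eq)

lemma torus_order_odd: "odd k \<Longrightarrow> torus_order k = q ^ k + 1"
  using q_ge_2 by (simp add: torus_order_def nat_add_distrib nat_power_eq)

lemma q_power_ge_2: "k > 0 \<Longrightarrow> q ^ k \<ge> 2"
  using q_ge_2 self_le_power[of q k] by linarith

lemma torus_order_pos: "k > 0 \<Longrightarrow> torus_order k > 0"
  using q_power_ge_2[of k] by (cases "even k") (auto simp: torus_order_even torus_order_odd)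

lemma int_torus_order: "k > 0 \<Longrightarrow> int (torus_order k) = int q ^ k - (- 1) ^ k"
  using torus_order_pos[of k] by (simp add: torus_order_def)

lemma coprime_torus_order:
  assumes "k > 0"
  shows "coprime (torus_order k) q"
proof -
  have "coprime (torus_order k) (q ^ k)"
  proof (cases "even k")
    case True
    then show ?thesis
      using q_ge_2 by (simp only: torus_order_even) (intro coprime_diff_one_left_nat, simp)
  next
    case False
    then show ?thesis using q_ge_2 coprime_add_one_left[of "q ^ k"]
      by (simp only: torus_order_odd not_False_eq_True)
  qed
  then show ?thesis using assms by (auto simp only: coprime_power_right_iff)
qed

lemma torus_order_ge: "k > 0 \<Longrightarrow> q \<le> 4 * torus_order k"
  using q_power_ge_2[of k] self_le_power[of q k] q_ge_2
  by (cases "even k") (auto simp: torus_order_even torus_order_odd)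

text \<open>A factor 2 is given away twice: q^(m+1) + q <= 2 q^k, and q^k <= 2 (q^k - 1) for even k.
  This is the 4 in the final constant.\<close>

lemma torus_order_growth:
  assumes "0 < m" "m < k"
  shows "q * torus_order m \<le> 4 * torus_order k"
proof -
  have "torus_order m \<le> q ^ m + 1"
    by (cases "even m") (auto simp: torus_order_even torus_order_odd)
  then have "q * torus_order m \<le> q * (q ^ m + 1)" by (rule mult_left_mono) simp
  also have "\<dots> = q ^ Suc m + q" by simp
  also have "q ^ Suc m + q \<le> q ^ k + q ^ k"
    using assms q_ge_2 by (intro add_mono power_increasing self_le_power) auto
  also have "q ^ k + q ^ k \<le> 4 * torus_order k"
  proof (cases "even k")
    case True
    have "q ^ k \<ge> 2" using assms by (intro q_power_ge_2) simp
    then show ?thesis unfolding torus_order_even[OF True] by arith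
  next
    case False
    then show ?thesis by (simp add: torus_order_odd)
  qed
  finally show ?thesis by simp
qed

text \<open>The torus equation reads d(s j) = d(j)^(-q), so c steps along a cycle raise a value to
  the power (-q)^c. Integer exponents avoid a distinction by the parity of c.\<close>

abbreviation ipow :: "'a \<Rightarrow> int \<Rightarrow> 'a" where "ipow x k \<equiv> x [^]\<^bsub>Multiplicative_Group.mult_of L\<^esub> k"

sublocale mult_group: comm_group "Multiplicative_Group.mult_of L"
  using field_mult_group m_comm by (intro group.group_comm_groupI) auto

lemma ipow_closed: "x \<in> carrier L \<Longrightarrow> x \<noteq> \<zero> \<Longrightarrow> ipow x k \<in> carrier L \<and> ipow x k \<noteq> \<zero>"
  using mult_group.int_pow_closed[of x k] by auto

lemma ipow_ipow: "x \<in> carrier L \<Longrightarrow> x \<noteq> \<zero> \<Longrightarrow> ipow (ipow x j) k = ipow x (j * k)"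
  using mult_group.int_pow_pow[of x j k] by simp

lemma ipow_nat: "ipow x (int k) = x [^] k"
  by (simp add: int_pow_int Multiplicative_Group.nat_pow_mult_of)

lemma mult_eq_one_iff_ipow:
  assumes "x \<in> carrier L" "x \<noteq> \<zero>" "y \<in> carrier L"
  shows "y \<otimes> x [^] q = \<one> \<longleftrightarrow> y = ipow x (- int q)"
proof -
  have xq: "x [^] q \<in> carrier (Multiplicative_Group.mult_of L)" using assms nat_pow_nonzero by simp
  have "y \<otimes> x [^] q = \<one> \<longleftrightarrow> y = inv\<^bsub>Multiplicative_Group.mult_of L\<^esub> (x [^] q)"
  proof
    assume yx: "y \<otimes> x [^] q = \<one>"
    have "y \<noteq> \<zero>" using yx assms by auto
    then show "y = inv\<^bsub>Multiplicative_Group.mult_of L\<^esub> (x [^] q)"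
      using yx xq assms mult_group.inv_equality[of y "x [^] q"] by simp
  next
    assume "y = inv\<^bsub>Multiplicative_Group.mult_of L\<^esub> (x [^] q)"
    then show "y \<otimes> x [^] q = \<one>" using mult_group.l_inv[OF xq] by simp
  qed
  also have "inv\<^bsub>Multiplicative_Group.mult_of L\<^esub> (x [^] q) = ipow x (- int q)"
    using assms mult_group.int_pow_neg[of x "int q"] by (simp add: ipow_nat)
  finally show ?thesis .
qed

text \<open>The number (-q)^k - 1 is the torus order up to sign, and the sign only inverts the
  power.\<close>

lemma unity_roots_torus_order_iff:
  assumes "x \<in> carrier L" "x \<noteq> \<zero>" "k > 0"
  shows "x \<in> unity_roots (torus_order k) \<longleftrightarrow> ipow x ((- int q) ^ k) = x"
proof -
  have xg: "x \<in> carrier (Multiplicative_Group.mult_of L)" using assms by simp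
  have "ipow x ((- int q) ^ k) = x \<longleftrightarrow> ipow x ((- int q) ^ k - 1) = \<one>"
  proof -
    have "ipow x ((- int q) ^ k) = ipow x ((- int q) ^ k - 1) \<otimes> x"
      using mult_group.int_pow_mult[OF xg, of "(- int q) ^ k - 1" 1] xg by (simp add: mult_group.int_pow_1)
    then show ?thesis
      using assms ipow_closed[of x "(- int q) ^ k - 1"] m_rcancel[of x "ipow x ((- int q) ^ k - 1)" \<one>] by auto
  qed
  also have "\<dots> \<longleftrightarrow> ipow x (int (torus_order k)) = \<one>"
  proof (cases "even k")
    case True
    then show ?thesis using assms by (simp add: int_torus_order)
  next
    case False
    then have "(- int q) ^ k - 1 = - int (torus_order k)" using assms by (simp add: int_torus_order)
    then show ?thesis
      using mult_group.int_pow_neg[OF xg, of "int (torus_order k)"]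
        mult_group.inv_eq_1_iff[of "ipow x (int (torus_order k))"] xg mult_group.int_pow_closed[OF xg]
      by simp
  qed
  finally show ?thesis using assms by (simp add: unity_roots_def ipow_nat)
qed

lemma unity_roots_ipow_mod:
  assumes "x \<in> unity_roots (torus_order k)" "k > 0"
  shows "ipow x ((- int q) ^ (c mod k)) = ipow x ((- int q) ^ c)"
proof -
  have x: "x \<in> carrier L" "x \<noteq> \<zero>"
    using unity_roots_pos[OF assms(1)] torus_order_pos[OF assms(2)] by auto
  have per: "ipow x ((- int q) ^ k) = x" using unity_roots_torus_order_iff x assms by blast
  have mult: "ipow x ((- int q) ^ (k * m)) = x" for m
  proof (induction m)
    case 0
    then show ?case using x by (simp add: mult_group.int_pow_1)
  next
    case (Suc m)
    have "ipow x ((- int q) ^ (k * Suc m)) = ipow (ipow x ((- int q) ^ k)) ((- int q) ^ (k * m))"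
      using x by (simp add: ipow_ipow power_add)
    then show ?case using per Suc by simp
  qed
  have "ipow x ((- int q) ^ c) = ipow x ((- int q) ^ (k * (c div k) + c mod k))" by simp
  also have "\<dots> = ipow (ipow x ((- int q) ^ (k * (c div k)))) ((- int q) ^ (c mod k))"
    unfolding power_add by (rule ipow_ipow[OF x, symmetric])
  finally show ?thesis by (simp only: mult)
qed

end

locale cycle_torus = matrix_space L q n + cycle_system n l s e
  for L (structure) and q n l s e
begin

lemma torus_value:
  assumes d: "d \<in> torus s" and b: "b < length l"
  shows "d (e b c) = ipow (d (e b 0)) ((- int q) ^ c)"
proof (induction c)
  case 0
  have "d (e b 0) \<in> carrier (Multiplicative_Group.mult_of L)"
    using torus_carrier[OF d] torus_nonzero[OF s_perm d] e_less[OF b] by simp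
  then show ?case by (simp add: mult_group.int_pow_1)
next
  case (Suc c)
  have c: "d (e b c) \<in> carrier L" "d (e b c) \<noteq> \<zero>" for c
    using torus_carrier[OF d] torus_nonzero[OF s_perm d] e_less[OF b] by auto
  have "d (e b (Suc c)) \<otimes> d (e b c) [^] q = \<one>"
    using d e_less[OF b, of c] s_e[OF b, of c] by (auto simp: torus_def)
  then have "d (e b (Suc c)) = ipow (d (e b c)) (- int q)"
    using mult_eq_one_iff_ipow[OF c c(1)] by blast
  also have "\<dots> = ipow (d (e b 0)) ((- int q) ^ Suc c)"
    unfolding Suc.IH using c by (simp add: ipow_ipow mult.commute)
  finally show ?case .
qed

text \<open>The cycle closes after l ! b steps, so its first value is fixed by x -> x^((-q)^(l !
  b)).\<close>

lemma torus_start: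
  assumes d: "d \<in> torus s" and b: "b < length l"
  shows "d (e b 0) \<in> unity_roots (torus_order (l ! b))"
proof -
  have "e b (l ! b) = e b 0" using e_eq_iff[OF b b] by simp
  then have "ipow (d (e b 0)) ((- int q) ^ (l ! b)) = d (e b 0)"
    using torus_value[OF d b, of "l ! b"] by simp
  then show ?thesis
    using unity_roots_torus_order_iff[of "d (e b 0)" "l ! b"] torus_carrier[OF d]
      torus_nonzero[OF s_perm d] e_less[OF b] length_pos[OF b] by simp
qed

text \<open>Coordinates on the torus: the values at the first points of the cycles identify it with
  a product of groups of roots of unity.\<close>

abbreviation start :: "(nat \<Rightarrow> 'a) \<Rightarrow> nat \<Rightarrow> 'a" where
  "start d \<equiv> (\<lambda>b\<in>{..<length l}. d (e b 0))"

abbreviation starts :: "(nat \<Rightarrow> 'a) set" where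
  "starts \<equiv> \<Pi>\<^sub>E b\<in>{..<length l}. unity_roots (torus_order (l ! b))"

lemma inj_on_start: "inj_on start (torus s)"
proof (rule inj_onI)
  fix d d' assume d: "d \<in> torus s" "d' \<in> torus s" and eq: "start d = start d'"
  have "d j = d' j" if "j < n" for j
  proof -
    from e_surj[OF that] obtain b c where bc: "b < length l" "j = e b c" by blast
    have "d (e b 0) = d' (e b 0)" using fun_cong[OF eq, of b] bc by simp
    then show ?thesis
      by (simp only: bc(2) torus_value[OF d(1) bc(1), of c] torus_value[OF d(2) bc(1), of c])
  qed
  moreover have "d \<in> extensional {..<n}" "d' \<in> extensional {..<n}"
    using d by (auto simp: torus_def PiE_def)
  ultimately show "d = d'" by (intro extensionalityI) auto
qed

lemma ex_torus_start:
  assumes a: "a \<in> starts"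
  shows "\<exists>d\<in>torus s. \<forall>b<length l. d (e b 0) = a b"
proof -
  define bl where "bl j = (SOME b. b < length l \<and> (\<exists>c. j = e b c))" for j
  \<comment> \<open>The position is chosen among many that differ by multiples of the cycle length;
    \<open>unity_roots_ipow_mod\<close> makes the resulting value independent of the choice.\<close>
  define os where "os j = (SOME c. j = e (bl j) c)" for j
  define d where "d = (\<lambda>j\<in>{..<n}. ipow (a (bl j)) ((- int q) ^ os j))"
  have ab: "a b \<in> unity_roots (torus_order (l ! b))" "a b \<in> carrier L" "a b \<noteq> \<zero>" if "b < length l" for b
  proof -
    show "a b \<in> unity_roots (torus_order (l ! b))" using a that by auto
    from unity_roots_pos[OF this] torus_order_pos[OF length_pos[OF that]]
    show "a b \<in> carrier L" "a b \<noteq> \<zero>" by auto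
  qed
  have de: "d (e b c) = ipow (a b) ((- int q) ^ c)" if b: "b < length l" for b c
  proof -
    have 1: "bl (e b c) < length l \<and> (\<exists>c'. e b c = e (bl (e b c)) c')"
      unfolding bl_def by (rule someI[of _ b]) (use b in auto)
    then have bl: "bl (e b c) = b" using e_eq_iff[OF b] by metis
    have "e b c = e (bl (e b c)) (os (e b c))"
      unfolding os_def using 1 by (intro someI_ex[of "\<lambda>c'. e b c = e (bl (e b c)) c'"]) blast
    then have "c mod (l ! b) = os (e b c) mod (l ! b)" using e_eq_iff[OF b b] bl by metis
    then have "ipow (a b) ((- int q) ^ os (e b c)) = ipow (a b) ((- int q) ^ c)"
      using unity_roots_ipow_mod[OF ab(1)[OF b] length_pos[OF b]] by metis
    then show ?thesis using e_less[OF b] bl by (simp add: d_def)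
  qed
  have "d \<in> torus s" unfolding torus_def
  proof (intro CollectI conjI allI impI)
    show "d \<in> {..<n} \<rightarrow>\<^sub>E carrier L"
    proof (rule PiE_I)
      fix j assume "j \<in> {..<n}"
      then obtain b c where bc: "b < length l" "j = e b c" using e_surj by blast
      then show "d j \<in> carrier L" using ipow_closed[OF ab(2,3)[OF bc(1)]] de by simp
    qed (simp add: d_def)
    fix j assume "j < n"
    then obtain b c where bc: "b < length l" "j = e b c" using e_surj by blast
    note x = ab(2,3)[OF bc(1)]
    have "d (s j) = ipow (a b) ((- int q) ^ Suc c)" using bc s_e de by simp
    also have "\<dots> = ipow (d j) (- int q)"
      using bc de x by (simp add: ipow_ipow mult.commute)
    finally have dsj: "d (s j) = ipow (d j) (- int q)" .
    have dj: "d j \<in> carrier L" "d j \<noteq> \<zero>" using ipow_closed[OF x] de bc by simp_all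
    then have "d (s j) \<in> carrier L" unfolding dsj using ipow_closed by blast
    then show "d (s j) \<otimes> d j [^] q = \<one>" using mult_eq_one_iff_ipow[OF dj] dsj by blast
  qed
  moreover have "d (e b 0) = a b" if "b < length l" for b
    using de[OF that, of 0] ab[OF that] by (simp add: mult_group.int_pow_1)
  ultimately show ?thesis by blast
qed

lemma start_image: "start ` torus s = starts"
proof
  show "start ` torus s \<subseteq> starts"
    by (intro image_subsetI) (simp add: torus_start)
  show "starts \<subseteq> start ` torus s"
  proof
    fix a assume a: "a \<in> starts"
    then obtain d where d: "d \<in> torus s" "\<forall>b<length l. d (e b 0) = a b" using ex_torus_start by blast
    then have "start d = a" using a by (intro ext) (auto simp: PiE_def extensional_def)
    then show "a \<in> start ` torus s" using d by blast
  qed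
qed

lemma finite_torus: "finite (torus s)"
proof -
  have "finite starts"
    by (intro finite_PiE) (auto intro!: finite_unity_roots torus_order_pos length_pos)
  then have "finite (start ` torus s)" unfolding start_image .
  then show ?thesis by (rule finite_imageD) (rule inj_on_start)
qed

lemma card_torus: "card (torus s) = (\<Prod>b<length l. torus_order (l ! b))"
proof -
  have "card (torus s) = card starts" using card_image[OF inj_on_start] start_image by simp
  also have "\<dots> = (\<Prod>b<length l. torus_order (l ! b))"
    by (auto simp: card_PiE intro!: prod.cong card_unity_roots coprime_torus_order torus_order_pos length_pos)
  finally show ?thesis .
qed

definition torus_powers :: "nat \<Rightarrow> (nat \<Rightarrow> 'a) set" where
  "torus_powers m = {d \<in> torus s. \<exists>r\<in>torus s. \<forall>i<n. d i = r i [^] m}"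

text \<open>Being an m-th power can be tested at the first points of the cycles: roots chosen there
  extend to an element of the torus, whose m-th power has the prescribed coordinates.\<close>

lemma start_torus_powers:
  "start ` torus_powers m = (\<Pi>\<^sub>E b\<in>{..<length l}. (\<lambda>x. x [^] m) ` unity_roots (torus_order (l ! b)))"
proof
  show "start ` torus_powers m \<subseteq> (\<Pi>\<^sub>E b\<in>{..<length l}. (\<lambda>x. x [^] m) ` unity_roots (torus_order (l ! b)))"
  proof (rule image_subsetI)
    fix d assume "d \<in> torus_powers m"
    then obtain r where r: "r \<in> torus s" "\<forall>i<n. d i = r i [^] m" by (auto simp: torus_powers_def)
    show "start d \<in> (\<Pi>\<^sub>E b\<in>{..<length l}. (\<lambda>x. x [^] m) ` unity_roots (torus_order (l ! b)))"
      using r torus_start[OF r(1)] e_less by auto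
  qed
next
  show "(\<Pi>\<^sub>E b\<in>{..<length l}. (\<lambda>x. x [^] m) ` unity_roots (torus_order (l ! b))) \<subseteq> start ` torus_powers m"
  proof
    fix a assume a: "a \<in> (\<Pi>\<^sub>E b\<in>{..<length l}. (\<lambda>x. x [^] m) ` unity_roots (torus_order (l ! b)))"
    then have "\<forall>b\<in>{..<length l}. \<exists>x. x \<in> unity_roots (torus_order (l ! b)) \<and> a b = x [^] m"
      by (auto simp: PiE_iff)
    from bchoice[OF this] obtain x where x: "\<And>b. b < length l \<Longrightarrow> x b \<in> unity_roots (torus_order (l ! b))"
      "\<And>b. b < length l \<Longrightarrow> a b = x b [^] m" by auto
    have "restrict x {..<length l} \<in> starts" using x by auto
    from ex_torus_start[OF this]
    obtain r where r: "r \<in> torus s" "\<And>b. b < length l \<Longrightarrow> r (e b 0) = x b" by auto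
    define d where "d = (\<lambda>i\<in>{..<n}. r i [^] m)"
    have rc: "r i \<in> carrier L" if "i < n" for i using torus_carrier[OF r(1) that] .
    have sn: "s i < n" if "i < n" for i using permutes_in_image[OF s_perm, of i] that by simp
    have "d \<in> torus s" unfolding torus_def
    proof (intro CollectI conjI allI impI)
      show "d \<in> {..<n} \<rightarrow>\<^sub>E carrier L" using rc by (auto simp: d_def)
      fix j assume j: "j < n"
      have "d (s j) \<otimes> d j [^] q = r (s j) [^] m \<otimes> (r j [^] q) [^] m"
        using j sn rc by (simp add: d_def nat_pow_pow mult.commute)
      also have "\<dots> = (r (s j) \<otimes> r j [^] q) [^] m"
        using nat_pow_distrib[of "r (s j)" "r j [^] q" m] rc[OF j] rc[OF sn[OF j]] by simp
      also have "r (s j) \<otimes> r j [^] q = \<one>" using r(1) j by (auto simp: torus_def)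
      finally show "d (s j) \<otimes> d j [^] q = \<one>" by simp
    qed
    then have "d \<in> torus_powers m" using r by (auto simp: torus_powers_def d_def)
    moreover have "start d = a"
    proof
      fix b show "start d b = a b"
        using a r x e_less[of b 0] by (cases "b < length l") (auto simp: d_def PiE_def extensional_def)
    qed
    ultimately show "a \<in> start ` torus_powers m" by blast
  qed
qed

lemma card_torus_powers:
  assumes "m > 0"
  shows "real (card (torus_powers m))
    = real (card (torus s)) * (\<Prod>b<length l. 1 / real (gcd m (torus_order (l ! b))))"
proof -
  have "inj_on start (torus_powers m)"
    by (rule inj_on_subset[OF inj_on_start]) (auto simp: torus_powers_def)
  then have "card (torus_powers m) = card (start ` torus_powers m)" by (rule card_image[symmetric])
  also have "\<dots> = (\<Prod>b<length l. card ((\<lambda>x. x [^] m) ` unity_roots (torus_order (l ! b))))"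
    unfolding start_torus_powers by (simp add: card_PiE)
  finally have "real (card (torus_powers m))
    = (\<Prod>b<length l. real (card ((\<lambda>x. x [^] m) ` unity_roots (torus_order (l ! b)))))" by simp
  also have "\<dots> = (\<Prod>b<length l. real (torus_order (l ! b)) * (1 / real (gcd m (torus_order (l ! b)))))"
  proof (rule prod.cong)
    fix b assume "b \<in> {..<length l}"
    then have b: "l ! b > 0" using length_pos by simp
    have "card ((\<lambda>x. x [^] m) ` unity_roots (torus_order (l ! b))) * gcd m (torus_order (l ! b)) = torus_order (l ! b)"
      using b assms by (intro card_power_unity_roots coprime_torus_order torus_order_pos)
    then have "real (card ((\<lambda>x. x [^] m) ` unity_roots (torus_order (l ! b)))) * real (gcd m (torus_order (l ! b)))
        = real (torus_order (l ! b))" by (metis of_nat_mult)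
    moreover have "real (gcd m (torus_order (l ! b))) \<noteq> 0" using assms by simp
    ultimately show "real (card ((\<lambda>x. x [^] m) ` unity_roots (torus_order (l ! b))))
        = real (torus_order (l ! b)) * (1 / real (gcd m (torus_order (l ! b))))"
      by (simp add: field_simps)
  qed simp
  finally show ?thesis by (simp only: card_torus prod.distrib of_nat_prod)
qed

lemma card_torus_split:
  assumes "b < length l"
  shows "card (torus s) = torus_order (l ! b) * (\<Prod>b\<in>{..<length l} - {b}. torus_order (l ! b))"
  unfolding card_torus using assms by (intro prod.remove) auto

text \<open>On different cycles, the other coordinates determine the one of \<open>b'\<close>, which
  saves a factor \<open>torus_order (l ! b')\<close>, at least q / 4. On the same cycle, the
  coincidence gives the values a period m smaller than the length, so the coordinate lies in a group
  of order \<open>torus_order m\<close>, smaller by a factor of at least q / 4.\<close>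

lemma card_coincidence_le:
  assumes ij: "i < n" "j < n" "i \<noteq> j"
  shows "q * card {d \<in> torus s. d i = d j} \<le> 4 * card (torus s)" (is "q * card ?D \<le> _")
proof -
  have inj: "inj_on start ?D" by (rule inj_on_subset[OF inj_on_start]) auto
  have fin: "finite ?D" by (rule finite_subset[OF _ finite_torus]) auto
  obtain b c where i: "b < length l" "c < l ! b" "i = e b c" using e_surj[OF ij(1)] by blast
  obtain b' c' where j: "b' < length l" "c' < l ! b'" "j = e b' c'" using e_surj[OF ij(2)] by blast
  let ?R = "\<Prod>b\<in>{..<length l} - {b'}. torus_order (l ! b)"
  have fin_roots: "finite (unity_roots (torus_order (l ! b)))" if "b < length l" for b
    using that by (intro finite_unity_roots torus_order_pos length_pos)
  have card_roots: "card (unity_roots (torus_order (l ! b))) = torus_order (l ! b)" if "b < length l" for b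
    using that by (intro card_unity_roots coprime_torus_order torus_order_pos length_pos)
  \<comment> \<open>Going on to the end of the cycle recovers the first value from any later one, so
    no root has to be extracted.\<close>
  have wrap: "ipow (d (e b c)) ((- int q) ^ (l ! b - c)) = d (e b 0)"
    if "d \<in> torus s" "b < length l" "c < l ! b" for d b c
  proof -
    have x: "d (e b 0) \<in> carrier L" "d (e b 0) \<noteq> \<zero>"
      using torus_carrier[OF that(1)] torus_nonzero[OF s_perm that(1)] e_less[OF that(2)] by auto
    have "ipow (d (e b c)) ((- int q) ^ (l ! b - c)) = ipow (d (e b 0)) ((- int q) ^ (l ! b))"
      unfolding torus_value[OF that(1,2), of c] ipow_ipow[OF x] power_add[symmetric]
      using that(3) by (simp only: le_add_diff_inverse less_imp_le)
    also have "\<dots> = d (e b (l ! b))" by (rule torus_value[OF that(1,2), symmetric])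
    also have "e b (l ! b) = e b 0" using e_eq_iff[OF that(2,2)] by simp
    finally show ?thesis .
  qed
  show ?thesis
  proof (cases "b = b'")
    case False
    let ?r = "\<lambda>d. restrict (start d) ({..<length l} - {b'})"
    have "inj_on ?r ?D"
    proof (rule inj_onI)
      fix d d' assume d: "d \<in> ?D" "d' \<in> ?D" and eq: "?r d = ?r d'"
      have other: "d (e k 0) = d' (e k 0)" if "k < length l" "k \<noteq> b'" for k
        using fun_cong[OF eq, of k] that by simp
      have "d j = d' j"
        using d other[OF i(1) False] torus_value[of d b c] torus_value[of d' b c] i by auto
      then have last: "d (e b' 0) = d' (e b' 0)"
        using wrap[of d b' c'] wrap[of d' b' c'] d j by auto
      have "start d = start d'"
      proof (rule restrict_ext)
        fix k assume "k \<in> {..<length l}"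
        then show "d (e k 0) = d' (e k 0)" using other last by (cases "k = b'") auto
      qed
      then show "d = d'" using inj_onD[OF inj] d by blast
    qed
    then have "card ?D = card (?r ` ?D)" by (rule card_image[symmetric])
    also have "\<dots> \<le> card (\<Pi>\<^sub>E k\<in>{..<length l} - {b'}. unity_roots (torus_order (l ! k)))"
    proof (rule card_mono)
      show "finite (\<Pi>\<^sub>E k\<in>{..<length l} - {b'}. unity_roots (torus_order (l ! k)))"
        using fin_roots by (intro finite_PiE) auto
      show "?r ` ?D \<subseteq> (\<Pi>\<^sub>E k\<in>{..<length l} - {b'}. unity_roots (torus_order (l ! k)))"
        by (intro image_subsetI PiE_I) (use torus_start in auto)
    qed
    also have "\<dots> = ?R" using card_roots by (auto simp: card_PiE intro!: prod.cong)
    finally have "q * card ?D \<le> q * ?R" by simp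
    also have "\<dots> \<le> 4 * torus_order (l ! b') * ?R"
      by (intro mult_right_mono torus_order_ge length_pos j) simp
    finally show ?thesis using card_torus_split[OF j(1)] by (simp add: mult.assoc)
  next
    case True
    define c1 where "c1 = min c c'"
    define c2 where "c2 = max c c'"
    have "c \<noteq> c'" using ij(3) i(3) j(3) True by blast
    then have c12: "c1 < c2" "c2 < l ! b'" using i(2) j(2) True by (auto simp: c1_def c2_def)
    define m where "m = c2 - c1"
    have m: "0 < m" "m < l ! b'" using c12 by (auto simp: m_def)
    have root: "d (e b' 0) \<in> unity_roots (torus_order m)" if d: "d \<in> ?D" for d
    proof -
      have t: "d \<in> torus s" using d by simp
      have x: "d (e b' 0) \<in> carrier L" "d (e b' 0) \<noteq> \<zero>"
        using torus_carrier[OF t] torus_nonzero[OF s_perm t] e_less[OF j(1)] by auto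
      have per: "d (e b' 0) \<in> unity_roots (torus_order (l ! b'))" using torus_start[OF t j(1)] .
      have "d (e b' c1) = d (e b' c2)"
        using d i j True by (auto simp: c1_def c2_def min_def max_def)
      \<comment> \<open>Both equal values are continued by l ! b' - c1 steps: from c1 this arrives
        at the first point of the cycle, from c2 it arrives m steps beyond it.\<close>
      then have "ipow (d (e b' c2)) ((- int q) ^ (l ! b' - c1)) = d (e b' 0)"
        using wrap[OF t j(1), of c1] c12 by simp
      then have "ipow (d (e b' 0)) ((- int q) ^ (c2 + (l ! b' - c1))) = d (e b' 0)"
        unfolding torus_value[OF t j(1), of c2] ipow_ipow[OF x] power_add .
      moreover have "(c2 + (l ! b' - c1)) mod (l ! b') = m"
      proof -
        have "c2 + (l ! b' - c1) = m + l ! b'" using c12 by (simp add: m_def)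
        then show ?thesis using m by simp
      qed
      ultimately have "ipow (d (e b' 0)) ((- int q) ^ m) = d (e b' 0)"
        using unity_roots_ipow_mod[OF per length_pos[OF j(1)], of "c2 + (l ! b' - c1)"] by simp
      then show ?thesis using unity_roots_torus_order_iff[OF x m(1)] by blast
    qed
    let ?A = "\<lambda>k. if k = b' then unity_roots (torus_order m) else unity_roots (torus_order (l ! k))"
    have "card ?D = card (start ` ?D)" using inj by (rule card_image[symmetric])
    also have "\<dots> \<le> card (\<Pi>\<^sub>E k\<in>{..<length l}. ?A k)"
    proof (rule card_mono)
      show "finite (\<Pi>\<^sub>E k\<in>{..<length l}. ?A k)"
        using fin_roots finite_unity_roots[OF torus_order_pos[OF m(1)]] by (intro finite_PiE) auto
      show "start ` ?D \<subseteq> (\<Pi>\<^sub>E k\<in>{..<length l}. ?A k)"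
        using root torus_start by (intro image_subsetI PiE_I) auto
    qed
    also have "\<dots> = (\<Prod>k<length l. card (?A k))" by (simp add: card_PiE)
    also have "\<dots> = card (?A b') * (\<Prod>k\<in>{..<length l} - {b'}. card (?A k))"
      using j(1) by (intro prod.remove) auto
    also have "(\<Prod>k\<in>{..<length l} - {b'}. card (?A k)) = ?R"
      by (rule prod.cong) (use card_roots in auto)
    also have "card (?A b') = torus_order m"
      using card_unity_roots coprime_torus_order torus_order_pos m by simp
    finally have "q * card ?D \<le> q * torus_order m * ?R" by (simp add: mult.assoc)
    also have "\<dots> \<le> 4 * torus_order (l ! b') * ?R"
      by (intro mult_right_mono torus_order_growth m) simp
    finally show ?thesis using card_torus_split[OF j(1)] by (simp add: mult.assoc)
  qed
qed

text \<open>A union bound over at most n^2 pairs of positions; it becomes the error term 4 n^2 /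
  q.\<close>

lemma card_nonregular_le:
  "q * card {d \<in> torus s. \<not> inj_on d {..<n}} \<le> 4 * n ^ 2 * card (torus s)"
proof -
  let ?I = "{(i, j). i < n \<and> j < n \<and> i \<noteq> j}"
  have I: "finite ?I" "card ?I \<le> n ^ 2"
  proof -
    have sub: "?I \<subseteq> {..<n} \<times> {..<n}" by auto
    then show "finite ?I" by (rule finite_subset) simp
    show "card ?I \<le> n ^ 2"
      using card_mono[OF _ sub] by (simp add: card_cartesian_product power2_eq_square)
  qed
  have "{d \<in> torus s. \<not> inj_on d {..<n}} \<subseteq> (\<Union>(i, j)\<in>?I. {d \<in> torus s. d i = d j})"
    by (auto simp: inj_on_def)
  then have "card {d \<in> torus s. \<not> inj_on d {..<n}} \<le> card (\<Union>(i, j)\<in>?I. {d \<in> torus s. d i = d j})"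
    by (intro card_mono) (use I finite_torus in auto)
  also have "\<dots> \<le> (\<Sum>(i, j)\<in>?I. card {d \<in> torus s. d i = d j})"
    using card_UN_le[OF I(1), of "\<lambda>(i, j). {d \<in> torus s. d i = d j}"] by (simp add: case_prod_unfold)
  finally have "q * card {d \<in> torus s. \<not> inj_on d {..<n}}
      \<le> q * (\<Sum>(i, j)\<in>?I. card {d \<in> torus s. d i = d j})" by simp
  also have "\<dots> = (\<Sum>(i, j)\<in>?I. q * card {d \<in> torus s. d i = d j})"
    by (simp add: sum_distrib_left case_prod_unfold)
  also have "\<dots> \<le> (\<Sum>(i, j)\<in>?I. 4 * card (torus s))"
    by (rule sum_mono) (use card_coincidence_le in auto)
  also have "\<dots> = card ?I * (4 * card (torus s))" by (simp add: case_prod_unfold)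
  also have "\<dots> \<le> n ^ 2 * (4 * card (torus s))" using I(2) by (rule mult_right_mono) simp
  finally show ?thesis by (simp add: mult_ac)
qed

end

section \<open>The density of powers\<close>

context matrix_space
begin

definition unitary_powers :: "nat \<Rightarrow> 'a mat set" where
  "unitary_powers m = (\<lambda>x. x [^]\<^bsub>Mat\<^esub> m) ` unitaries"

lemma unitary_mult_closed:
  assumes "x \<in> unitaries" "y \<in> unitaries"
  shows "x \<star> y \<in> unitaries"
proof -
  have c: "x \<in> Units Mat" "y \<in> Units Mat" "x \<in> carrier Mat" "y \<in> carrier Mat"
    "adj x \<in> carrier Mat" "adj y \<in> carrier Mat"
    using assms adj_closed by (auto simp: unitaries_def)
  have "x \<star> y \<star> adj (x \<star> y) = x \<star> (y \<star> adj y) \<star> adj x"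
    using c by (simp add: adj_mult Mat.m_assoc)
  also have "\<dots> = \<one>\<^bsub>Mat\<^esub>" using assms c by (simp add: unitaries_def)
  finally show ?thesis using c by (simp add: unitaries_def)
qed

lemma unitary_pow_closed: "x \<in> unitaries \<Longrightarrow> x [^]\<^bsub>Mat\<^esub> (k::nat) \<in> unitaries"
  by (induction k) (auto simp: one_unitary unitary_mult_closed)

text \<open>\<open>\<mu>\<close> is the cycle type of the permutation of the eigenlines induced by the Frobenius map.\<close>

definition of_cycle_type :: "nat multiset \<Rightarrow> 'a mat set \<Rightarrow> bool" where
  "of_cycle_type \<mu> A \<longleftrightarrow> (\<exists>l s e g S. mset l = \<mu> \<and> cycle_system n l s e \<and> frame s g \<and>
     S \<subseteq> torus s \<and> (\<forall>d\<in>S. inj_on d {..<n}) \<and> A = conj_set g S)"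

lemma of_cycle_type_disjoint:
  assumes "of_cycle_type \<mu> A" "of_cycle_type \<nu> B" "\<mu> \<noteq> \<nu>"
  shows "A \<inter> B = {}"
proof (rule ccontr)
  assume ne: "A \<inter> B \<noteq> {}"
  obtain l s e g S where 1: "mset l = \<mu>" "cycle_system n l s e" "frame s g" "S \<subseteq> torus s"
    "\<And>d. d \<in> S \<Longrightarrow> inj_on d {..<n}" "A = conj_set g S"
    using assms(1) unfolding of_cycle_type_def by blast
  obtain l' s' e' g' S' where 2: "mset l' = \<nu>" "cycle_system n l' s' e'" "frame s' g'" "S' \<subseteq> torus s'"
    "\<And>d. d \<in> S' \<Longrightarrow> inj_on d {..<n}" "B = conj_set g' S'"
    using assms(2) unfolding of_cycle_type_def by blast
  from ne obtain h d h' d' where hd: "h \<in> unitaries" "d \<in> S" "h' \<in> unitaries" "d' \<in> S'"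
    and eq: "(h \<star> g) \<star> diag d \<star> inv\<^bsub>Mat\<^esub> (h \<star> g)
      = (h' \<star> g') \<star> diag d' \<star> inv\<^bsub>Mat\<^esub> (h' \<star> g')"
    unfolding 1(6) 2(6) conj_set_def by auto
  have "\<exists>p t. p permutes {..<n} \<and> (\<forall>j<n. s' (p j) = p (s j)) \<and> t \<in> torus s \<and>
      inv\<^bsub>Mat\<^esub> (h \<star> g) \<star> (h' \<star> g') = monomial_mat p t"
    by (rule frames_same_conj_imp_monomial[OF _ _ unitary_mult_frame[OF hd(1) 1(3)]
          unitary_mult_frame[OF hd(3) 2(3)] _ _ _ _ eq])
      (use hd 1 2 in \<open>auto intro: cycle_system.s_perm\<close>)
  then obtain p where "p permutes {..<n}" "\<And>j. j < n \<Longrightarrow> s' (p j) = p (s j)" by blast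
  from intertwiner_imp_mset_eq[OF 1(2) 2(2) this] show False using 1(1) 2(1) assms(3) by simp
qed

lemma conj_set_unitary:
  assumes "s permutes {..<n}" "frame s g" "S \<subseteq> torus s"
  shows "conj_set g S \<subseteq> unitaries"
  unfolding conj_set_def
  using torus_conj_unitary[OF assms(1) unitary_mult_frame[OF _ assms(2)]] assms(3) by auto

end

context cycle_torus
begin

lemma ex_cycle_frame: "\<exists>g. frame s g"
proof -
  interpret twisted_space L q n s by unfold_locales (rule s_perm)
  show ?thesis by (rule ex_frame)
qed

lemma conj_set_powers_subset:
  assumes f: "frame s g" and S: "S \<subseteq> torus_powers m"
  shows "conj_set g S \<subseteq> unitary_powers m"
proof
  fix x assume "x \<in> conj_set g S"
  then obtain h d where hd: "h \<in> unitaries" "d \<in> S"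
    and x: "x = (h \<star> g) \<star> diag d \<star> inv\<^bsub>Mat\<^esub> (h \<star> g)"
    by (auto simp: conj_set_def)
  define a where "a = h \<star> g"
  have fa: "frame s a" unfolding a_def by (rule unitary_mult_frame[OF hd(1) f])
  obtain r where r: "r \<in> torus s" "\<And>i. i < n \<Longrightarrow> d i = r i [^] m"
    using hd(2) S by (auto simp: torus_powers_def)
  have rc: "r i \<in> carrier L" if "i < n" for i using torus_carrier[OF r(1) that] .
  have "diag d = diag (\<lambda>i. r i [^] m)"
    unfolding diag_def by (rule cong_mat) (use r in auto)
  also have "\<dots> = diag r [^]\<^bsub>Mat\<^esub> m" using diag_pow[of r m] rc by simp
  finally have "x = (a \<star> diag r \<star> inv\<^bsub>Mat\<^esub> a) [^]\<^bsub>Mat\<^esub> m"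
    using Mat.conj_nat_pow[OF frame_closed(1)[OF fa] diag_closed[of r], of m] rc x by (simp add: a_def)
  then show "x \<in> unitary_powers m"
    using torus_conj_unitary[OF s_perm fa r(1)] by (auto simp: unitary_powers_def)
qed

lemma conj_set_nonpowers_disjoint:
  assumes f: "frame s g" and S: "S \<subseteq> torus s - torus_powers m" "\<And>d. d \<in> S \<Longrightarrow> inj_on d {..<n}"
  shows "conj_set g S \<inter> unitary_powers m = {}"
proof (rule ccontr)
  assume "conj_set g S \<inter> unitary_powers m \<noteq> {}"
  then obtain h d y where hd: "h \<in> unitaries" "d \<in> S" "y \<in> unitaries"
    and eq: "y [^]\<^bsub>Mat\<^esub> m = (h \<star> g) \<star> diag d \<star> inv\<^bsub>Mat\<^esub> (h \<star> g)"
    unfolding conj_set_def unitary_powers_def by force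
  have d: "d \<in> torus s" "d \<notin> torus_powers m" using hd(2) S by auto
  have "\<exists>r\<in>torus s. \<forall>i<n. d i = r i [^] m"
    by (rule root_of_regular_conj[OF s_perm unitary_mult_frame[OF hd(1) f] d(1) S(2)[OF hd(2)] hd(3) eq])
  then show False using d by (auto simp: torus_powers_def)
qed

text \<open>The regular part of S makes up at least the proportion \<rho> - 4 n^2 / q of the torus,
  so the order of the torus cancels from the bound in \<open>card_conj_set\<close>. What remains of
  the fibre size is z, the reciprocal of the weight.\<close>

lemma card_conj_set_ge:
  assumes f: "frame s g" and S: "S \<subseteq> torus s" and rho: "real (card S) = \<rho> * real (card (torus s))"
  shows "real (card unitaries) * (partition_weight (mset l) * (\<rho> - 4 * real n ^ 2 / real q))
    \<le> real (card (conj_set g {d \<in> S. inj_on d {..<n}}))"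
proof -
  let ?R = "{d \<in> S. inj_on d {..<n}}" and ?N = "{d \<in> torus s. \<not> inj_on d {..<n}}"
  let ?T = "real (card (torus s))" and ?U = "real (card unitaries)"
  define z where "z = (\<Prod>i\<in>set_mset (mset l). fact (count (mset l) i) * i ^ count (mset l) i)"
  define x where "x = card (conj_set g ?R)"
  have q0: "real q > 0" using q_ge_2 by simp
  have T0: "?T > 0" unfolding card_torus by (auto intro!: prod_pos torus_order_pos length_pos)
  have z0: "z > 0" unfolding z_def
  proof (rule prod_pos)
    fix i assume "i \<in> set_mset (mset l)"
    then have "i > 0" using length_pos by (auto simp: in_set_conv_nth)
    then show "0 < fact (count (mset l) i) * i ^ count (mset l) i" by simp
  qed
  have zw: "partition_weight (mset l) = 1 / real z"
    by (simp add: partition_weight_def z_def prod_dividef)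
  have fin: "finite S" by (rule finite_subset[OF S finite_torus])
  have "card S \<le> card (?R \<union> ?N)" by (rule card_mono) (use S fin finite_torus in auto)
  also have "\<dots> \<le> card ?R + card ?N" by (rule card_Un_le)
  finally have "real (card S) \<le> real (card ?R) + real (card ?N)" by linarith
  moreover have "real (card ?N) \<le> 4 * real n ^ 2 / real q * ?T"
  proof -
    have "real q * real (card ?N) \<le> 4 * real n ^ 2 * ?T"
      using of_nat_mono[OF card_nonregular_le] by (simp only: of_nat_mult of_nat_power of_nat_numeral)
    then show ?thesis using q0 by (simp add: field_simps)
  qed
  ultimately have R: "(\<rho> - 4 * real n ^ 2 / real q) * ?T \<le> real (card ?R)"
    using rho by (simp add: algebra_simps)
  have "card (centralizer s) \<le> z"
    unfolding centralizer_def z_def by (rule card_centralizer_le) (rule cycle_system_axioms)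
  then have "card (centralizer s) * card (torus s) * x \<le> z * card (torus s) * x"
    by (intro mult_right_mono) auto
  moreover have "card unitaries * card ?R \<le> card (centralizer s) * card (torus s) * x"
    unfolding x_def by (rule card_conj_set[OF s_perm f finite_torus]) (use S in auto)
  ultimately have "card unitaries * card ?R \<le> z * card (torus s) * x" by linarith
  from of_nat_mono[OF this] have "?U * real (card ?R) \<le> real z * ?T * real x"
    by (simp only: of_nat_mult)
  moreover have "?U * ((\<rho> - 4 * real n ^ 2 / real q) * ?T) \<le> ?U * real (card ?R)"
    using R by (rule mult_left_mono) simp
  ultimately have "?U * (\<rho> - 4 * real n ^ 2 / real q) * ?T \<le> real z * real x * ?T"
    by (simp add: mult_ac)
  then have "?U * (\<rho> - 4 * real n ^ 2 / real q) \<le> real z * real x"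
    using T0 by (rule mult_right_le_imp_le)
  then show ?thesis using z0 unfolding zw x_def[symmetric] by (simp add: field_simps)
qed

end

context matrix_space
begin

text \<open>The proportion of m-th powers in a torus of type \<mu>.\<close>

definition power_density :: "nat \<Rightarrow> nat multiset \<Rightarrow> real" where
  "power_density m \<mu> = (\<Prod>i\<in>set_mset \<mu>. (1 / real (gcd m (torus_order i))) ^ count \<mu> i)"

lemma ex_sets_of_cycle_type:
  assumes mu: "\<mu> \<in> partitions_of n" and m: "m > 0"
  defines "\<delta> \<equiv> 4 * real n ^ 2 / real q"
  shows "\<exists>A B. of_cycle_type \<mu> A \<and> of_cycle_type \<mu> B \<and> A \<subseteq> unitary_powers m \<and>
    B \<subseteq> unitaries - unitary_powers m \<and>
    real (card unitaries) * (partition_weight \<mu> * (power_density m \<mu> - \<delta>)) \<le> real (card A) \<and>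
    real (card unitaries) * (partition_weight \<mu> * (1 - power_density m \<mu> - \<delta>)) \<le> real (card B)"
proof -
  obtain l where l: "mset l = \<mu>" using ex_mset by blast
  have "0 \<notin> set l" "sum_list l = n"
    using mu by (auto simp: partitions_of_def simp flip: l sum_mset_sum_list)
  then obtain s e where cs: "cycle_system n l s e" using ex_cycle_system by blast
  interpret cycle_system n l s e by (rule cs)
  interpret cycle_torus L q n l s e ..
  obtain g where f: "frame s g" using ex_cycle_frame by blast
  have P_sub: "torus_powers m \<subseteq> torus s" by (auto simp: torus_powers_def)
  have dens: "power_density m \<mu> = (\<Prod>b<length l. 1 / real (gcd m (torus_order (l ! b))))"
    using prod_nth_eq_prod_count[of "\<lambda>i. 1 / real (gcd m (torus_order i))" l]
    by (simp add: power_density_def l)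
  have cP: "real (card (torus_powers m)) = power_density m \<mu> * real (card (torus s))"
    unfolding dens card_torus_powers[OF m] by simp
  have cQ: "real (card (torus s - torus_powers m)) = (1 - power_density m \<mu>) * real (card (torus s))"
    using cP card_Diff_subset[OF finite_subset[OF P_sub finite_torus] P_sub] card_mono[OF finite_torus P_sub]
    by (simp add: of_nat_diff algebra_simps)
  let ?A = "conj_set g {d \<in> torus_powers m. inj_on d {..<n}}"
  let ?B = "conj_set g {d \<in> torus s - torus_powers m. inj_on d {..<n}}"
  have "of_cycle_type \<mu> (conj_set g {d \<in> S. inj_on d {..<n}})" if "S \<subseteq> torus s" for S
    unfolding of_cycle_type_def
    by (rule exI[of _ l], rule exI[of _ s], rule exI[of _ e], rule exI[of _ g],
        rule exI[of _ "{d \<in> S. inj_on d {..<n}}"]) (use l cs f that in auto)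
  then have "of_cycle_type \<mu> ?A" "of_cycle_type \<mu> ?B" using P_sub by blast+
  moreover have "?A \<subseteq> unitary_powers m" by (rule conj_set_powers_subset[OF f]) auto
  moreover have "?B \<subseteq> unitaries - unitary_powers m"
    using conj_set_unitary[OF s_perm f, of "{d \<in> torus s - torus_powers m. inj_on d {..<n}}"]
      conj_set_nonpowers_disjoint[OF f, of "{d \<in> torus s - torus_powers m. inj_on d {..<n}}" m]
    by blast
  ultimately show ?thesis
    using card_conj_set_ge[OF f P_sub cP] card_conj_set_ge[OF f _ cQ] unfolding l \<delta>_def by blast
qed

lemma unitary_powers_density:
  assumes m: "m > 0"
  shows "\<bar>real (card (unitary_powers m)) / real (card unitaries)
    - (\<Sum>\<mu>\<in>partitions_of n. partition_weight \<mu> * power_density m \<mu>)\<bar> \<le> 4 * real n ^ 2 / real q"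
proof -
  define \<delta> where "\<delta> = 4 * real n ^ 2 / real q"
  let ?P = "partitions_of n" and ?U = "real (card unitaries)" and ?w = partition_weight
  have "\<forall>\<mu>\<in>?P. \<exists>AB. of_cycle_type \<mu> (fst AB) \<and> of_cycle_type \<mu> (snd AB) \<and> fst AB \<subseteq> unitary_powers m \<and>
    snd AB \<subseteq> unitaries - unitary_powers m \<and>
    ?U * (?w \<mu> * (power_density m \<mu> - \<delta>)) \<le> real (card (fst AB)) \<and>
    ?U * (?w \<mu> * (1 - power_density m \<mu> - \<delta>)) \<le> real (card (snd AB))"
    using ex_sets_of_cycle_type[OF _ m] unfolding \<delta>_def by (metis fst_conv snd_conv)
  from bchoice[OF this] obtain AB where AB: "\<And>\<mu>. \<mu> \<in> ?P \<Longrightarrow> of_cycle_type \<mu> (fst (AB \<mu>))"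
    "\<And>\<mu>. \<mu> \<in> ?P \<Longrightarrow> of_cycle_type \<mu> (snd (AB \<mu>))" "\<And>\<mu>. \<mu> \<in> ?P \<Longrightarrow> fst (AB \<mu>) \<subseteq> unitary_powers m"
    "\<And>\<mu>. \<mu> \<in> ?P \<Longrightarrow> snd (AB \<mu>) \<subseteq> unitaries - unitary_powers m"
    "\<And>\<mu>. \<mu> \<in> ?P \<Longrightarrow> ?U * (?w \<mu> * (power_density m \<mu> - \<delta>)) \<le> real (card (fst (AB \<mu>)))"
    "\<And>\<mu>. \<mu> \<in> ?P \<Longrightarrow> ?U * (?w \<mu> * (1 - power_density m \<mu> - \<delta>)) \<le> real (card (snd (AB \<mu>)))"
    by auto
  have fin: "finite (unitary_powers m)" "finite (unitaries - unitary_powers m)"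
    using finite_unitaries by (auto simp: unitary_powers_def)
  have sub: "unitary_powers m \<subseteq> unitaries"
    using unitary_pow_closed by (auto simp: unitary_powers_def)
  \<comment> \<open>The weights add up to one, so the errors of the single types add up to \<delta>
    itself, independently of the number of partitions.\<close>
  have sums: "(\<Sum>\<mu>\<in>?P. ?U * (?w \<mu> * (\<rho> \<mu> - \<delta>))) = ?U * ((\<Sum>\<mu>\<in>?P. ?w \<mu> * \<rho> \<mu>) - \<delta>)" for \<rho>
    using sum_partition_weight[of n]
    by (simp add: right_diff_distrib sum_subtractf flip: sum_distrib_left sum_distrib_right)
  have "?U * ((\<Sum>\<mu>\<in>?P. ?w \<mu> * power_density m \<mu>) - \<delta>) \<le> (\<Sum>\<mu>\<in>?P. real (card (fst (AB \<mu>))))"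
    unfolding sums[symmetric] by (rule sum_mono) (rule AB(5))
  also have "\<dots> = real (card (\<Union>\<mu>\<in>?P. fst (AB \<mu>)))"
  proof -
    have "card (\<Union>\<mu>\<in>?P. fst (AB \<mu>)) = (\<Sum>\<mu>\<in>?P. card (fst (AB \<mu>)))"
    proof (rule card_UN_disjoint)
      show "\<forall>\<mu>\<in>?P. finite (fst (AB \<mu>))" using finite_subset[OF AB(3) fin(1)] by blast
      show "\<forall>\<mu>\<in>?P. \<forall>\<nu>\<in>?P. \<mu> \<noteq> \<nu> \<longrightarrow> fst (AB \<mu>) \<inter> fst (AB \<nu>) = {}"
        using of_cycle_type_disjoint[OF AB(1) AB(1)] by blast
    qed (rule finite_partitions_of)
    then show ?thesis by simp
  qed
  also have "\<dots> \<le> real (card (unitary_powers m))"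
    using AB(3) fin by (intro of_nat_mono card_mono) auto
  finally have lower: "?U * ((\<Sum>\<mu>\<in>?P. ?w \<mu> * power_density m \<mu>) - \<delta>) \<le> real (card (unitary_powers m))" .
  have "?U * ((\<Sum>\<mu>\<in>?P. ?w \<mu> * (1 - power_density m \<mu>)) - \<delta>) \<le> (\<Sum>\<mu>\<in>?P. real (card (snd (AB \<mu>))))"
    unfolding sums[symmetric] by (rule sum_mono) (rule AB(6))
  also have "\<dots> = real (card (\<Union>\<mu>\<in>?P. snd (AB \<mu>)))"
  proof -
    have "card (\<Union>\<mu>\<in>?P. snd (AB \<mu>)) = (\<Sum>\<mu>\<in>?P. card (snd (AB \<mu>)))"
    proof (rule card_UN_disjoint)
      show "\<forall>\<mu>\<in>?P. finite (snd (AB \<mu>))" using finite_subset[OF AB(4) fin(2)] by blast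
      show "\<forall>\<mu>\<in>?P. \<forall>\<nu>\<in>?P. \<mu> \<noteq> \<nu> \<longrightarrow> snd (AB \<mu>) \<inter> snd (AB \<nu>) = {}"
        using of_cycle_type_disjoint[OF AB(2) AB(2)] by blast
    qed (rule finite_partitions_of)
    then show ?thesis by simp
  qed
  also have "\<dots> \<le> real (card (unitaries - unitary_powers m))"
    using AB(4) fin by (intro of_nat_mono card_mono) blast+
  also have "\<dots> = ?U - real (card (unitary_powers m))"
    using card_Diff_subset[OF fin(1) sub] card_mono[OF finite_unitaries sub] by (simp add: of_nat_diff)
  finally have "?U * ((\<Sum>\<mu>\<in>?P. ?w \<mu> * (1 - power_density m \<mu>)) - \<delta>) \<le> ?U - real (card (unitary_powers m))" .
  moreover have "(\<Sum>\<mu>\<in>?P. ?w \<mu> * (1 - power_density m \<mu>)) = 1 - (\<Sum>\<mu>\<in>?P. ?w \<mu> * power_density m \<mu>)"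
    using sum_partition_weight[of n] by (simp add: right_diff_distrib sum_subtractf)
  ultimately have "?U * (1 - (\<Sum>\<mu>\<in>?P. ?w \<mu> * power_density m \<mu>) - \<delta>) \<le> ?U - real (card (unitary_powers m))"
    by (simp only:)
  moreover have "x \<le> u * (a + \<delta>)" if "u * (1 - a - \<delta>) \<le> u - x" for x u a
    using that by (simp add: algebra_simps)
  ultimately have upper: "real (card (unitary_powers m)) \<le> ?U * ((\<Sum>\<mu>\<in>?P. ?w \<mu> * power_density m \<mu>) + \<delta>)"
    by blast
  have U0: "?U > 0" using one_unitary finite_unitaries by (auto simp: card_gt_0_iff)
  have "(\<Sum>\<mu>\<in>?P. ?w \<mu> * power_density m \<mu>) - \<delta> \<le> real (card (unitary_powers m)) / ?U"
    using lower U0 by (simp add: pos_le_divide_eq mult.commute)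
  moreover have "real (card (unitary_powers m)) / ?U \<le> (\<Sum>\<mu>\<in>?P. ?w \<mu> * power_density m \<mu>) + \<delta>"
    using upper U0 by (simp add: pos_divide_le_eq mult.commute)
  ultimately show ?thesis unfolding \<delta>_def by linarith
qed

lemma partition_term_eq:
  assumes "\<mu> \<in> partitions_of n"
  shows "(\<Prod>i\<in>set_mset \<mu>. 1 / (fact (count \<mu> i) * real i ^ count \<mu> i
      * real_of_int (gcd (int m) (int q ^ i - (- 1) ^ i)) ^ count \<mu> i))
    = partition_weight \<mu> * power_density m \<mu>"
  unfolding partition_weight_def power_density_def prod.distrib[symmetric]
proof (rule prod.cong)
  fix i assume "i \<in> set_mset \<mu>"
  then have "i > 0" using assms by (auto simp: partitions_of_def intro!: Nat.gr0I)
  then have "gcd (int m) (int q ^ i - (- 1) ^ i) = int (gcd m (torus_order i))"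
    by (simp flip: int_torus_order)
  then show "1 / (fact (count \<mu> i) * real i ^ count \<mu> i * real_of_int (gcd (int m) (int q ^ i - (- 1) ^ i)) ^ count \<mu> i)
    = 1 / (fact (count \<mu> i) * real i ^ count \<mu> i) * (1 / real (gcd m (torus_order i))) ^ count \<mu> i"
    by (simp add: power_divide)
qed simp

end

text \<open>The additive group of K has order q, so q times one vanishes by Lagrange's
  theorem.\<close>

lemma closed_field_prime_powerI:
  assumes "primepow q" "algebraic_closure L K" "card K = q"
  shows "closed_field_prime_power L q"
proof -
  interpret algebraic_closure L K by (rule assms(2))
  have sub: "subgroup K (add_monoid L)" using subfieldE(1)[OF subfield_axioms] subring.axioms(1) by blast
  interpret A: group "(add_monoid L)\<lparr>carrier := K\<rparr>"
    by (rule subgroup.subgroup_is_group[OF sub]) (rule add.is_group)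
  have one: "\<one>\<^bsub>L\<^esub> \<in> K" using subfieldE(2) subfield_axioms subringE(3)[OF subfieldE(1)[OF subfield_axioms]] by blast
  have "\<one>\<^bsub>L\<^esub> [^]\<^bsub>(add_monoid L)\<lparr>carrier := K\<rparr>\<^esub> order ((add_monoid L)\<lparr>carrier := K\<rparr>) = \<zero>\<^bsub>L\<^esub>"
    using A.pow_order_eq_1[of "\<one>\<^bsub>L\<^esub>"] one by simp
  then have "[q] \<cdot>\<^bsub>L\<^esub> \<one>\<^bsub>L\<^esub> = \<zero>\<^bsub>L\<^esub>"
    using assms(3) by (simp add: order_def add_pow_def nat_pow_def)
  then show ?thesis using assms(1) by unfold_locales
qed

theorem proposition5p1:
  fixes n M :: nat
  assumes "n \<ge> 1" and "M \<ge> 2"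
  shows "\<exists>C::real. \<forall>(q::nat) (L::'a ring) (K::'a set).
    primepow q \<longrightarrow> algebraic_closure L K \<longrightarrow> card K = q \<longrightarrow>
    \<bar>real (card (power_image (unitary_group L n q) M)) / real (order (unitary_group L n q))
      - (\<Sum>\<mu>\<in>partitions_of n. \<Prod>i\<in>set_mset \<mu>.
           1 / (fact (count \<mu> i) * real i ^ count \<mu> i
                * real_of_int (gcd (int M) (int q ^ i - (- 1) ^ i)) ^ count \<mu> i))\<bar>
    \<le> C / real q"
proof (rule exI[of _ "4 * real n ^ 2"], intro allI impI)
  fix q :: nat and L :: "'a ring" and K :: "'a set"
  assume "primepow q" "algebraic_closure L K" "card K = q"
  then interpret closed_field_prime_power L q by (rule closed_field_prime_powerI)
  interpret matrix_space L q n ..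
  have "power_image (unitary_group L n q) M = unitary_powers M"
    by (simp add: power_image_def unitary_powers_def carrier_unitary_group pow_unitary_group)
  moreover have "order (unitary_group L n q) = card unitaries"
    by (simp add: order_def carrier_unitary_group)
  moreover have "(\<Sum>\<mu>\<in>partitions_of n. \<Prod>i\<in>set_mset \<mu>.
           1 / (fact (count \<mu> i) * real i ^ count \<mu> i
                * real_of_int (gcd (int M) (int q ^ i - (- 1) ^ i)) ^ count \<mu> i))
      = (\<Sum>\<mu>\<in>partitions_of n. partition_weight \<mu> * power_density M \<mu>)"
    by (rule sum.cong) (auto simp: partition_term_eq)
  ultimately show "\<bar>real (card (power_image (unitary_group L n q) M)) / real (order (unitary_group L n q))
      - (\<Sum>\<mu>\<in>partitions_of n. \<Prod>i\<in>set_mset \<mu>.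
           1 / (fact (count \<mu> i) * real i ^ count \<mu> i
                * real_of_int (gcd (int M) (int q ^ i - (- 1) ^ i)) ^ count \<mu> i))\<bar>
    \<le> 4 * real n ^ 2 / real q"
    using unitary_powers_density[of M] assms(2) by simp
qed

end
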